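(* Assume that the collision kernel has separated form with exponent $\beta\in(1-D,0]$. Let $t_0\in\mathbb R$, let $\mathcal M$ be a global Maxwellian, and let $F_1,F_2$ be mild solutions of the Boltzmann equation defined a.e. on $\mathbb R^D\times\mathbb R^D\times(t_0,+\infty)$ (resp. on $\mathbb R^D\times\mathbb R^D\times(-\infty,t_0)$) satisfying $$|F_1(v,x,t)|\le\mathcal M(v,x,t)\quad\text{and}\quad|F_2(v,x,t)|\le\mathcal M(v,x,t)$$ for a.e. $(v,x,t)\in\mathbb R^D\times\mathbb R^D\times(t_0,+\infty)$ (resp. $\mathbb R^D\times\mathbb R^D\times(-\infty,t_0)$). Let $F_j^{+\infty}\equiv F_j^{+\infty}(v,x)$ (resp. $F_j^{-\infty}\equiv F_j^{-\infty}(v,x)$) be such that $$\|F_j(t)-e^{-(t-t_0)\mathsf A}F_j^{+\infty}\|_{L^1(\mathbb R^D\times\mathbb R^D)}\to0\ \text{ as }t\to+\infty,\quad j=1,2$$ (resp. $\|F_j(t)-e^{-(t-t_0)\mathsf A}F_j^{-\infty}\|_{L^1(\mathbb R^D\times\mathbb R^D)}\to0$ as $t\to-\infty$, $j=1,2$). Then $$|F_1(t)-F_2(t)|_{\mathcal M(t)}\le|F_1^{+\infty}-F_2^{+\infty}|_{\mathcal M(t_0)}\,e^{4\mu(\mathcal M)}\quad\text{for all }t>t_0$$ (resp. $|F_1(t)-F_2(t)|_{\mathcal M(t)}\le|F_1^{-\infty}-F_2^{-\infty}|_{\mathcal M(t_0)}\,e^{4\mu(\mathcal M)}$ for all $t<t_0$).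 In particular, if $F_1^{+\infty}=F_2^{+\infty}$ (resp. $F_1^{-\infty}=F_2^{-\infty}$) a.e. on $\mathbb R^D\times\mathbb R^D$, then $F_1(v,x,t)=F_2(v,x,t)$ for a.e. $(v,x)\in\mathbb R^D\times\mathbb R^D$, for all $t>t_0$ (resp. all $t<t_0$).
   Context: Collision kernel and collision integral. $D\ge1$ is an integer. A collision kernel of separated form with exponent $\beta$ is $\mathsf b(z,\omega)=|z|^\beta\hat{\mathsf b}(\omega\cdot z/|z|)$, $z\in\mathbb R^D$, $\omega\in\mathbb S^{D-1}$, where $\hat{\mathsf b}\ge0$ is measurable and $\bar{\mathsf b}:=\int_{\mathbb S^{D-1}}\hat{\mathsf b}(\omega\cdot n)\,d\omega<\infty$ ($n$ any unit vector). With $v'=v-((v-v_* )\cdot\omega)\omega$ and $v_*'=v_*+((v-v_* )\cdot\omega)\omega$, the collision integral is $$\mathcal B(F,F)(v,x,t)=\iint_{\mathbb S^{D-1}\times\mathbb R^D}\big(F(v',x,t)F(v'_*,x,t)-F(v,x,t)F(v_*,x,t)\big)\mathsf b(v-v_*,\omega)\,d\omega\,dv_*,$$ and $\mathcal A(F)(v,x,t):=\bar{\mathsf b}\int_{\mathbb R^D}F(v_*,x,t)|v-v_*|^\beta\,dv_*$. The Boltzmann equation is $\partial_tF+v\cdot\nabla_xF=\mathcal B(F,F)$. Functions $F$ are real valued. Global Maxwellians (of finite mass) are the functions $$\mathcal M(v,x,t)=\frac{m}{(2\pi)^D}\sqrt{\det Q}\;e^{-q(v-v_0,x-x_0,t)},\qquad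 q(v,x,t)=\tfrac12\big(c|v|^2+a|x-tv|^2+2b(x-tv)\cdot v\big)-v\cdot B(x-tv),$$ with $m,a,c>0$, $b\in\mathbb R$, $x_0,v_0\in\mathbb R^D$, $B$ a real skew-symmetric $D\times D$ matrix such that $Q:=(ac-b^2)I+B^2$ is positive definite. They satisfy $\partial_t\mathcal M+v\cdot\nabla_x\mathcal M=0$ and $\mathcal B(\mathcal M,\mathcal M)=0$. $\mathcal M(t)$ denotes $(v,x)\mapsto\mathcal M(v,x,t)$. The constant $\mu$: for $\beta\in(1-D,0]$, $\mu(\mathcal M):=\int_{\mathbb R}\|\mathcal A(\mathcal M)(t)\|_{L^\infty(\mathbb R^D\times\mathbb R^D)}\,dt$, which is finite. Norm: $|f|_{\mathcal M(t)}:=\|f/\mathcal M(t)\|_{L^\infty(\mathbb R^D\times\mathbb R^D)}$ for $t\in\mathbb R$. Mild solutions: $e^{t\mathsf A}$ is defined by $(e^{t\mathsf A}\phi)(v,x)=\phi(v,x+tv)$. A mild solution on $\mathbb R^D\times\mathbb R^D\times I$ ($I\subset\mathbb R$ an interval) is $F\in L^1_{loc}(\mathbb R^D\times\mathbb R^D\times I)$ with $\mathcal B(F,F)\in L^1_{loc}(\mathbb R^D\times\mathbb R^D\times I)$ and $$e^{t_2\mathsf A}F(v,x,t_2)=e^{t_1\mathsf A}F(v,x,t_1)+\int_{t_1}^{t_2}e^{s\mathsf A}\mathcal B(F,F)(v,x,s)\,ds$$ for a.e. $(v,x)\in\mathbb R^D\times\mathbb R^D$ and all $t_1,t_2\in I$.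 $F$ is identified with its representative in $C(I;L^1_{loc}(\mathbb R^D\times\mathbb R^D))$, and $F(t)$ denotes $(v,x)\mapsto F(v,x,t)$. *)

theory Defs
  imports "HOL-Analysis.Analysis" "HOL-Probability.Essential_Supremum"
begin

text \<open>Throughout, velocities and positions live in \<open>real ^ 'n\<close>, so that \<open>D = CARD('n) \<ge> 1\<close>.
  Phase-space functions are written curried, velocity first: \<open>\<phi> v x\<close> and \<open>F v x t\<close>.
  Integrals and null sets refer to complete measures (\<open>lebesgue\<close>, \<open>completion\<close>), so that
  nothing depends on the choice of a representative of a Lebesgue class.\<close>


section \<open>Collision kernel and collision integral\<close>

text \<open>Unnormalized surface measure on the unit sphere, as the push-forward of \<open>D\<close> times Lebesgue
  measure on the unit ball under radial projection (\<open>sgn x = x / norm x\<close>); thus a Borel set \<open>A\<close>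
  gets \<open>D\<close> times the volume of the cone \<open>{r \<omega> | 0 < r < 1, \<omega> \<in> A}\<close>. For \<open>D = 1\<close> this is counting
  measure on the two points of the sphere.\<close>

definition surface_measure :: "(real ^ 'n) measure" where
  "surface_measure =
     scale_measure (of_nat CARD('n))
       (distr (restrict_space lborel (ball 0 1 - {0})) (restrict_space borel (sphere 0 1)) sgn)"

text \<open>The value of \<open>b z \<omega>\<close> is only prescribed for \<open>z \<noteq> 0\<close>, where the formula makes sense.
  The angular factor \<open>bh\<close> is a function on \<open>[-1, 1]\<close>; its values elsewhere are irrelevant.\<close>

definition separated_kernel :: "real \<Rightarrow> (real \<Rightarrow> real) \<Rightarrow> (real ^ 'n \<Rightarrow> real ^ 'n \<Rightarrow> real) \<Rightarrow> bool" where
  "separated_kernel \<beta> bh b \<longleftrightarrow>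
     (\<forall>s\<in>{-1..1}. 0 \<le> bh s) \<and>
     bh \<in> borel_measurable (lebesgue_on {-1..1}) \<and>
     (\<forall>n :: real ^ 'n. norm n = 1 \<longrightarrow> integrable (completion surface_measure) (\<lambda>\<omega>. bh (\<omega> \<bullet> n))) \<and>
     (\<forall>z \<omega>. z \<noteq> 0 \<longrightarrow> norm \<omega> = 1 \<longrightarrow> b z \<omega> = norm z powr \<beta> * bh (\<omega> \<bullet> (z /\<^sub>R norm z)))"

text \<open>By rotation invariance the following does not depend on the unit vector \<open>n\<close>.\<close>

definition angular_mass :: "(real \<Rightarrow> real) \<Rightarrow> real ^ 'n \<Rightarrow> real" where
  "angular_mass bh n = (LINT \<omega>|completion surface_measure. bh (\<omega> \<bullet> n))"

definition post_v :: "real ^ 'n \<Rightarrow> real ^ 'n \<Rightarrow> real ^ 'n \<Rightarrow> real ^ 'n" where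
  "post_v v vs \<omega> = v - ((v - vs) \<bullet> \<omega>) *\<^sub>R \<omega>"

definition post_vs :: "real ^ 'n \<Rightarrow> real ^ 'n \<Rightarrow> real ^ 'n \<Rightarrow> real ^ 'n" where
  "post_vs v vs \<omega> = vs + ((v - vs) \<bullet> \<omega>) *\<^sub>R \<omega>"

definition collision_integrand ::
  "(real ^ 'n \<Rightarrow> real ^ 'n \<Rightarrow> real) \<Rightarrow> (real ^ 'n \<Rightarrow> real ^ 'n \<Rightarrow> real \<Rightarrow> real) \<Rightarrow>
   real ^ 'n \<Rightarrow> real ^ 'n \<Rightarrow> real \<Rightarrow> (real ^ 'n) \<times> (real ^ 'n) \<Rightarrow> real" where
  "collision_integrand b F v x t = (\<lambda>(\<omega>, vs).
     (F (post_v v vs \<omega>) x t * F (post_vs v vs \<omega>) x t - F v x t * F vs x t) * b (v - vs) \<omega>)"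

definition collision ::
  "(real ^ 'n \<Rightarrow> real ^ 'n \<Rightarrow> real) \<Rightarrow> (real ^ 'n \<Rightarrow> real ^ 'n \<Rightarrow> real \<Rightarrow> real) \<Rightarrow>
   real ^ 'n \<Rightarrow> real ^ 'n \<Rightarrow> real \<Rightarrow> real" where
  "collision b F v x t =
     integral\<^sup>L (completion (surface_measure \<Otimes>\<^sub>M lborel)) (collision_integrand b F v x t)"

definition attenuation ::
  "real \<Rightarrow> (real \<Rightarrow> real) \<Rightarrow> (real ^ 'n \<Rightarrow> real ^ 'n \<Rightarrow> real \<Rightarrow> real) \<Rightarrow>
   real ^ 'n \<Rightarrow> real ^ 'n \<Rightarrow> real \<Rightarrow> real" where
  "attenuation \<beta> bh F v x t =
     angular_mass bh (SOME n :: real ^ 'n. norm n = 1) *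
     (LINT vs|lebesgue. F vs x t * norm (v - vs) powr \<beta>)"


section \<open>Global Maxwellians\<close>

definition Maxwellian_Q :: "real \<Rightarrow> real \<Rightarrow> real \<Rightarrow> real ^ 'n ^ 'n \<Rightarrow> real ^ 'n ^ 'n" where
  "Maxwellian_Q a b c B = (a * c - b\<^sup>2) *\<^sub>R mat 1 + B ** B"

definition Maxwellian_q ::
  "real \<Rightarrow> real \<Rightarrow> real \<Rightarrow> real ^ 'n ^ 'n \<Rightarrow> real ^ 'n \<Rightarrow> real ^ 'n \<Rightarrow> real \<Rightarrow> real" where
  "Maxwellian_q a b c B v x t =
     (c * (norm v)\<^sup>2 + a * (norm (x - t *\<^sub>R v))\<^sup>2 + 2 * b * ((x - t *\<^sub>R v) \<bullet> v)) / 2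
     - v \<bullet> (B *v (x - t *\<^sub>R v))"

definition global_Maxwellian :: "(real ^ 'n \<Rightarrow> real ^ 'n \<Rightarrow> real \<Rightarrow> real) \<Rightarrow> bool" where
  "global_Maxwellian M \<longleftrightarrow>
     (\<exists>m a b c x0 v0 B.
        0 < m \<and> 0 < a \<and> 0 < c \<and> transpose B = - B \<and>
        (\<forall>y. y \<noteq> 0 \<longrightarrow> 0 < y \<bullet> (Maxwellian_Q a b c B *v y)) \<and>
        (\<forall>v x t. M v x t =
           m / (2 * pi) ^ CARD('n) * sqrt (det (Maxwellian_Q a b c B)) *
           exp (- Maxwellian_q a b c B (v - v0) (x - x0) t)))"


section \<open>Norms and function spaces\<close>

definition L1_norm :: "(real ^ 'n \<Rightarrow> real ^ 'n \<Rightarrow> real) \<Rightarrow> ennreal" where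
  "L1_norm \<phi> = (\<integral>\<^sup>+(v, x). ennreal \<bar>\<phi> v x\<bar> \<partial>lebesgue)"

definition Linf_norm :: "(real ^ 'n \<Rightarrow> real ^ 'n \<Rightarrow> real) \<Rightarrow> ennreal" where
  "Linf_norm \<phi> = esssup lebesgue (\<lambda>(v, x). ennreal \<bar>\<phi> v x\<bar>)"

definition weighted_norm ::
  "(real ^ 'n \<Rightarrow> real ^ 'n \<Rightarrow> real \<Rightarrow> real) \<Rightarrow> real \<Rightarrow> (real ^ 'n \<Rightarrow> real ^ 'n \<Rightarrow> real) \<Rightarrow> ennreal" where
  "weighted_norm M t \<phi> = Linf_norm (\<lambda>v x. \<phi> v x / M v x t)"

definition L1_loc :: "'a::euclidean_space set \<Rightarrow> ('a \<Rightarrow> real) \<Rightarrow> bool" where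
  "L1_loc S f \<longleftrightarrow> (\<forall>K. compact K \<longrightarrow> K \<subseteq> S \<longrightarrow> f absolutely_integrable_on K)"

text \<open>For a global Maxwellian and \<open>1 - D < \<beta> \<le> 0\<close> the integral below is finite, so that
  the conversion to a real number loses nothing.\<close>

definition mu :: "real \<Rightarrow> (real \<Rightarrow> real) \<Rightarrow> (real ^ 'n \<Rightarrow> real ^ 'n \<Rightarrow> real \<Rightarrow> real) \<Rightarrow> real" where
  "mu \<beta> bh M = enn2real (\<integral>\<^sup>+t. Linf_norm (\<lambda>v x. attenuation \<beta> bh M v x t) \<partial>lborel)"


section \<open>Mild solutions\<close>

text \<open>\<open>transport t\<close> is the group element \<open>e^{tA}\<close>.\<close>

definition transport :: "real \<Rightarrow> (real ^ 'n \<Rightarrow> real ^ 'n \<Rightarrow> real) \<Rightarrow> real ^ 'n \<Rightarrow> real ^ 'n \<Rightarrow> real" where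
  "transport t \<phi> v x = \<phi> v (x + t *\<^sub>R v)"

text \<open>Membership of the collision integral in \<open>L1_loc\<close> tacitly includes that it is defined, i.e.
  absolutely convergent, almost everywhere; since \<open>integral\<^sup>L\<close> is total this is stated separately.
  The Duhamel formula is required for all \<open>t1\<close>, \<open>t2\<close> and, given these, for almost every \<open>(v, x)\<close>:
  this singles out the representative of \<open>F\<close> that is continuous in time with values in \<open>L1_loc\<close>,
  each \<open>F(t)\<close> being a class modulo null sets of \<open>(v, x)\<close>.\<close>

definition mild_solution ::
  "(real ^ 'n \<Rightarrow> real ^ 'n \<Rightarrow> real) \<Rightarrow> real set \<Rightarrow> (real ^ 'n \<Rightarrow> real ^ 'n \<Rightarrow> real \<Rightarrow> real) \<Rightarrow> bool" where
  "mild_solution b I F \<longleftrightarrow>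
     L1_loc (UNIV \<times> UNIV \<times> I) (\<lambda>(v, x, t). F v x t) \<and>
     (AE (v, x, t) in lebesgue. t \<in> I \<longrightarrow>
        integrable (completion (surface_measure \<Otimes>\<^sub>M lborel)) (collision_integrand b F v x t)) \<and>
     L1_loc (UNIV \<times> UNIV \<times> I) (\<lambda>(v, x, t). collision b F v x t) \<and>
     (\<forall>t1\<in>I. \<forall>t2\<in>I. AE (v, x) in lebesgue.
        transport t2 (\<lambda>v x. F v x t2) v x =
        transport t1 (\<lambda>v x. F v x t1) v x +
        (LINT s=t1..t2|lebesgue. transport s (\<lambda>v x. collision b F v x s) v x))"

end

theory Submission
  imports Defs "HOL-Probability.Distributions"
begin

text \<open>
  Along characteristics, write \<open>d = F1 - F2\<close>. If \<open>\<bar>d(s)\<bar> \<le> K M(s)\<close>, then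
  \<open>\<bar>F1' F1*' - F2' F2*'\<bar> \<le> 2 K M' M*' = 2 K M M*\<close>, so the two collision integrals differ at time
  \<open>s\<close> by at most \<open>4 K M(s) A(M)(s)\<close>. When \<open>M\<close> is constant along characteristics, Duhamel's formula
  turns this into a Gronwall inequality for the weighted norm of \<open>d\<close>, started at infinite time.

  As parametrised here (and in the source), \<open>M\<close> is constant along characteristics only if \<open>v0 = 0\<close>.
  If \<open>v0 \<noteq> 0\<close>, it tends to \<open>0\<close> along each characteristic, and a solution dominated by it
  must vanish: if \<open>\<bar>F(s)\<bar> \<le> K\<close>, then
  \<open>\<bar>F' F*'\<bar> \<le> min (K^2, M M*) \<le> K sqrt (M M*)\<close>, so the same Gronwall argument works
  with the constant weight and the integrable rate given by \<open>A(sqrt M)\<close>.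
\<close>

section \<open>A Gronwall inequality\<close>

text \<open>Convergence at infinite time is only in L1, which says nothing about the weighted
  supremum norm of \<open>d\<close>, so Gronwall cannot be started there directly. It does give
  pointwise convergence along almost every characteristic, for a sequence of times. Inserting a
  crude a priori bound into Duhamel's formula between a late time and that limit shows that the
  weighted norm at the late time exceeds the norm of the data at infinity by at most a multiple of
  the tail of the rate; Gronwall then runs from the late time, and the tail is sent to zero. The
  weighted norm is never shown to be measurable in time, so the Gronwall inequality is phrased
  through uniform bounds on time intervals and not through an integral of the norm. The null set in
  Duhamel's formula depends on the two times, so limits are taken along sequences. The rate is
  integrable because at fixed position \<open>M\<close> lies below a Gaussian in the velocity whose
  inverse variance grows like 1 + t^2; hence A(M) is bounded by a multiple of (1 + t^2)^(-(D +
  beta)/2), and beta > 1 - D is exactly what makes this integrable in time.\<close>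

lemma gronwall_interval:
  fixes N E :: "real \<Rightarrow> real"
  assumes tT: "t \<le> T" and contE: "continuous_on {t..T} E"
    and anti: "\<And>r s. t \<le> r \<Longrightarrow> r \<le> s \<Longrightarrow> s \<le> T \<Longrightarrow> E s \<le> E r"
    and N0: "\<And>s. s \<in> {t..T} \<Longrightarrow> 0 \<le> N s"
    and NC: "\<And>s. s \<in> {t..T} \<Longrightarrow> N s \<le> C"
    and step: "\<And>r s K. t \<le> r \<Longrightarrow> r \<le> s \<Longrightarrow> s \<le> T \<Longrightarrow> 0 \<le> K \<Longrightarrow>
                 (\<And>u. u \<in> {r..s} \<Longrightarrow> N u \<le> K) \<Longrightarrow> N r \<le> N s + K * (E r - E s)"
  shows "N t \<le> N T * exp (E t - E T)"
proof -
  define e where "e = E t - E T"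
  have e0: "0 \<le> e" using anti[of t T] tT by (simp add: e_def)
  have C0: "0 \<le> C" using N0[of t] NC[of t] tT by auto
  \<comment> \<open>The total mass \<open>e\<close> of the rate is cut into \<open>n\<close> pieces
    of mass \<open>d = e / n < 1\<close>. On one piece the supremum \<open>K\<close> of
    \<open>N\<close> satisfies \<open>K \<le> L + K * d\<close>, where \<open>L\<close> bounds
    \<open>N\<close> on the later pieces, so each piece costs a factor \<open>1 / (1 - d)\<close>;
    as \<open>n\<close> grows the product tends to \<open>exp e\<close>. The bound \<open>C\<close>
    keeps the suprema finite, so that \<open>K * d\<close> can be absorbed.\<close>
  have fin: "N t \<le> N T / (1 - e / real n) ^ n" if n: "e < real n" for n
  proof -
    have npos: "0 < real n" using n e0 by linarith
    define d where "d = e / real n"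
    have d: "0 \<le> d" "d < 1" using n npos e0 by (auto simp: d_def)
    have "k \<le> n \<Longrightarrow> \<forall>s\<in>{t..T}. E s - E T \<le> real k * d \<longrightarrow> N s \<le> N T / (1 - d) ^ k" for k
    proof (induction k)
      case 0
      show ?case
      proof (intro ballI impI)
        fix s assume s: "s \<in> {t..T}" "E s - E T \<le> real 0 * d"
        then have "E s - E T = 0" using anti[of s T] by auto
        moreover have "N s \<le> N T + C * (E s - E T)"
          using s NC C0 by (intro step) auto
        ultimately show "N s \<le> N T / (1 - d) ^ 0" by simp
      qed
    next
      case (Suc k)
      define L where "L = N T / (1 - d) ^ k"
      define S where "S = {s\<in>{t..T}. E s - E T \<le> real (Suc k) * d}"
      have IH: "N s \<le> L" if "s \<in> {t..T}" "E s - E T \<le> real k * d" for s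
        using Suc that by (auto simp: L_def)
      have TS: "T \<in> S" using tT d by (auto simp: S_def)
      define K where "K = Sup (N ` S)"
      have bdd: "bdd_above (N ` S)" by (rule bdd_aboveI2[of _ _ C]) (auto simp: S_def NC)
      have NK: "N s \<le> K" if "s \<in> S" for s
        unfolding K_def using that bdd by (intro cSup_upper) auto
      have K0: "0 \<le> K" using NK[OF TS] N0[of T] tT by auto
      have main: "N s \<le> L + K * d" if s: "s \<in> S" for s
      proof (cases "E s - E T \<le> real k * d")
        case True
        then have "N s \<le> L" using s by (intro IH) (auto simp: S_def)
        then show ?thesis using K0 d by (smt (verit) mult_nonneg_nonneg)
      next
        case False
        \<comment> \<open>By continuity of \<open>E\<close> there is a time \<open>s'\<close> after
          which exactly \<open>k\<close> pieces remain. From there on the bound \<open>L\<close>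
          holds, and at most one piece lies between \<open>s\<close> and \<open>s'\<close>.\<close>
        have "\<exists>s'\<ge>s. s' \<le> T \<and> E s' = E T + real k * d"
        proof (rule IVT2')
          show "continuous_on {s..T} E" using s by (intro continuous_on_subset[OF contE]) (auto simp: S_def)
        qed (use False s d in \<open>auto simp: S_def\<close>)
        then obtain s' where s': "s \<le> s'" "s' \<le> T" "E s' = E T + real k * d" by auto
        have ts: "t \<le> s" using s by (auto simp: S_def)
        have "N s \<le> N s' + K * (E s - E s')"
        proof (rule step)
          fix u assume "u \<in> {s..s'}"
          then have "u \<in> S" using anti[of s u] s s' by (auto simp: S_def)
          then show "N u \<le> K" by (rule NK)
        qed (use ts s' K0 in auto)
        moreover have "N s' \<le> L" using s' ts by (intro IH) auto
        moreover have "K * (E s - E s') \<le> K * d"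
          using s s' K0 by (intro mult_left_mono) (auto simp: S_def algebra_simps)
        ultimately show ?thesis by linarith
      qed
      have "K \<le> L + K * d" unfolding K_def
        by (rule cSup_least) (use TS main in \<open>auto simp: K_def\<close>)
      then have "K * (1 - d) \<le> L" by (simp add: algebra_simps)
      then have "K \<le> L / (1 - d)" using d by (simp add: pos_le_divide_eq)
      then have "K \<le> N T / (1 - d) ^ Suc k" by (simp add: L_def field_simps)
      then show ?case using NK by (force simp: S_def)
    qed
    from this[of n] have "N t \<le> N T / (1 - d) ^ n"
      using tT npos by (auto simp: d_def e_def)
    then show ?thesis by (simp add: d_def)
  qed
  have "((\<lambda>n. N T / (1 + (- e) / real n) ^ n) \<longlongrightarrow> N T / exp (- e)) sequentially"
    by (intro tendsto_divide tendsto_const tendsto_exp_limit_sequentially) auto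
  moreover have "eventually (\<lambda>n. N t \<le> N T / (1 + (- e) / real n) ^ n) sequentially"
  proof -
    have "eventually (\<lambda>n. e < real n) sequentially"
      using filterlim_real_sequentially filterlim_at_top_dense by blast
    then show ?thesis by eventually_elim (use fin in auto)
  qed
  ultimately have "N t \<le> N T / exp (- e)" by (rule tendsto_lowerbound) auto
  then show ?thesis by (simp add: divide_inverse exp_minus[symmetric] e_def)
qed

section \<open>Null sets and lower integrals\<close>

text \<open>For non-measurable \<open>h\<close>, \<open>nn_integral\<close> is a lower integral. This one-sided Tonelli theorem
  makes it unnecessary to know that the collision kernel is jointly measurable.\<close>

lemma (in pair_sigma_finite) nn_integral_pair_le:
  "(\<integral>\<^sup>+p. h p \<partial>(M1 \<Otimes>\<^sub>M M2)) \<le> (\<integral>\<^sup>+y. \<integral>\<^sup>+x. h (x, y) \<partial>M1 \<partial>M2)"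
  unfolding nn_integral_def[of "M1 \<Otimes>\<^sub>M M2"]
proof (rule SUP_least, clarify)
  fix g assume g: "simple_function (M1 \<Otimes>\<^sub>M M2) g" "g \<le> h"
  then have "integral\<^sup>S (M1 \<Otimes>\<^sub>M M2) g = (\<integral>\<^sup>+y. \<integral>\<^sup>+x. g (x, y) \<partial>M1 \<partial>M2)"
    by (simp add: nn_integral_eq_simple_integral[symmetric] nn_integral_snd borel_measurable_simple_function)
  also have "\<dots> \<le> (\<integral>\<^sup>+y. \<integral>\<^sup>+x. h (x, y) \<partial>M1 \<partial>M2)"
    using g(2) by (intro nn_integral_mono) (auto simp: le_fun_def)
  finally show "integral\<^sup>S (M1 \<Otimes>\<^sub>M M2) g \<le> (\<integral>\<^sup>+y. \<integral>\<^sup>+x. h (x, y) \<partial>M1 \<partial>M2)" .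
qed

text \<open>Simple functions below \<open>h\<close> pull back to functions below \<open>h\<close>
  composed with \<open>f\<close>, the change of variables is exact for them, and
  \<open>nn_integral\<close> is a supremum over them. This covers angular factors that are
  measurable only for a completed measure.\<close>

lemma nn_integral_distr_le:
  assumes f: "f \<in> M \<rightarrow>\<^sub>M N"
  shows "(\<integral>\<^sup>+y. h y \<partial>distr M N f) \<le> (\<integral>\<^sup>+x. h (f x) \<partial>M)"
  unfolding nn_integral_def[of "distr M N f"]
proof (rule SUP_least, clarify)
  fix g assume g: "simple_function (distr M N f) g" "g \<le> h"
  then have gm: "g \<in> borel_measurable N"
    using borel_measurable_simple_function by force
  have "integral\<^sup>S (distr M N f) g = (\<integral>\<^sup>+x. g (f x) \<partial>M)"
    using g gm f by (simp add: nn_integral_eq_simple_integral[symmetric] nn_integral_distr)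
  also have "\<dots> \<le> (\<integral>\<^sup>+x. h (f x) \<partial>M)"
    using g(2) by (intro nn_integral_mono) (auto simp: le_fun_def)
  finally show "integral\<^sup>S (distr M N f) g \<le> (\<integral>\<^sup>+x. h (f x) \<partial>M)" .
qed

text \<open>Only null sets matter, so no Jacobian is computed: the exceptional set lies in the image
  under \<open>L'\<close> of a negligible set, and linear images of negligible sets are negligible.
  It is applied to rotations, to the collision map and to free transport.\<close>

lemma AE_lborel_linear_bij:
  fixes L L' :: "'a::euclidean_space \<Rightarrow> 'a"
  assumes L': "linear L'" and inv: "\<And>x. L' (L x) = x" and P: "AE x in lborel. P x"
  shows "AE x in lborel. P (L x)"
proof -
  obtain N where N: "negligible N" "{x. \<not> P x} \<subseteq> N"
    using P by (auto simp: eventually_ae_filter_negligible AE_completion_iff[of _ lborel, symmetric])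
  have "negligible (L' ` N)"
    using N(1) L' by (intro negligible_differentiable_image_negligible linear_imp_differentiable_on) auto
  moreover have "{x. \<not> P (L x)} \<subseteq> L' ` N"
    using N(2) inv by (metis (mono_tags, lifting) image_eqI mem_Collect_eq subset_iff)
  ultimately show ?thesis
    by (subst AE_completion_iff[symmetric]) (auto simp: eventually_ae_filter_negligible)
qed

lemma AE_lborel_pair:
  assumes "AE p in (lborel :: ('a::euclidean_space \<times> 'b::euclidean_space) measure). P p"
  shows "AE x in lborel. AE y in lborel. P (x, y)"
  using assms unfolding lborel_prod[symmetric] by (rule lborel_pair.AE_pair)

text \<open>Integrating the indicator of the failure set over the second variable gives a measurable
  function that vanishes exactly where the a.e. statement holds.\<close>

lemma (in sigma_finite_measure) measurable_pred_AE:
  assumes [measurable]: "Measurable.pred (N \<Otimes>\<^sub>M M) P"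
  shows "Measurable.pred N (\<lambda>x. AE y in M. P (x, y))"
proof -
  have "(AE y in M. P (x, y)) \<longleftrightarrow> (\<integral>\<^sup>+y. indicator {p. \<not> P p} (x, y) \<partial>M) = 0"
    if x: "x \<in> space N" for x
  proof -
    have [measurable]: "Measurable.pred M (\<lambda>y. P (x, y))"
      using measurable_compose[OF measurable_Pair1'[OF x] assms(1)] .
    show ?thesis by (subst nn_integral_0_iff_AE) (auto simp: indicator_def)
  qed
  moreover have "Measurable.pred N (\<lambda>x. (\<integral>\<^sup>+y. indicator {p. \<not> P p} (x, y) \<partial>M) = 0)"
    by measurable
  ultimately show ?thesis by (simp cong: measurable_cong)
qed

text \<open>Fubini for null sets needs measurable predicates, while statements about solutions
  involve functions that are only Lebesgue measurable. Enclosing the exceptional set in a Borel null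
  set \<open>N\<close> lets Fubini act on the predicate of lying outside \<open>N\<close>.\<close>

lemma AE_lborel_borel_null:
  assumes "AE x in (lborel :: 'a::euclidean_space measure). P x"
  obtains N where "N \<in> sets borel" "AE x in lborel. x \<notin> N" "\<And>x. x \<notin> N \<Longrightarrow> P x"
proof -
  obtain N where "{x\<in>space lborel. \<not> P x} \<subseteq> N" "N \<in> null_sets (lborel :: 'a measure)"
    using assms by (auto simp: eventually_ae_filter)
  then show thesis by (intro that[of N]) (auto intro: AE_not_in)
qed

lemma AE_lborel_pair_iff:
  assumes P: "Measurable.pred borel P"
  shows "(AE p in (lborel :: ('a::euclidean_space \<times> 'b::euclidean_space) measure). P p)
     \<longleftrightarrow> (AE x in lborel. AE y in lborel. P (x, y))"
proof
  assume *: "AE x in lborel. AE y in lborel. P (x, y)"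
  show "AE p in lborel. P p" unfolding lborel_prod[symmetric]
    by (rule lborel_pair.AE_pair_measure)
      (use P * in \<open>simp_all only: lborel_prod pred_def sets_lborel space_lborel space_borel\<close>)
qed (rule AE_lborel_pair)

lemma AE_lborel_commute:
  assumes P: "Measurable.pred borel (\<lambda>p :: 'a::euclidean_space \<times> 'b::euclidean_space. P (fst p) (snd p))"
  shows "(AE x in lborel. AE y in lborel. P x y) \<longleftrightarrow> (AE y in lborel. AE x in lborel. P x y)"
  by (rule lborel_pair.AE_commute) (use P in \<open>simp only: lborel_prod pred_def sets_lborel space_lborel space_borel\<close>)

text \<open>Reassociating the triple makes the last variable, later the time, the second factor of a
  two-fold product; slicing in either order is then the two-variable statement. The predicate left
  after quantifying out that variable has to be shown measurable first.\<close>

lemma AE_lborel_triple_iff: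
  assumes P[measurable]: "Measurable.pred borel P"
  shows "(AE p in (lborel :: ('a::euclidean_space \<times> 'b::euclidean_space \<times> 'c::euclidean_space) measure). P p)
     \<longleftrightarrow> (AE z in lborel. AE (x, y) in lborel. P (x, y, z))" (is ?A)
    and "(AE p in (lborel :: ('a::euclidean_space \<times> 'b::euclidean_space \<times> 'c::euclidean_space) measure). P p)
     \<longleftrightarrow> (AE (x, y) in lborel. AE z in lborel. P (x, y, z))" (is ?B)
proof -
  let ?Q = "\<lambda>(p :: ('a \<times> 'b) \<times> 'c). P (fst (fst p), snd (fst p), snd p)"
  have [measurable]: "Measurable.pred (borel \<Otimes>\<^sub>M borel \<Otimes>\<^sub>M borel) P"
    using P by (simp add: borel_prod)
  have Q: "Measurable.pred borel ?Q"
    by (simp add: borel_prod[symmetric])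
  have [measurable]: "Measurable.pred borel (\<lambda>y. P (x, y))" for x
    by (simp add: borel_prod[symmetric])
  have R: "Measurable.pred borel (\<lambda>p. AE z in lborel. ?Q (p, z))"
  proof (rule lborel.measurable_pred_AE)
    have "sets (borel \<Otimes>\<^sub>M lborel) = sets (borel :: (('a \<times> 'b) \<times> 'c) measure)"
      by (simp add: borel_prod[symmetric] cong: sets_pair_measure_cong)
    then show "Measurable.pred (borel \<Otimes>\<^sub>M lborel) ?Q"
      using Q by (subst measurable_cong_sets) auto
  qed
  have *: "(AE p in lborel. P p) \<longleftrightarrow> (AE p in lborel. AE z in lborel. ?Q (p, z))"
    by (subst AE_lborel_pair_iff[OF P], subst AE_lborel_pair_iff, simp, subst AE_lborel_pair_iff[OF R]) simp
  show ?B unfolding * by (auto simp: case_prod_beta)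
  show ?A unfolding * by (subst AE_lborel_commute) (use Q in \<open>auto simp: case_prod_beta\<close>)
qed

section \<open>Surface measure and the collision map\<close>

lemma linear_borel_measurable:
  fixes U :: "'a::euclidean_space \<Rightarrow> 'b::euclidean_space"
  shows "linear U \<Longrightarrow> U \<in> borel \<rightarrow>\<^sub>M borel"
  by (rule borel_measurable_continuous_onI) (metis linear_continuous_on linear_conv_bounded_linear)

text \<open>By Vitali's covering theorem it suffices to consider balls. The library results on
  orthogonal images assume a well-ordered index type.\<close>

lemma distr_lborel_orthogonal:
  fixes U :: "real ^ 'n \<Rightarrow> real ^ 'n"
  assumes U: "orthogonal_transformation U"
  shows "distr lborel borel U = lborel"
proof (rule measure_eqI_generator_eq)
  let ?E = "{S :: (real ^ 'n) set. open S}"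
  show "Int_stable ?E" by (auto simp: Int_stable_def)
  show "sets (distr lborel borel U) = sigma_sets UNIV ?E" "sets lborel = sigma_sets UNIV ?E"
    by (simp_all add: borel_def)
  have Um[measurable]: "U \<in> borel \<rightarrow>\<^sub>M borel"
    by (rule linear_borel_measurable) (rule orthogonal_transformation_linear[OF U])
  let ?W = "inv U"
  have W: "orthogonal_transformation ?W" by (rule orthogonal_transformation_inv[OF U])
  have UW: "U (?W x) = x" and WU: "?W (U x) = x" for x
    using orthogonal_transformation_surj[OF U] orthogonal_transformation_inj[OF U]
    by (simp_all add: surj_f_inv_f inv_f_f)
  \<comment> \<open>The preimage of a ball is a ball of the same radius, and the volume of a ball
    depends only on its radius: this is where orthogonality yields equal volumes.\<close>
  have vball: "U -` ball c r = ball (?W c) r" for c r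
  proof -
    have "dist c (U x) = dist (?W c) x" for x
    proof -
      have "dist c (U x) = norm (U (?W c) - U x)" by (simp add: UW dist_norm)
      also have "U (?W c) - U x = U (?W c - x)"
        by (rule linear_diff[symmetric]) (rule orthogonal_transformation_linear[OF U])
      finally show ?thesis by (simp add: orthogonal_transformation_norm[OF U] dist_norm)
    qed
    then show ?thesis by (auto simp only: vimage_eq mem_ball)
  qed
  show "emeasure (distr lborel borel U) X = emeasure lborel X" if X: "X \<in> ?E" for X
  proof -
    define K where "K = {(c :: real ^ 'n, r). 0 < r \<and> ball c r \<subseteq> X}"
    obtain C where C: "countable C" "C \<subseteq> K"
      and disj: "pairwise (\<lambda>i j. disjnt (ball (fst i) (snd i)) (ball (fst j) (snd j))) C"
      and neg: "negligible (X - (\<Union>i\<in>C. ball (fst i) (snd i)))"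
    proof (rule Vitali_covering_theorem_balls[of X K fst snd])
      fix x and d :: real assume x: "x \<in> X" "0 < d"
      then obtain e where e: "0 < e" "ball x e \<subseteq> X" using X openE by auto
      then have "(x, min e (d/2)) \<in> K" using x by (auto simp: K_def subset_iff)
      then show "\<exists>i. i \<in> K \<and> x \<in> ball (fst i) (snd i) \<and> snd i < d"
        using e x by (intro exI[of _ "(x, min e (d/2))"]) auto
    qed
    let ?B = "\<Union>i\<in>C. ball (fst i) (snd i)"
    have "AE x in lebesgue. x \<in> X \<longleftrightarrow> x \<in> ?B"
      unfolding eventually_ae_filter_negligible using neg C(2)
      by (intro exI[of _ "X - ?B"]) (force simp: K_def)
    then have ae: "AE x in lborel. x \<in> X \<longleftrightarrow> x \<in> ?B" by (simp only: AE_completion_iff)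
    have dB: "disjoint_family_on (\<lambda>i. ball (fst i) (snd i)) C"
      using disj by (auto simp: disjoint_family_on_def pairwise_def disjnt_def)
    have "emeasure (distr lborel borel U) X = emeasure lborel (U -` X)"
      using X by (simp add: emeasure_distr)
    also have "\<dots> = emeasure lborel (\<Union>i\<in>C. U -` ball (fst i) (snd i))"
    proof (rule emeasure_eq_AE)
      show "AE x in lborel. (x \<in> U -` X) = (x \<in> (\<Union>i\<in>C. U -` ball (fst i) (snd i)))"
        using AE_lborel_linear_bij[OF orthogonal_transformation_linear[OF W] WU ae] by simp
      show "U -` X \<in> sets lborel" using X measurable_sets[OF Um, of X] by simp
      show "(\<Union>i\<in>C. U -` ball (fst i) (snd i)) \<in> sets lborel"
        unfolding vball by (intro sets.countable_UN' C) auto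
    qed
    also have "\<dots> = (\<integral>\<^sup>+i. emeasure lborel (U -` ball (fst i) (snd i)) \<partial>count_space C)"
    proof (rule emeasure_UN_countable)
      show "disjoint_family_on (\<lambda>i. U -` ball (fst i) (snd i)) C"
        using dB unfolding disjoint_family_on_def by blast
    qed (use C(1) in \<open>auto simp: vball\<close>)
    also have "\<dots> = (\<integral>\<^sup>+i. emeasure lborel (ball (fst i) (snd i)) \<partial>count_space C)"
      unfolding vball using C(2) by (intro nn_integral_cong) (auto simp: emeasure_ball K_def)
    also have "\<dots> = emeasure lborel ?B"
      using dB by (intro emeasure_UN_countable[symmetric] C) auto
    also have "\<dots> = emeasure lborel X"
      using X C(1) ae by (intro emeasure_eq_AE) auto
    finally show ?thesis .
  qed
  show "range (\<lambda>n. ball 0 (real n)) \<subseteq> ?E" "(\<Union>n. ball 0 (real n)) = UNIV"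
    using reals_Archimedean2 by auto
  show "emeasure (distr lborel borel U) (ball 0 (real i)) \<noteq> \<infinity>" for i
    by (simp add: emeasure_distr vball emeasure_ball)
qed auto

lemma space_surface_measure: "space (surface_measure :: (real ^ 'n) measure) = sphere 0 1"
  by (simp add: surface_measure_def space_scale_measure)

lemma measurable_sgn_punctured_ball:
  "sgn \<in> restrict_space lborel (ball 0 1 - {0 :: real ^ 'n}) \<rightarrow>\<^sub>M restrict_space borel (sphere 0 1)"
  by (rule measurable_restrict_space2) (auto simp: norm_sgn intro!: measurable_restrict_space1)

lemma sets_surface_measure:
  "sets (surface_measure :: (real ^ 'n) measure) = sets (restrict_space borel (sphere 0 1))"
  by (simp add: surface_measure_def)

lemma measurable_surface_ident:
  "(\<lambda>\<omega>. \<omega>) \<in> (surface_measure :: (real ^ 'n) measure) \<rightarrow>\<^sub>M borel"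
  by (subst measurable_cong_sets[OF sets_surface_measure refl]) (auto intro: measurable_restrict_space1)

lemma emeasure_surface_measure:
  fixes A :: "(real ^ 'n) set"
  assumes "A \<in> sets surface_measure"
  shows "emeasure surface_measure A =
           of_nat CARD('n) * emeasure lborel {x \<in> ball 0 1 - {0}. sgn x \<in> A}"
proof -
  have A: "A \<in> sets (restrict_space borel (sphere 0 1))" using assms by (simp add: sets_surface_measure)
  have "emeasure surface_measure A = of_nat CARD('n) *
     emeasure (restrict_space lborel (ball 0 1 - {0})) (sgn -` A \<inter> (ball 0 1 - {0}))"
    using emeasure_distr[OF measurable_sgn_punctured_ball A]
    by (simp add: surface_measure_def space_restrict_space)
  also have "emeasure (restrict_space lborel (ball 0 1 - {0})) (sgn -` A \<inter> (ball 0 1 - {0}))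
     = emeasure lborel (sgn -` A \<inter> (ball 0 1 - {0 :: real ^ 'n}))"
    by (rule emeasure_restrict_space) auto
  also have "sgn -` A \<inter> (ball 0 1 - {0}) = {x \<in> ball 0 1 - {0}. sgn x \<in> A}" by auto
  finally show ?thesis .
qed

lemma finite_measure_surface: "finite_measure (surface_measure :: (real ^ 'n) measure)"
proof (rule finite_measureI)
  have "emeasure lborel {x \<in> ball 0 1 - {0 :: real ^ 'n}. sgn x \<in> sphere 0 1}
     \<le> emeasure lborel (ball 0 1 :: (real ^ 'n) set)"
    by (rule emeasure_mono) auto
  also have "\<dots> < \<infinity>" by (simp add: emeasure_ball)
  finally have "emeasure lborel {x \<in> ball 0 1 - {0 :: real ^ 'n}. sgn x \<in> sphere 0 1} < \<infinity>" .
  moreover have "sphere 0 1 \<in> sets (surface_measure :: (real ^ 'n) measure)"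
    using sets.top[of "surface_measure :: (real ^ 'n) measure"] by (simp add: space_surface_measure)
  ultimately show "emeasure (surface_measure :: (real ^ 'n) measure) (space surface_measure) \<noteq> \<infinity>"
    unfolding space_surface_measure
    by (subst emeasure_surface_measure) (auto simp: ennreal_mult_eq_top_iff)
qed

interpretation surface: finite_measure "surface_measure :: (real ^ 'n) measure"
  by (rule finite_measure_surface)

interpretation surface_lborel: pair_sigma_finite "surface_measure :: (real ^ 'n) measure" "lborel :: 'b::euclidean_space measure" ..

lemma measurable_orthogonal_surface:
  fixes U :: "real ^ 'n \<Rightarrow> real ^ 'n"
  assumes "orthogonal_transformation U"
  shows "U \<in> surface_measure \<rightarrow>\<^sub>M surface_measure"
proof -
  have [measurable]: "U \<in> borel \<rightarrow>\<^sub>M borel"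
    by (rule linear_borel_measurable) (rule orthogonal_transformation_linear[OF assms])
  have "U \<in> restrict_space borel (sphere 0 1) \<rightarrow>\<^sub>M restrict_space borel (sphere 0 1)"
    using assms by (intro measurable_restrict_space2 measurable_restrict_space1)
      (auto simp: orthogonal_transformation_norm)
  then show ?thesis by (subst measurable_cong_sets[OF sets_surface_measure sets_surface_measure])
qed

text \<open>\<open>U\<close> commutes with radial projection, so the cone over the preimage of
  \<open>A\<close> is the preimage of the cone over \<open>A\<close>, and rotation invariance of
  Lebesgue measure carries over.\<close>

lemma distr_surface_orthogonal:
  fixes U :: "real ^ 'n \<Rightarrow> real ^ 'n"
  assumes U: "orthogonal_transformation U"
  shows "distr surface_measure surface_measure U = surface_measure"
proof (rule measure_eqI)
  fix A assume "A \<in> sets (distr surface_measure surface_measure U)"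
  then have A: "A \<in> sets surface_measure" by simp
  define S where "S = {x \<in> ball 0 1 - {0}. sgn x \<in> A}"
  have Sm: "S \<in> sets borel"
  proof -
    have "S = sgn -` A \<inter> (ball 0 1 - {0})" by (auto simp: S_def)
    moreover have "sgn -` A \<inter> space (restrict_space lborel (ball 0 1 - {0})) \<in> sets (restrict_space lborel (ball 0 1 - {0 :: real ^ 'n}))"
      using A by (intro measurable_sets[OF measurable_sgn_punctured_ball]) (simp add: sets_surface_measure)
    ultimately show ?thesis by (simp add: space_restrict_space sets_restrict_space_iff)
  qed
  have eq: "{x \<in> ball 0 1 - {0}. sgn x \<in> U -` A \<inter> space surface_measure} = U -` S"
  proof (intro set_eqI iffI)
    fix x assume x: "x \<in> {x \<in> ball 0 1 - {0}. sgn x \<in> U -` A \<inter> space surface_measure}"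
    have "U (sgn x) = sgn (U x)" using U
      by (simp add: sgn_div_norm orthogonal_transformation_norm linear_cmul orthogonal_transformation_linear)
    moreover have "U x \<noteq> 0" using x U by (metis (mono_tags, lifting) DiffD2 mem_Collect_eq orthogonal_transformation_norm norm_eq_zero singletonI)
    ultimately have "U x \<in> S" using x U by (auto simp: S_def orthogonal_transformation_norm)
    then show "x \<in> U -` S" by simp
  next
    fix x assume x: "x \<in> U -` S"
    have "U (sgn x) = sgn (U x)" using U
      by (simp add: sgn_div_norm orthogonal_transformation_norm linear_cmul orthogonal_transformation_linear)
    then have "U (sgn x) \<in> A" using x by (simp add: S_def)
    moreover have "norm (U x) = norm x" using U by (simp add: orthogonal_transformation_norm)
    ultimately show "x \<in> {x \<in> ball 0 1 - {0}. sgn x \<in> U -` A \<inter> space surface_measure}"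
      using x by (auto simp: S_def space_surface_measure norm_sgn)
  qed
  have "emeasure lborel (U -` S) = emeasure (distr lborel borel U) S"
    using Sm linear_borel_measurable[OF orthogonal_transformation_linear[OF U]] by (simp add: emeasure_distr)
  also have "\<dots> = emeasure lborel S" by (simp add: distr_lborel_orthogonal[OF U])
  finally have "emeasure lborel (U -` S) = emeasure lborel S" .
  then show "emeasure (distr surface_measure surface_measure U) A = emeasure surface_measure A"
    using measurable_sets[OF measurable_orthogonal_surface[OF U] A] A
    unfolding emeasure_distr[OF measurable_orthogonal_surface[OF U] A]
    by (simp only: emeasure_surface_measure eq flip: S_def)
qed simp

text \<open>A rotation taking \<open>n'\<close> to \<open>n\<close> is substituted; for arbitrary
  \<open>h\<close> the change of variables is one-sided. Exchanging \<open>n\<close> and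
  \<open>n'\<close> turns this into the equality that follows.\<close>

lemma nn_integral_surface_inner_le:
  fixes n n' :: "real ^ 'n"
  assumes "norm n = 1" "norm n' = 1"
  shows "(\<integral>\<^sup>+\<omega>. h (\<omega> \<bullet> n) \<partial>surface_measure) \<le> (\<integral>\<^sup>+\<omega>. h (\<omega> \<bullet> n') \<partial>surface_measure)"
proof -
  obtain U where U: "orthogonal_transformation U" "U n' = n"
    using orthogonal_transformation_exists[of n' n] assms by auto
  have "(\<integral>\<^sup>+\<omega>. h (\<omega> \<bullet> n) \<partial>surface_measure) = (\<integral>\<^sup>+\<omega>. h (\<omega> \<bullet> n) \<partial>distr surface_measure surface_measure U)"
    by (simp add: distr_surface_orthogonal[OF U(1)])
  also have "\<dots> \<le> (\<integral>\<^sup>+\<omega>. h (U \<omega> \<bullet> n) \<partial>surface_measure)"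
    by (rule nn_integral_distr_le) (rule measurable_orthogonal_surface[OF U(1)])
  also have "\<dots> = (\<integral>\<^sup>+\<omega>. h (\<omega> \<bullet> n') \<partial>surface_measure)"
    using U by (intro nn_integral_cong) (auto simp: orthogonal_transformation_def)
  finally show ?thesis .
qed

lemma nn_integral_angular_eq:
  fixes n n' :: "real ^ 'n"
  assumes "norm n = 1" "norm n' = 1"
  shows "(\<integral>\<^sup>+\<omega>. h (\<omega> \<bullet> n) \<partial>surface_measure) = (\<integral>\<^sup>+\<omega>. h (\<omega> \<bullet> n') \<partial>surface_measure)"
  by (intro antisym nn_integral_surface_inner_le assms)

section \<open>Angular integrals of the collision kernel and bounds for collision integrals\<close>

context
  fixes \<beta> :: real and bh :: "real \<Rightarrow> real" and b :: "real ^ 'n \<Rightarrow> real ^ 'n \<Rightarrow> real"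
  assumes kernel: "separated_kernel \<beta> bh b"
begin

lemma angular_factor_nonneg:
  assumes "norm n = 1" "\<omega> \<in> space (surface_measure :: (real ^ 'n) measure)"
  shows "0 \<le> bh (\<omega> \<bullet> n)"
proof -
  have "\<bar>\<omega> \<bullet> n\<bar> \<le> 1" using Cauchy_Schwarz_ineq2[of \<omega> n] assms by (simp add: space_surface_measure)
  then have "\<omega> \<bullet> n \<in> {-1..1}" by (auto simp: abs_le_iff)
  then show ?thesis using kernel by (simp add: separated_kernel_def)
qed

lemma angular_mass_nonneg: "0 \<le> angular_mass bh (SOME n :: real ^ 'n. norm n = 1)"
proof -
  have "norm (SOME n :: real ^ 'n. norm n = 1) = 1" using vector_choose_size[of 1] by (metis (mono_tags) someI_ex zero_le_one)
  then show ?thesis unfolding angular_mass_def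
    by (intro integral_nonneg_AE AE_I2) (simp add: angular_factor_nonneg)
qed

text \<open>\<open>angular_mass\<close> is evaluated at an arbitrarily chosen unit vector, so a
  general \<open>n\<close> has to be reduced to that one. The completion enters because
  integrability in \<open>separated_kernel\<close> refers to it; it does not change
  \<open>nn_integral\<close>.\<close>

lemma nn_integral_angular:
  fixes n :: "real ^ 'n"
  assumes n: "norm n = 1"
  shows "(\<integral>\<^sup>+\<omega>. ennreal (bh (\<omega> \<bullet> n)) \<partial>surface_measure)
    = ennreal (angular_mass bh (SOME n :: real ^ 'n. norm n = 1))"
proof -
  define n' where "n' = (SOME n :: real ^ 'n. norm n = 1)"
  have n': "norm n' = 1" unfolding n'_def using vector_choose_size[of 1] by (metis (mono_tags) someI_ex zero_le_one)
  have "(\<integral>\<^sup>+\<omega>. ennreal (bh (\<omega> \<bullet> n)) \<partial>surface_measure) = (\<integral>\<^sup>+\<omega>. ennreal (bh (\<omega> \<bullet> n')) \<partial>surface_measure)"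
    by (rule nn_integral_angular_eq[OF n n'])
  also have "\<dots> = (\<integral>\<^sup>+\<omega>. ennreal (bh (\<omega> \<bullet> n')) \<partial>completion surface_measure)"
    by (simp add: nn_integral_completion)
  also have "\<dots> = ennreal (angular_mass bh n')"
    unfolding angular_mass_def
    by (intro nn_integral_eq_integral AE_I2) (use kernel n' angular_factor_nonneg[OF n'] in \<open>auto simp: separated_kernel_def\<close>)
  finally show ?thesis by (simp add: n'_def)
qed

lemma nn_integral_kernel:
  fixes z :: "real ^ 'n"
  assumes z: "z \<noteq> 0" and c: "0 \<le> c"
  shows "(\<integral>\<^sup>+\<omega>. ennreal (c * b z \<omega>) \<partial>surface_measure)
    = ennreal (c * (angular_mass bh (SOME n :: real ^ 'n. norm n = 1) * norm z powr \<beta>))"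
proof -
  define n where "n = z /\<^sub>R norm z"
  have n: "norm n = 1" using z by (simp add: n_def)
  have m: "(\<lambda>\<omega>. bh (\<omega> \<bullet> n)) \<in> borel_measurable (completion surface_measure)"
    using kernel n by (auto simp: separated_kernel_def)
  have "(\<integral>\<^sup>+\<omega>. ennreal (c * b z \<omega>) \<partial>surface_measure)
     = (\<integral>\<^sup>+\<omega>. ennreal (c * norm z powr \<beta>) * ennreal (bh (\<omega> \<bullet> n)) \<partial>completion surface_measure)"
    unfolding nn_integral_completion
    using kernel z c angular_factor_nonneg[OF n]
    by (intro nn_integral_cong) (auto simp: separated_kernel_def n_def space_surface_measure ennreal_mult[symmetric] mult_ac)
  also have "\<dots> = ennreal (c * norm z powr \<beta>) * (\<integral>\<^sup>+\<omega>. ennreal (bh (\<omega> \<bullet> n)) \<partial>completion surface_measure)"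
    using m by (intro nn_integral_cmult) auto
  also have "\<dots> = ennreal (c * norm z powr \<beta>) * ennreal (angular_mass bh (SOME n :: real ^ 'n. norm n = 1))"
    by (simp add: nn_integral_completion nn_integral_angular[OF n])
  finally show ?thesis using c angular_mass_nonneg by (simp add: ennreal_mult[symmetric] mult_ac)
qed

text \<open>One-sided Tonelli puts the \<open>\<omega>\<close>-integral inside, where the kernel
  integrates to the angular mass times \<open>norm (v - w) powr \<beta>\<close>. With
  \<open>f\<close> a Maxwellian the bound is \<open>C\<close> times the attenuation
  coefficient.\<close>

lemma collision_integral_bound:
  fixes H :: "(real ^ 'n) \<times> (real ^ 'n) \<Rightarrow> real"
  assumes f[measurable]: "f \<in> borel_measurable borel" and f0: "\<And>w. 0 \<le> f w" and C: "0 \<le> C"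
    and int: "integrable lborel (\<lambda>w. f w * norm (v - w) powr \<beta>)"
    and H: "AE (\<omega>, w) in surface_measure \<Otimes>\<^sub>M lborel. \<bar>H (\<omega>, w)\<bar> \<le> C * f w * b (v - w) \<omega>"
  shows "\<bar>integral\<^sup>L (completion (surface_measure \<Otimes>\<^sub>M lborel)) H\<bar>
    \<le> C * (angular_mass bh (SOME n :: real ^ 'n. norm n = 1) * (LINT w|lebesgue. f w * norm (v - w) powr \<beta>))"
    (is "_ \<le> C * (?m * ?I)")
proof (cases "integrable (completion (surface_measure \<Otimes>\<^sub>M lborel)) H")
  \<comment> \<open>A Bochner integral that does not exist has the value \<open>0\<close>, so the
    bound is trivial here.\<close>
  case False
  have "0 \<le> ?I" by (intro integral_nonneg_AE AE_I2) (simp add: f0)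
  then show ?thesis using False C angular_mass_nonneg by (simp add: not_integrable_integral_eq)
next
  case True
  have I: "?I = (LINT w|lborel. f w * norm (v - w) powr \<beta>)" by (rule integral_completion) measurable
  have "ennreal \<bar>integral\<^sup>L (completion (surface_measure \<Otimes>\<^sub>M lborel)) H\<bar>
     \<le> (\<integral>\<^sup>+p. ennreal \<bar>H p\<bar> \<partial>completion (surface_measure \<Otimes>\<^sub>M lborel))"
    using integral_norm_bound_ennreal[OF True] by simp
  also have "\<dots> = (\<integral>\<^sup>+p. ennreal \<bar>H p\<bar> \<partial>(surface_measure \<Otimes>\<^sub>M lborel))"
    by (rule nn_integral_completion)
  also have "\<dots> \<le> (\<integral>\<^sup>+p. ennreal (C * f (snd p) * b (v - snd p) (fst p)) \<partial>(surface_measure \<Otimes>\<^sub>M lborel))"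
    using H by (intro nn_integral_mono_AE) (auto elim!: eventually_mono)
  also have "\<dots> \<le> (\<integral>\<^sup>+w. \<integral>\<^sup>+\<omega>. ennreal (C * f w * b (v - w) \<omega>) \<partial>surface_measure \<partial>lborel)"
    using surface_lborel.nn_integral_pair_le[of "\<lambda>p. ennreal (C * f (snd p) * b (v - snd p) (fst p))"] by simp
  also have "\<dots> = (\<integral>\<^sup>+w. ennreal (C * ?m) * ennreal (f w * norm (v - w) powr \<beta>) \<partial>lborel)"
  proof (rule nn_integral_cong_AE)
    \<comment> \<open>\<open>separated_kernel\<close> prescribes nothing at relative velocity zero;
      this excludes only one \<open>w\<close>.\<close>
    have "AE w in lborel. w \<noteq> v" by (rule AE_lborel_singleton)
    then show "AE w in lborel. (\<integral>\<^sup>+\<omega>. ennreal (C * f w * b (v - w) \<omega>) \<partial>surface_measure)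
        = ennreal (C * ?m) * ennreal (f w * norm (v - w) powr \<beta>)"
    proof eventually_elim
      case (elim w)
      then show ?case using C f0[of w] angular_mass_nonneg
        by (subst nn_integral_kernel) (auto simp: ennreal_mult[symmetric] mult_ac)
    qed
  qed
  also have "\<dots> = ennreal (C * ?m) * (\<integral>\<^sup>+w. ennreal (f w * norm (v - w) powr \<beta>) \<partial>lborel)"
    by (rule nn_integral_cmult) measurable
  also have "(\<integral>\<^sup>+w. ennreal (f w * norm (v - w) powr \<beta>) \<partial>lborel) = ennreal ?I"
    unfolding I by (intro nn_integral_eq_integral int) (simp add: f0)
  also have "ennreal (C * ?m) * ennreal ?I = ennreal (C * (?m * ?I))"
    using C angular_mass_nonneg f0 by (subst ennreal_mult[symmetric]) (auto intro!: integral_nonneg_AE simp: mult_ac)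
  finally show ?thesis
    using C angular_mass_nonneg f0 by (subst (asm) ennreal_le_iff) (auto intro!: integral_nonneg_AE mult_nonneg_nonneg)
qed

end

text \<open>For fixed \<open>\<omega>\<close> the collision map is a linear involution on pairs of
  velocities, so it preserves null sets of pairs. Fubini turns this into a statement for almost
  every \<open>v\<close>. It allows a.e. bounds on a solution to be used at the post-collisional
  velocities inside the collision integrand.\<close>

lemma AE_collision_velocities:
  fixes P :: "real ^ 'n \<Rightarrow> bool"
  assumes P: "AE v in lborel. P v"
  shows "AE v in lborel. AE (\<omega>, w) in surface_measure \<Otimes>\<^sub>M lborel.
           P (post_v v w \<omega>) \<and> P (post_vs v w \<omega>) \<and> P w"
proof -
  obtain N where N: "N \<in> sets borel" "AE x in lborel. x \<notin> N" "\<And>x. x \<notin> N \<Longrightarrow> P x"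
    using AE_lborel_borel_null[OF P] by blast
  let ?Q = "\<lambda>\<omega> p. post_v (fst p) (snd p) \<omega> \<notin> N \<and> post_vs (fst p) (snd p) \<omega> \<notin> N \<and> snd p \<notin> N"
  have N'[measurable]: "Measurable.pred borel (\<lambda>x. x \<notin> N)" using N(1) by simp
  have [measurable]: "(\<lambda>q. fst q) \<in> (surface_measure :: (real ^ 'n) measure) \<Otimes>\<^sub>M R \<rightarrow>\<^sub>M borel" for R :: "'d measure"
    using measurable_compose[OF measurable_fst measurable_surface_ident] .
  have Qm: "Measurable.pred (surface_measure \<Otimes>\<^sub>M lborel) (\<lambda>q. ?Q (fst q) (snd q))"
    unfolding post_v_def post_vs_def by (simp add: borel_prod[symmetric] lborel_prod[symmetric])
  have AEp: "AE p in (lborel :: ((real ^ 'n) \<times> (real ^ 'n)) measure). fst p \<notin> N" "AE p in (lborel :: ((real ^ 'n) \<times> (real ^ 'n)) measure). snd p \<notin> N"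
  proof -
    have "AE x in lborel. AE y in (lborel :: (real ^ 'n) measure). x \<notin> N" using N(2) by eventually_elim simp
    then show "AE p in (lborel :: ((real ^ 'n) \<times> (real ^ 'n)) measure). fst p \<notin> N"
      using AE_lborel_pair_iff[of "\<lambda>p :: (real ^ 'n) \<times> (real ^ 'n). fst p \<notin> N"] by (simp add: borel_prod[symmetric])
    show "AE p in (lborel :: ((real ^ 'n) \<times> (real ^ 'n)) measure). snd p \<notin> N"
      using N(2) AE_lborel_pair_iff[of "\<lambda>p :: (real ^ 'n) \<times> (real ^ 'n). snd p \<notin> N"] by (simp add: borel_prod[symmetric])
  qed
  have "AE p in lborel. ?Q \<omega> p" if \<omega>: "\<omega> \<in> space surface_measure" for \<omega>
  proof -
    define L where "L p = (post_v (fst p) (snd p) \<omega>, post_vs (fst p) (snd p) \<omega>)" for p :: "(real ^ 'n) \<times> (real ^ 'n)"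
    have lin: "linear L" unfolding L_def post_v_def post_vs_def
      by (auto intro!: linearI simp: algebra_simps inner_simps)
    have "\<omega> \<bullet> \<omega> = 1" using \<omega> by (simp add: space_surface_measure norm_eq_1)
    \<comment> \<open>A collision reverses the component of the relative velocity along
      \<open>\<omega>\<close>, so a second collision adds back what the first one removed.\<close>
    then have "(post_v v w \<omega> - post_vs v w \<omega>) \<bullet> \<omega> = - ((v - w) \<bullet> \<omega>)" for v w
      unfolding post_v_def post_vs_def
      by (simp only: inner_diff_left inner_add_left inner_scaleR_left) (simp add: algebra_simps)
    then have inv: "L (L p) = p" for p
      unfolding L_def fst_conv snd_conv post_v_def[of "post_v _ _ _"] post_vs_def[of "post_v _ _ _"]
      by (simp add: post_v_def post_vs_def)
    from AE_lborel_linear_bij[OF lin inv AEp(1)] AE_lborel_linear_bij[OF lin inv AEp(2)] AEp(2)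
    show ?thesis by eventually_elim (simp add: L_def)
  qed
  then have "AE \<omega> in surface_measure. AE p in lborel. ?Q \<omega> p" by (rule AE_I2)
  \<comment> \<open>The pair is moved outermost so that \<open>v\<close> can be peeled off and
    \<open>\<omega>\<close> recombined with \<open>w\<close> alone.\<close>
  then have "AE p in lborel. AE \<omega> in surface_measure. ?Q \<omega> p"
    by (subst surface_lborel.AE_commute[symmetric]) (use Qm in \<open>simp_all add: pred_def\<close>)
  then have "AE v in lborel. AE w in lborel. AE \<omega> in surface_measure. ?Q \<omega> (v, w)"
    by (rule AE_lborel_pair)
  then show ?thesis
  proof eventually_elim
    case (elim v)
    have Qv: "Measurable.pred (surface_measure \<Otimes>\<^sub>M lborel) (\<lambda>q. ?Q (fst q) (v, snd q))"
      unfolding post_v_def post_vs_def by simp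
    have "AE \<omega> in surface_measure. AE w in lborel. ?Q \<omega> (v, w)"
      using elim by (subst surface_lborel.AE_commute) (use Qv in \<open>simp_all add: pred_def\<close>)
    then have "AE q in surface_measure \<Otimes>\<^sub>M lborel. ?Q (fst q) (v, snd q)"
      by (intro surface_lborel.AE_pair_measure) (use Qv in \<open>simp_all add: pred_def\<close>)
    then show ?case by eventually_elim (auto intro: N(3))
  qed
qed

section \<open>Gaussian moments\<close>

lemma nn_integral_lborel_affine:
  fixes f :: "'a::euclidean_space \<Rightarrow> ennreal"
  assumes [measurable]: "f \<in> borel_measurable borel" and r: "0 < r"
  shows "(\<integral>\<^sup>+x. f x \<partial>lborel) = ennreal (r ^ DIM('a)) * (\<integral>\<^sup>+x. f (t + r *\<^sub>R x) \<partial>lborel)"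
  using r by (subst lborel_affine[of r t])
    (auto simp: nn_integral_density nn_integral_distr nn_integral_cmult)

lemma nn_integral_gaussian_finite:
  "(\<integral>\<^sup>+x. ennreal (exp (- (norm x)\<^sup>2 / 2)) \<partial>(lborel :: 'a::euclidean_space measure)) < \<infinity>"
proof -
  have one: "(\<integral>\<^sup>+y. ennreal (exp (- y\<^sup>2 / 2)) \<partial>(lborel :: real measure)) < \<infinity>"
  proof -
    have "integrable lborel (\<lambda>y. sqrt (2 * pi) * normal_density 0 1 y)"
      by (intro integrable_mult_right integrable_normal_density) auto
    then have "integrable lborel (\<lambda>y :: real. exp (- y\<^sup>2 / 2))"
      by (simp add: normal_density_def)
    from integrableD(2)[OF this] show ?thesis by (simp add: top.not_eq_extremum)
  qed
  have "(\<integral>\<^sup>+x. ennreal (exp (- (norm x)\<^sup>2 / 2)) \<partial>(lborel :: 'a::euclidean_space measure))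
      = (\<integral>\<^sup>+x. (\<Prod>b\<in>Basis. ennreal (exp (- (x \<bullet> b)\<^sup>2 / 2))) \<partial>(lborel :: 'a measure))"
  proof (rule nn_integral_cong)
    fix x :: 'a
    have "(norm x)\<^sup>2 = (\<Sum>b\<in>Basis. (x \<bullet> b)\<^sup>2)"
      by (subst power2_norm_eq_inner, subst euclidean_inner) (simp add: power2_eq_square)
    then show "ennreal (exp (- (norm x)\<^sup>2 / 2)) = (\<Prod>b\<in>Basis. ennreal (exp (- (x \<bullet> b)\<^sup>2 / 2)))"
      by (simp add: prod_ennreal exp_sum[symmetric] sum_negf sum_divide_distrib)
  qed
  also have "\<dots> = (\<Prod>b\<in>(Basis :: 'a set). \<integral>\<^sup>+y. ennreal (exp (- y\<^sup>2 / 2)) \<partial>lborel)"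
    by (rule nn_integral_lborel_prod) auto
  also have "\<dots> < \<infinity>" using one by (simp add: power_less_top_ennreal)
  finally show ?thesis .
qed

text \<open>Since \<open>\<beta> \<le> 0\<close> and every coordinate is at most the norm,
  \<open>norm x powr \<beta>\<close> is at most the product over the coordinates of their absolute
  values to the power \<open>\<beta> / D\<close>. These exponents exceed -1, so a product of finite
  one-dimensional integrals bounds the integral, without polar coordinates.\<close>

lemma nn_integral_norm_powr_finite:
  fixes \<beta> :: real
  assumes b: "- real DIM('a) < \<beta>" "\<beta> \<le> 0"
  shows "(\<integral>\<^sup>+x. ennreal (norm x powr \<beta> * indicator (cball 0 1) x) \<partial>(lborel :: 'a::euclidean_space measure)) < \<infinity>"
proof -
  define g where "g = \<beta> / real DIM('a)"
  have g: "- 1 < g" "g \<le> 0" using b by (auto simp: g_def field_simps)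
  \<comment> \<open>The value \<open>top\<close> at zero is there because \<open>0 powr g\<close> is
    \<open>0\<close> in HOL, which would break the product bound on the coordinate hyperplanes; it
    sits on a null set.\<close>
  define h :: "real \<Rightarrow> ennreal" where
    "h y = ennreal (\<bar>y\<bar> powr g * indicator {-1..1} y) + top * indicator {0} y" for y
  have [measurable]: "h \<in> borel_measurable borel" unfolding h_def by measurable
  have one: "(\<integral>\<^sup>+y. h y \<partial>lborel) < \<infinity>"
  proof -
    have pos: "(\<integral>\<^sup>+y. ennreal (indicator {0..1} y * y powr g) \<partial>(lborel :: real measure)) < \<infinity>"
      using nn_integral_has_integral_lebesgue[OF _ has_integral_powr_from_0[OF g(1), of 1]] by (simp add: ennreal_mult'' flip: ennreal_indicator)
    have "(\<integral>\<^sup>+y. ennreal (indicator {0..1} y * y powr g) \<partial>(lborel :: real measure))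
        = (\<integral>\<^sup>+y. ennreal (indicator {0..1} (- y) * (- y) powr g) \<partial>lborel)"
      by (subst lborel_distr_uminus[symmetric]) (simp add: nn_integral_distr)
    with pos have neg: "(\<integral>\<^sup>+y. ennreal (indicator {0..1} (- y) * (- y) powr g) \<partial>(lborel :: real measure)) < \<infinity>" by simp
    have "(\<integral>\<^sup>+y. h y \<partial>lborel) \<le> (\<integral>\<^sup>+y. ennreal (indicator {0..1} y * y powr g)
        + ennreal (indicator {0..1} (- y) * (- y) powr g) \<partial>lborel)"
    proof (rule nn_integral_mono_AE)
      have "AE y in lborel. y \<noteq> (0::real)" by (rule AE_lborel_singleton)
      then show "AE y in lborel. h y \<le> ennreal (indicator {0..1} y * y powr g)
          + ennreal (indicator {0..1} (- y) * (- y) powr g)"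
        by eventually_elim (auto simp: h_def indicator_def)
    qed
    also have "\<dots> < \<infinity>" using pos neg by (subst nn_integral_add) (auto simp: ennreal_add_less_top)
    finally show ?thesis .
  qed
  have "(\<integral>\<^sup>+x. ennreal (norm x powr \<beta> * indicator (cball 0 1) x) \<partial>(lborel :: 'a measure))
     \<le> (\<integral>\<^sup>+x. (\<Prod>b\<in>Basis. h (x \<bullet> b)) \<partial>(lborel :: 'a measure))"
  proof (rule nn_integral_mono)
    fix x :: 'a
    show "ennreal (norm x powr \<beta> * indicator (cball 0 1) x) \<le> (\<Prod>b\<in>Basis. h (x \<bullet> b))"
    proof (cases "x \<in> cball 0 1 \<and> x \<noteq> 0")
      case False
      then show ?thesis by (cases "x = 0") (auto simp: powr_def)
    next
      case True
      have le: "ennreal (norm x powr g) \<le> h (x \<bullet> b)" if "b \<in> Basis" for b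
      proof (cases "x \<bullet> b = 0")
        case True
        then show ?thesis by (simp add: h_def)
      next
        case False
        have le: "\<bar>x \<bullet> b\<bar> \<le> norm x" using that by (rule Basis_le_norm)
        then have "norm x powr g \<le> \<bar>x \<bullet> b\<bar> powr g"
          using False g by (intro powr_mono2') auto
        moreover have "x \<bullet> b \<in> {-1..1}" using le \<open>x \<in> cball 0 1 \<and> x \<noteq> 0\<close> by (auto simp: abs_le_iff)
        ultimately show ?thesis using False by (simp add: h_def)
      qed
      have "ennreal (norm x powr \<beta>) = ennreal (\<Prod>b\<in>(Basis :: 'a set). norm x powr g)"
        using True by (simp add: powr_realpow[symmetric] powr_powr g_def)
      also have "\<dots> = (\<Prod>b\<in>(Basis :: 'a set). ennreal (norm x powr g))" by (simp add: ennreal_power)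
      also have "\<dots> \<le> (\<Prod>b\<in>Basis. h (x \<bullet> b))" 
        using le by (intro prod_mono_ennreal) auto
      finally show ?thesis using True by simp
    qed
  qed
  also have "\<dots> = (\<Prod>b\<in>(Basis :: 'a set). \<integral>\<^sup>+y. h y \<partial>lborel)"
    by (rule nn_integral_lborel_prod) auto
  also have "\<dots> < \<infinity>" using one by (simp add: power_less_top_ennreal)
  finally show ?thesis .
qed

text \<open>Rescaling about \<open>v\<close> by \<open>\<theta> powr (- 1 / 2)\<close> gives the
  Gaussian unit width and produces the power of \<open>\<theta>\<close>. After that,
  \<open>norm z powr \<beta>\<close> is integrable on the unit ball, where the Gaussian is at most
  1, and is itself at most 1 outside. Neither contribution depends on the centre, so
  \<open>K\<close> is uniform in \<open>u\<close> and \<open>v\<close>.\<close>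

lemma nn_integral_gaussian_powr_bound:
  fixes \<beta> :: real
  assumes b: "- real DIM('a) < \<beta>" "\<beta> \<le> 0"
  obtains K where "0 \<le> K"
    "\<And>\<theta> (u :: 'a::euclidean_space) v. 0 < \<theta> \<Longrightarrow>
       (\<integral>\<^sup>+w. ennreal (exp (- \<theta> * (norm (w - u))\<^sup>2 / 2) * norm (v - w) powr \<beta>) \<partial>lborel)
         \<le> ennreal (K * \<theta> powr (- (real DIM('a) + \<beta>) / 2))"
proof -
  have [measurable]: "cball (0 :: 'a) 1 \<in> sets borel" by simp
  let ?I1 = "\<integral>\<^sup>+x. ennreal (norm x powr \<beta> * indicator (cball 0 1) x) \<partial>(lborel :: 'a measure)"
  let ?I2 = "\<integral>\<^sup>+x. ennreal (exp (- (norm x)\<^sup>2 / 2)) \<partial>(lborel :: 'a measure)"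
  have fin: "?I1 + ?I2 < \<infinity>"
    using nn_integral_norm_powr_finite[OF b] nn_integral_gaussian_finite by (simp add: ennreal_add_less_top)
  define K where "K = enn2real (?I1 + ?I2)"
  have K: "ennreal K = ?I1 + ?I2" using fin by (simp add: K_def)
  show thesis
  proof (rule that[of K])
    show "0 \<le> K" by (simp add: K_def)
    fix \<theta> :: real and u v :: 'a assume th: "0 < \<theta>"
    define r where "r = \<theta> powr (- 1 / 2)"
    have r: "0 < r" using th by (simp add: r_def)
    have r2: "\<theta> * r\<^sup>2 = 1" 
    proof -
      have "r\<^sup>2 = \<theta> powr (- 1)" using th by (simp add: r_def power2_eq_square flip: powr_add)
      then show ?thesis using th by (simp add: powr_minus)
    qed
    define u' where "u' = (u - v) /\<^sub>R r"
    have eq: "exp (- \<theta> * (norm (v + r *\<^sub>R z - u))\<^sup>2 / 2) * norm (v - (v + r *\<^sub>R z)) powr \<beta>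
       = r powr \<beta> * (exp (- (norm (z - u'))\<^sup>2 / 2) * norm z powr \<beta>)" for z
    proof -
      have "v + r *\<^sub>R z - u = r *\<^sub>R (z - u')" using r by (simp add: u'_def algebra_simps)
      then have "\<theta> * (norm (v + r *\<^sub>R z - u))\<^sup>2 = \<theta> * r\<^sup>2 * (norm (z - u'))\<^sup>2"
        by (simp add: power_mult_distrib)
      then have "- \<theta> * (norm (v + r *\<^sub>R z - u))\<^sup>2 / 2 = - (norm (z - u'))\<^sup>2 / 2" using r2 by simp
      then show ?thesis using r by (simp add: powr_mult)
    qed
    have "(\<integral>\<^sup>+w. ennreal (exp (- \<theta> * (norm (w - u))\<^sup>2 / 2) * norm (v - w) powr \<beta>) \<partial>lborel)
      = ennreal (r ^ DIM('a)) * (\<integral>\<^sup>+z. ennreal (r powr \<beta> * (exp (- (norm (z - u'))\<^sup>2 / 2) * norm z powr \<beta>)) \<partial>lborel)"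
      by (subst nn_integral_lborel_affine[OF _ r, of _ v]) (simp_all only: eq, measurable)
    also have "\<dots> = ennreal (r ^ DIM('a)) * ennreal (r powr \<beta>) * (\<integral>\<^sup>+z. ennreal (exp (- (norm (z - u'))\<^sup>2 / 2) * norm z powr \<beta>) \<partial>lborel)"
      by (simp add: ennreal_mult nn_integral_cmult mult_ac)
    also have "\<dots> \<le> ennreal (r ^ DIM('a)) * ennreal (r powr \<beta>) * ennreal K"
    proof (rule mult_left_mono)
      have "(\<integral>\<^sup>+z. ennreal (exp (- (norm (z - u'))\<^sup>2 / 2) * norm z powr \<beta>) \<partial>lborel)
        \<le> (\<integral>\<^sup>+z. ennreal (norm z powr \<beta> * indicator (cball 0 1) z) + ennreal (exp (- (norm (z - u'))\<^sup>2 / 2)) \<partial>lborel)"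
      proof (rule nn_integral_mono)
        fix z :: 'a
        have "exp (- (norm (z - u'))\<^sup>2 / 2) * norm z powr \<beta>
          \<le> norm z powr \<beta> * indicator (cball 0 1) z + exp (- (norm (z - u'))\<^sup>2 / 2)"
        proof (cases "z \<in> cball 0 1")
          case True
          have "exp (- (norm (z - u'))\<^sup>2 / 2) * norm z powr \<beta> \<le> 1 * norm z powr \<beta>"
            by (intro mult_right_mono) auto
          then show ?thesis using True by (simp add: add_increasing2)
        next
          case False
          then have "norm z powr \<beta> \<le> norm z powr 0" using b by (intro powr_mono) auto
          then have "exp (- (norm (z - u'))\<^sup>2 / 2) * norm z powr \<beta> \<le> exp (- (norm (z - u'))\<^sup>2 / 2) * 1"
            using False by (intro mult_left_mono) (auto split: if_splits)
          then show ?thesis using False by simp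
        qed
        then show "ennreal (exp (- (norm (z - u'))\<^sup>2 / 2) * norm z powr \<beta>)
          \<le> ennreal (norm z powr \<beta> * indicator (cball 0 1) z) + ennreal (exp (- (norm (z - u'))\<^sup>2 / 2))"
          by (simp add: ennreal_plus[symmetric] ennreal_leI del: ennreal_plus)
      qed
      also have "\<dots> = ?I1 + (\<integral>\<^sup>+z. ennreal (exp (- (norm (z - u'))\<^sup>2 / 2)) \<partial>lborel)"
        by (rule nn_integral_add) auto
      also have "(\<integral>\<^sup>+z. ennreal (exp (- (norm (z - u'))\<^sup>2 / 2)) \<partial>lborel) = ?I2"
        by (subst nn_integral_lborel_affine[of _ 1 u']) auto
      finally show "(\<integral>\<^sup>+z. ennreal (exp (- (norm (z - u'))\<^sup>2 / 2) * norm z powr \<beta>) \<partial>lborel) \<le> ennreal K"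
        by (simp add: K)
    qed simp
    also have "\<dots> = ennreal (K * \<theta> powr (- (real DIM('a) + \<beta>) / 2))"
    proof -
      have "r ^ DIM('a) * r powr \<beta> = r powr (real DIM('a) + \<beta>)"
        using r by (simp add: powr_add powr_realpow)
      also have "\<dots> = \<theta> powr (- (real DIM('a) + \<beta>) / 2)"
        unfolding r_def powr_powr by (rule arg_cong) (simp add: field_simps)
      finally show ?thesis using r \<open>0 \<le> K\<close> by (simp add: ennreal_mult[symmetric] mult_ac)
    qed
    finally show "(\<integral>\<^sup>+w. ennreal (exp (- \<theta> * (norm (w - u))\<^sup>2 / 2) * norm (v - w) powr \<beta>) \<partial>lborel)
         \<le> ennreal (K * \<theta> powr (- (real DIM('a) + \<beta>) / 2))" .
  qed
qed

text \<open>It is used with \<open>p = (D + \<beta>) / 2\<close>, for which \<open>p > 1 / 2\<close>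
  says exactly that \<open>\<beta> > 1 - D\<close>.\<close>

lemma nn_integral_one_plus_square_powr_finite:
  assumes p: "p > 1 / 2"
  shows "(\<integral>\<^sup>+t. ennreal ((1 + t\<^sup>2) powr (- p)) \<partial>(lborel :: real measure)) < \<infinity>"
proof -
  define f where "f t = indicator {1..} t * t powr (- 2 * p)" for t :: real
  have [measurable]: "f \<in> borel_measurable borel" unfolding f_def by measurable
  have f0: "0 \<le> f t" for t by (simp add: f_def)
  have pos: "(\<integral>\<^sup>+t. ennreal (f t) \<partial>lborel) < \<infinity>"
    using nn_integral_has_integral_lebesgue[OF _ has_integral_powr_to_inf[of "- 2 * p" 1]] p
    by (simp add: f_def)
  have "(\<integral>\<^sup>+t. ennreal (f t) \<partial>lborel) = (\<integral>\<^sup>+t. ennreal (f (- t)) \<partial>lborel)"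
    by (subst lborel_distr_uminus[symmetric]) (simp add: nn_integral_distr)
  with pos have neg: "(\<integral>\<^sup>+t. ennreal (f (- t)) \<partial>lborel) < \<infinity>" by simp
  have "(\<integral>\<^sup>+t. ennreal ((1 + t\<^sup>2) powr (- p)) \<partial>(lborel :: real measure))
     \<le> (\<integral>\<^sup>+t. indicator {-1..1} t + (ennreal (f t) + ennreal (f (- t))) \<partial>lborel)"
  proof (rule nn_integral_mono)
    fix t :: real
    have le1: "(1 + t\<^sup>2) powr (- p) \<le> 1"
      using p powr_mono2'[of "- p" 1 "1 + t\<^sup>2"] by simp
    have le2: "(1 + t\<^sup>2) powr (- p) \<le> \<bar>t\<bar> powr (- 2 * p)" if "t \<noteq> 0"
    proof -
      have "(1 + t\<^sup>2) powr (- p) \<le> (\<bar>t\<bar> powr 2) powr (- p)"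
        using p that by (intro powr_mono2') auto
      also have "\<dots> = \<bar>t\<bar> powr (- 2 * p)" by (subst powr_powr) simp
      finally show ?thesis .
    qed
    have "(1 + t\<^sup>2) powr (- p) \<le> indicator {-1..1} t + (f t + f (- t))"
    proof (cases "t \<in> {-1..1}")
      case True then show ?thesis using le1 f0[of t] f0[of "- t"] by simp
    next
      case False
      then show ?thesis using le2 by (auto simp: f_def indicator_def)
    qed
    then have "ennreal ((1 + t\<^sup>2) powr (- p)) \<le> ennreal (indicator {-1..1} t + (f t + f (- t)))"
      by (rule ennreal_leI)
    also have "\<dots> = indicator {-1..1} t + (ennreal (f t) + ennreal (f (- t)))"
      using f0[of t] f0[of "- t"] by (simp add: ennreal_plus ennreal_indicator)
    finally show "ennreal ((1 + t\<^sup>2) powr (- p)) \<le> indicator {-1..1} t + (ennreal (f t) + ennreal (f (- t)))" .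
  qed
  also have "\<dots> = emeasure lborel {-1..1::real} + ((\<integral>\<^sup>+t. ennreal (f t) \<partial>lborel) + (\<integral>\<^sup>+t. ennreal (f (- t)) \<partial>lborel))"
    by (simp add: nn_integral_add)
  also have "\<dots> < \<infinity>" using pos neg by (simp add: ennreal_add_less_top)
  finally show ?thesis .
qed

section \<open>Global Maxwellians\<close>

text \<open>All matrices on the segment from the identity to \<open>Q\<close> have a positive
  quadratic form, hence trivial kernel, so the determinant never vanishes along it. This makes the
  normalising constant of a Maxwellian positive.\<close>

lemma det_pos_of_positive_definite:
  fixes Q :: "real ^ 'n ^ 'n"
  assumes pos: "\<And>y. y \<noteq> 0 \<Longrightarrow> 0 < y \<bullet> (Q *v y)"
  shows "0 < det Q"
proof (rule ccontr)
  assume neg: "\<not> 0 < det Q"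
  let ?A = "\<lambda>s. (1 - s) *\<^sub>R mat 1 + s *\<^sub>R Q"
  have "continuous_on {0..1} (\<lambda>s. det (?A s))"
    unfolding det_def by (intro continuous_intros)
  moreover have "det (?A 1) \<le> 0" "0 \<le> det (?A 0)" using neg by auto
  ultimately obtain s where s: "0 \<le> s" "s \<le> 1" "det (?A s) = 0"
    using IVT2'[of "\<lambda>s. det (?A s)" 1 0 0] by auto
  have Ay: "?A s *v y = (1 - s) *\<^sub>R y + s *\<^sub>R (Q *v y)" for y
    by (simp add: matrix_vector_mult_add_rdistrib scaleR_matrix_vector_assoc[symmetric])
  have "y = 0" if "?A s *v y = 0" for y
  proof (rule ccontr)
    assume y: "y \<noteq> 0"
    have "0 = y \<bullet> (?A s *v y)" using that by simp
    also have "\<dots> = (1 - s) * (y \<bullet> y) + s * (y \<bullet> (Q *v y))" by (simp add: Ay inner_add_right)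
    also have "0 < (1 - s) * (y \<bullet> y) + s * (y \<bullet> (Q *v y))"
      using s pos[OF y] y by (cases "s = 1") (auto intro!: add_pos_nonneg)
    finally show False by simp
  qed
  then have "invertible (?A s)"
    by (simp add: invertible_left_inverse matrix_left_invertible_ker)
  then show False using s by (simp add: invertible_det_nz)
qed

text \<open>Energy is measured from an arbitrary velocity \<open>u\<close> because the exponent of a
  Maxwellian is centred at \<open>v0\<close>.\<close>

lemma post_conservation:
  fixes v w \<omega> u :: "real ^ 'n"
  assumes "norm \<omega> = 1"
  shows "post_v v w \<omega> + post_vs v w \<omega> = v + w"
    and "(norm (post_v v w \<omega> - u))\<^sup>2 + (norm (post_vs v w \<omega> - u))\<^sup>2 = (norm (v - u))\<^sup>2 + (norm (w - u))\<^sup>2"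
proof -
  show "post_v v w \<omega> + post_vs v w \<omega> = v + w" by (simp add: post_v_def post_vs_def)
  define k where "k = (v - w) \<bullet> \<omega>"
  have o: "\<omega> \<bullet> \<omega> = 1" using assms by (simp add: norm_eq_1)
  have norm_add: "(norm (p + j *\<^sub>R \<omega>))\<^sup>2 = (norm p)\<^sup>2 + 2 * j * (p \<bullet> \<omega>) + j\<^sup>2" for p j
    using inner_commute[of \<omega> p] o unfolding power2_norm_eq_inner
    by (simp add: inner_add_left inner_add_right power2_eq_square distrib_left)
  define p q where "p = (v - u) \<bullet> \<omega>" and "q = (w - u) \<bullet> \<omega>"
  have e: "post_v v w \<omega> - u = (v - u) + (- k) *\<^sub>R \<omega>" "post_vs v w \<omega> - u = (w - u) + k *\<^sub>R \<omega>"
    by (simp_all add: post_v_def post_vs_def k_def)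
  have k: "k = p - q" by (simp add: k_def p_def q_def inner_diff_left)
  show "(norm (post_v v w \<omega> - u))\<^sup>2 + (norm (post_vs v w \<omega> - u))\<^sup>2 = (norm (v - u))\<^sup>2 + (norm (w - u))\<^sup>2"
    unfolding e norm_add p_def[symmetric] q_def[symmetric] k
    by (simp add: power2_eq_square) (simp add: algebra_simps)
qed

section \<open>One global Maxwellian: Gaussian bounds, collision invariance, behaviour along
  characteristics\<close>

locale maxwellian =
  fixes M :: "real ^ 'n \<Rightarrow> real ^ 'n \<Rightarrow> real \<Rightarrow> real" and m a b c :: real
    and x0 v0 :: "real ^ 'n" and B :: "real ^ 'n ^ 'n"
  assumes m: "0 < m" and a: "0 < a" and c: "0 < c" and skew: "transpose B = - B"
    and Q_pos: "\<And>y. y \<noteq> 0 \<Longrightarrow> 0 < y \<bullet> (Maxwellian_Q a b c B *v y)"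
    and M_eq: "\<And>v x t. M v x t = m / (2 * pi) ^ CARD('n) * sqrt (det (Maxwellian_Q a b c B)) *
           exp (- Maxwellian_q a b c B (v - v0) (x - x0) t)"
begin

definition height :: real where
  "height = m / (2 * pi) ^ CARD('n) * sqrt (det (Maxwellian_Q a b c B))"

text \<open>At fixed position and time the exponent is a quadratic polynomial in the velocity, with
  leading coefficient \<open>theta t / 2\<close> and linear part given by \<open>drift\<close>. So
  \<open>theta t\<close> is the inverse variance of the velocity profile.\<close>

definition theta :: "real \<Rightarrow> real" where "theta t = a * t\<^sup>2 - 2 * b * t + c"

definition drift :: "real ^ 'n \<Rightarrow> real \<Rightarrow> real ^ 'n" where
  "drift x t = (a * t - b) *\<^sub>R x + B *v x"

lemma height_pos: "0 < height"
  unfolding height_def using m det_pos_of_positive_definite[OF Q_pos] by simp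

lemma skew_inner: "v \<bullet> (B *v w) = - ((B *v v) \<bullet> w)"
proof -
  have "v \<bullet> (B *v w) = (v v* B) \<bullet> w" by (simp add: dot_lmul_matrix)
  also have "v v* B = transpose B *v v" by (simp add: transpose_matrix_vector)
  also have "\<dots> = - (B *v v)" unfolding skew
    by (metis add.right_inverse add_eq_0_iff matrix_vector_mult_0 matrix_vector_mult_add_rdistrib)
  finally show ?thesis by simp
qed

lemma skew_self: "v \<bullet> (B *v v) = 0"
  using skew_inner[of v v] by (simp add: inner_commute)

lemma Q_form: "y \<bullet> (Maxwellian_Q a b c B *v y) = (a * c - b\<^sup>2) * (norm y)\<^sup>2 - (norm (B *v y))\<^sup>2"
proof -
  have "Maxwellian_Q a b c B *v y = (a * c - b\<^sup>2) *\<^sub>R y + B *v (B *v y)"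
    by (simp add: Maxwellian_Q_def matrix_vector_mult_add_rdistrib matrix_vector_mul_assoc
        scaleR_matrix_vector_assoc[symmetric])
  then show ?thesis
    by (simp add: inner_add_right skew_inner power2_norm_eq_inner)
qed

lemma disc_pos: "0 < a * c - b\<^sup>2"
proof -
  obtain y :: "real ^ 'n" where y: "norm y = 1" using vector_choose_size[of 1] by auto
  then have "y \<noteq> 0" by auto
  then have "0 < a * c - b\<^sup>2 - (norm (B *v y))\<^sup>2" using Q_pos[of y] y by (simp add: Q_form)
  then show ?thesis using zero_le_power2[of "norm (B *v y)"] by linarith
qed

text \<open>Subtracting \<open>d * (1 + t\<^sup>2)\<close> leaves a quadratic polynomial with
  leading coefficient \<open>a - d > 0\<close>. The choice of \<open>d\<close> makes its
  discriminant term \<open>b\<^sup>2 - (a - d) * (c - d)\<close> equal to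
  \<open>- d\<^sup>2\<close>, so it is nonnegative. The quadratic growth is the dispersion of free
  flow: at a given position the velocity spread shrinks.\<close>

lemma theta_lower: obtains d where "0 < d" "\<And>t. d * (1 + t\<^sup>2) \<le> theta t"
proof -
  define d where "d = (a * c - b\<^sup>2) / (a + c)"
  have d: "0 < d" using disc_pos a c by (simp add: d_def)
  have da: "d < a"
  proof -
    have "a * c - b\<^sup>2 < a * (a + c)" using a by (simp add: algebra_simps add_pos_nonneg)
    then show ?thesis using a c by (simp add: d_def pos_divide_less_eq)
  qed
  have dac: "d * (a + c) = a * c - b\<^sup>2" using a c by (simp add: d_def)
  show thesis
  proof (rule that[OF d])
    fix t
    have "(a - d) * (theta t - d * (1 + t\<^sup>2)) = ((a - d) * t - b)\<^sup>2 + (a * c - b\<^sup>2 - d * (a + c)) + d\<^sup>2"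
      by (simp add: theta_def algebra_simps power2_eq_square)
    also have "\<dots> \<ge> 0" using dac by simp
    finally show "d * (1 + t\<^sup>2) \<le> theta t" using da by (simp add: zero_le_mult_iff)
  qed
qed

lemma theta_pos: "0 < theta t"
proof -
  obtain d where d: "0 < d" "d * (1 + t\<^sup>2) \<le> theta t" using theta_lower by metis
  have "0 < d * (1 + t\<^sup>2)" using d by (intro mult_pos_pos add_pos_nonneg) auto
  then show ?thesis using d by linarith
qed

lemma q_expand:
  "Maxwellian_q a b c B v x t = theta t / 2 * (norm v)\<^sup>2 - v \<bullet> drift x t + a / 2 * (norm x)\<^sup>2"
proof -
  have h1: "v \<bullet> (B *v (x - t *\<^sub>R v)) = v \<bullet> (B *v x)"
    by (simp add: matrix_vector_mult_diff_distrib inner_diff_right matrix_vector_mult_scaleR skew_self)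
  have h2: "(norm (x - t *\<^sub>R v))\<^sup>2 = (norm x)\<^sup>2 - 2 * t * (v \<bullet> x) + t\<^sup>2 * (norm v)\<^sup>2"
    unfolding power2_norm_eq_inner
    by (simp add: inner_diff_left inner_diff_right inner_commute algebra_simps power2_eq_square)
  have h3: "(x - t *\<^sub>R v) \<bullet> v = v \<bullet> x - t * (norm v)\<^sup>2"
    by (simp add: inner_diff_left power2_norm_eq_inner inner_commute[of x])
  have h4: "v \<bullet> drift x t = (a * t - b) * (v \<bullet> x) + v \<bullet> (B *v x)"
    by (simp add: drift_def inner_add_right)
  show ?thesis unfolding Maxwellian_q_def theta_def h1 h2 h3 h4 by (simp add: field_simps)
qed

text \<open>Completing the square in \<open>v\<close> leaves the remainder
  \<open>x \<bullet> (Q *v x) / (2 * theta t)\<close>, with \<open>Q\<close> the matrix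
  \<open>Maxwellian_Q a b c B\<close>. Its positivity is what bounds the velocity profile by one and
  the same height at all positions and times.\<close>

lemma q_lower:
  "theta t / 2 * (norm (v - drift x t /\<^sub>R theta t))\<^sup>2 \<le> Maxwellian_q a b c B v x t"
proof -
  have th: "0 < theta t" by (rule theta_pos)
  define w where "w = drift x t"
  have w2: "(norm w)\<^sup>2 = (a * t - b)\<^sup>2 * (norm x)\<^sup>2 + (norm (B *v x))\<^sup>2"
    unfolding w_def drift_def power2_norm_eq_inner
    by (simp add: inner_add_left inner_add_right inner_commute skew_self[of x] power2_eq_square)
  have "0 \<le> x \<bullet> (Maxwellian_Q a b c B *v x)" by (cases "x = 0") (auto intro: less_imp_le Q_pos)
  then have "(norm w)\<^sup>2 \<le> a * theta t * (norm x)\<^sup>2"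
    unfolding Q_form w2 by (simp add: theta_def algebra_simps power2_eq_square)
  then have w3: "(norm w)\<^sup>2 / (2 * theta t) \<le> a / 2 * (norm x)\<^sup>2"
    using th by (simp add: field_simps)
  have "(norm (v - w /\<^sub>R theta t))\<^sup>2 = (norm v)\<^sup>2 - 2 * (v \<bullet> w) / theta t + (norm w)\<^sup>2 / (theta t)\<^sup>2"
    unfolding power2_norm_eq_inner
    by (simp add: inner_diff_left inner_diff_right inner_commute field_simps power2_eq_square)
  then have "theta t / 2 * (norm (v - w /\<^sub>R theta t))\<^sup>2 = theta t / 2 * (norm v)\<^sup>2 - v \<bullet> w + (norm w)\<^sup>2 / (2 * theta t)"
    using th by (simp add: field_simps power2_eq_square)
  then show ?thesis using w3 by (simp add: q_expand w_def[symmetric])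
qed

lemma M_height: "M v x t = height * exp (- Maxwellian_q a b c B (v - v0) (x - x0) t)"
  by (simp add: M_eq height_def)

lemma M_pos: "0 < M v x t"
  by (simp add: M_height height_pos)

lemma M_le_gaussian:
  "M w x t \<le> height * exp (- theta t * (norm (w - (v0 + drift (x - x0) t /\<^sub>R theta t)))\<^sup>2 / 2)"
  unfolding M_height using q_lower[of t "w - v0" "x - x0"] height_pos
  by (intro mult_left_mono) (auto simp: algebra_simps)

lemma M_le_height: "M w x t \<le> height"
proof -
  have "- Maxwellian_q a b c B (w - v0) (x - x0) t \<le> 0"
    using q_lower[of t "w - v0" "x - x0"] theta_pos[of t]
    by (smt (verit) mult_nonneg_nonneg divide_nonneg_pos zero_le_power2)
  then show ?thesis using height_pos by (simp add: M_height)
qed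

text \<open>At fixed \<open>x\<close> and \<open>t\<close> the exponent is a combination of 1, the
  velocity and the squared norm of the velocity, whose sums over the two particles a collision
  conserves.\<close>

lemma M_collision:
  assumes "norm \<omega> = 1"
  shows "M (post_v v w \<omega>) x t * M (post_vs v w \<omega>) x t = M v x t * M w x t"
proof -
  have "(post_v v w \<omega> - v0) \<bullet> k + (post_vs v w \<omega> - v0) \<bullet> k = (v - v0) \<bullet> k + (w - v0) \<bullet> k" for k
    using arg_cong[OF post_conservation(1)[OF assms, of v w], of "\<lambda>y. y \<bullet> k"]
    by (simp add: inner_add_left inner_diff_left)
  from this[of "drift (x - x0) t"] have "Maxwellian_q a b c B (post_v v w \<omega> - v0) (x - x0) t + Maxwellian_q a b c B (post_vs v w \<omega> - v0) (x - x0) t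
    = Maxwellian_q a b c B (v - v0) (x - x0) t + Maxwellian_q a b c B (w - v0) (x - x0) t"
    using arg_cong[OF post_conservation(2)[OF assms, of v w v0], of "\<lambda>y. theta t / 2 * y"]
    unfolding q_expand distrib_left by linarith
  then have "exp (- Maxwellian_q a b c B (post_v v w \<omega> - v0) (x - x0) t) * exp (- Maxwellian_q a b c B (post_vs v w \<omega> - v0) (x - x0) t)
    = exp (- Maxwellian_q a b c B (v - v0) (x - x0) t) * exp (- Maxwellian_q a b c B (w - v0) (x - x0) t)" (is "?e1 * ?e2 = ?e3 * ?e4")
    unfolding exp_add[symmetric] by simp
  then have "height * height * (?e1 * ?e2) = height * height * (?e3 * ?e4)" by (rule arg_cong)
  then show ?thesis unfolding M_height by (simp only: mult_ac)
qed

lemma M_transport_rest: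
  assumes "v0 = 0"
  shows "M v (x + t *\<^sub>R v) t = M v x 0"
  by (simp add: M_eq Maxwellian_q_def assms algebra_simps)

text \<open>Along a characteristic the displacement entering the exponent is
  \<open>x - x0 + t *\<^sub>R v0\<close>, which escapes linearly in \<open>t\<close>, so the
  exponent grows quadratically. The constant \<open>k\<close> depends on the characteristic, which
  suffices for a pointwise limit.\<close>

lemma M_transport_moving:
  assumes "v0 \<noteq> 0"
  obtains k where "0 < k" "\<And>t. M v (x + t *\<^sub>R v) t \<le> height * exp (k - t\<^sup>2 / k)"
proof -
  define V where "V = v - v0"
  define X where "X = x - x0"
  define g where "g = b *\<^sub>R V + B *v V"
  define K where "K = (norm g)\<^sup>2 / a + a / 4 * (norm X)\<^sup>2"
  \<comment> \<open>Young's inequality spends half of \<open>a / 2 * (norm Z)\<^sup>2\<close> on the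
    cross term with \<open>g\<close>. The remaining \<open>a / 4 * (norm Z)\<^sup>2\<close> is
    compared with \<open>t *\<^sub>R v0 = Z - X\<close>, which loses another factor 2.\<close>
  define l where "l = a / 8 * (norm v0)\<^sup>2"
  have l: "0 < l" using a assms by (simp add: l_def)
  have K: "0 \<le> K" using a by (simp add: K_def)
  have q: "l * t\<^sup>2 - K \<le> Maxwellian_q a b c B (v - v0) (x + t *\<^sub>R v - x0) t" for t
  proof -
    define Z where "Z = X + t *\<^sub>R v0"
    have Z: "x + t *\<^sub>R v - x0 - t *\<^sub>R V = Z" by (simp add: Z_def X_def V_def algebra_simps)
    have "Maxwellian_q a b c B (v - v0) (x + t *\<^sub>R v - x0) t
       = c / 2 * (norm V)\<^sup>2 + a / 2 * (norm Z)\<^sup>2 + Z \<bullet> g"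
      unfolding Maxwellian_q_def V_def[symmetric] Z skew_inner
      by (simp add: g_def inner_add_right inner_commute add_divide_distrib)
    also have "\<dots> \<ge> a / 2 * (norm Z)\<^sup>2 - norm Z * norm g"
      using c Cauchy_Schwarz_ineq2[of Z g] by (smt (verit) mult_nonneg_nonneg zero_le_power2 divide_nonneg_pos)
    also have "a / 2 * (norm Z)\<^sup>2 - norm Z * norm g \<ge> a / 4 * (norm Z)\<^sup>2 - (norm g)\<^sup>2 / a"
    proof -
      have "a * (a / 2 * (norm Z)\<^sup>2 - norm Z * norm g - (a / 4 * (norm Z)\<^sup>2 - (norm g)\<^sup>2 / a))
         = (a / 2 * norm Z - norm g)\<^sup>2"
        using a by (simp add: field_simps power2_eq_square)
      then have "0 \<le> a * (a / 2 * (norm Z)\<^sup>2 - norm Z * norm g - (a / 4 * (norm Z)\<^sup>2 - (norm g)\<^sup>2 / a))"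
        by simp
      then show ?thesis using a by (simp add: zero_le_mult_iff)
    qed
    also have "a / 4 * (norm Z)\<^sup>2 - (norm g)\<^sup>2 / a \<ge> l * t\<^sup>2 - K"
    proof -
      have "norm (t *\<^sub>R v0) \<le> norm Z + norm X"
        using norm_triangle_ineq4[of Z X] by (simp add: Z_def)
      then have "(norm (t *\<^sub>R v0))\<^sup>2 \<le> (norm Z + norm X)\<^sup>2" by (intro power_mono) auto
      also have "\<dots> \<le> 2 * (norm Z)\<^sup>2 + 2 * (norm X)\<^sup>2"
        using sum_squares_bound[of "norm Z" "norm X"] by (simp add: power2_sum)
      finally have "t\<^sup>2 * (norm v0)\<^sup>2 \<le> 2 * (norm Z)\<^sup>2 + 2 * (norm X)\<^sup>2"
        by (simp add: power_mult_distrib)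
      then have "a / 8 * (t\<^sup>2 * (norm v0)\<^sup>2) \<le> a / 8 * (2 * (norm Z)\<^sup>2 + 2 * (norm X)\<^sup>2)"
        using a by (intro mult_left_mono) auto
      then show ?thesis by (simp add: l_def K_def algebra_simps)
    qed
    finally show ?thesis .
  qed
  show thesis
  \<comment> \<open>One constant serves both roles: it is at least \<open>K\<close>, and its inverse
    is at most \<open>l\<close>.\<close>
  proof (rule that[of "K + 1 / l"])
    show "0 < K + 1 / l" using K l by (simp add: add_nonneg_pos)
    fix t
    have "t\<^sup>2 / (K + 1 / l) \<le> t\<^sup>2 / (1 / l)" using K l by (intro divide_left_mono mult_pos_pos) (auto intro: add_nonneg_pos)
    then have "- Maxwellian_q a b c B (v - v0) (x + t *\<^sub>R v - x0) t \<le> K + 1 / l - t\<^sup>2 / (K + 1 / l)"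
      using q[of t] l by (simp add: mult.commute) (smt (verit) divide_pos_pos)
    then show "M v (x + t *\<^sub>R v) t \<le> height * exp (K + 1 / l - t\<^sup>2 / (K + 1 / l))"
      unfolding M_height using height_pos by (intro mult_left_mono) auto
  qed
qed

lemma M_measurable: "(\<lambda>(v, x, t). M v x t) \<in> borel_measurable borel"
proof -
  have "continuous_on UNIV (\<lambda>p :: (real ^ 'n) \<times> (real ^ 'n) \<times> real. B *v (fst (snd p) - x0 - snd (snd p) *\<^sub>R (fst p - v0)))"
    by (intro continuous_on_compose2[OF linear_continuous_on[OF matrix_vector_mul_bounded_linear]] continuous_intros) auto
  then show ?thesis
    unfolding M_eq Maxwellian_q_def case_prod_beta
    by (intro borel_measurable_continuous_onI continuous_intros) auto
qed

lemma theta_powr_integrable: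
  assumes p: "1 / 2 < p"
  shows "integrable lborel (\<lambda>t. theta t powr (- p))"
proof -
  obtain d where d: "0 < d" "\<And>t. d * (1 + t\<^sup>2) \<le> theta t" using theta_lower by metis
  have [measurable]: "theta \<in> borel_measurable borel" unfolding theta_def by measurable
  have "(\<integral>\<^sup>+t. ennreal (theta t powr (- p)) \<partial>lborel)
     \<le> (\<integral>\<^sup>+t. ennreal (d powr (- p)) * ennreal ((1 + t\<^sup>2) powr (- p)) \<partial>lborel)"
  proof (rule nn_integral_mono)
    fix t :: real
    have "theta t powr (- p) \<le> (d * (1 + t\<^sup>2)) powr (- p)"
      using d p by (intro powr_mono2') (auto intro!: mult_pos_pos add_pos_nonneg)
    also have "\<dots> = d powr (- p) * (1 + t\<^sup>2) powr (- p)" using d by (simp add: powr_mult)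
    finally show "ennreal (theta t powr (- p)) \<le> ennreal (d powr (- p)) * ennreal ((1 + t\<^sup>2) powr (- p))"
      by (simp add: ennreal_mult[symmetric] ennreal_leI)
  qed
  also have "\<dots> = ennreal (d powr (- p)) * (\<integral>\<^sup>+t. ennreal ((1 + t\<^sup>2) powr (- p)) \<partial>lborel)"
    by (rule nn_integral_cmult) auto
  also have "\<dots> < \<infinity>"
    using nn_integral_one_plus_square_powr_finite[OF p] by (simp add: ennreal_mult_less_top)
  finally show ?thesis by (intro integrableI_nonneg) auto
qed

end

section \<open>The attenuation coefficient of a Maxwellian and its time integral\<close>

locale kinetic = maxwellian M m a b c x0 v0 B
  for M :: "real ^ 'n \<Rightarrow> real ^ 'n \<Rightarrow> real \<Rightarrow> real" and m a b c :: real
    and x0 v0 :: "real ^ 'n" and B :: "real ^ 'n ^ 'n" +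
  fixes \<beta> :: real and bh :: "real \<Rightarrow> real" and ker :: "real ^ 'n \<Rightarrow> real ^ 'n \<Rightarrow> real"
  assumes beta: "1 - real CARD('n) < \<beta>" "\<beta> \<le> 0" and kernel: "separated_kernel \<beta> bh ker"
begin

definition mass :: real where "mass = angular_mass bh (SOME n :: real ^ 'n. norm n = 1)"

definition decay :: real where "decay = (real CARD('n) + \<beta>) / 2"

lemma decay: "1 / 2 < decay" using beta by (simp add: decay_def)

lemma mass_nonneg: "0 \<le> mass" unfolding mass_def by (rule angular_mass_nonneg[OF kernel])

lemma measurable_M [measurable (raw)]:
  assumes [measurable]: "f \<in> N \<rightarrow>\<^sub>M borel" "g \<in> N \<rightarrow>\<^sub>M borel" "h \<in> N \<rightarrow>\<^sub>M borel"
  shows "(\<lambda>y. M (f y) (g y) (h y)) \<in> borel_measurable N"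
proof -
  have "(\<lambda>y. (f y, g y, h y)) \<in> N \<rightarrow>\<^sub>M borel"
    by (simp add: borel_prod[symmetric])
  from measurable_compose[OF this M_measurable] show ?thesis by simp
qed

text \<open>Stated for any function below a Gaussian, since it is used both for \<open>M\<close>,
  with inverse variance \<open>theta t\<close>, and for the square root of \<open>M\<close>, with
  half of that.\<close>

lemma potential_bound:
  obtains K where "0 \<le> K"
    "\<And>f h \<theta> u v. f \<in> borel_measurable borel \<Longrightarrow> 0 \<le> h \<Longrightarrow> 0 < \<theta> \<Longrightarrow> (\<And>w. 0 \<le> f w) \<Longrightarrow>
       (\<And>w. f w \<le> h * exp (- \<theta> * (norm (w - u :: real ^ 'n))\<^sup>2 / 2)) \<Longrightarrow>
       integrable lborel (\<lambda>w. f w * norm (v - w) powr \<beta>) \<and>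
       (LINT w|lebesgue. f w * norm (v - w) powr \<beta>) \<le> h * K * \<theta> powr (- decay)"
proof -
  have "- real DIM(real ^ 'n) < \<beta>" using beta by simp
  from nn_integral_gaussian_powr_bound[OF this beta(2)] obtain K where K: "0 \<le> K"
    "\<And>\<theta> (u :: real ^ 'n) v. 0 < \<theta> \<Longrightarrow>
       (\<integral>\<^sup>+w. ennreal (exp (- \<theta> * (norm (w - u))\<^sup>2 / 2) * norm (v - w) powr \<beta>) \<partial>lborel)
         \<le> ennreal (K * \<theta> powr (- (real DIM(real ^ 'n) + \<beta>) / 2))" by blast
  show thesis
  proof (rule that[OF K(1)], goal_cases)
    case (1 f h \<theta> u v)
    note [measurable] = 1(1)
    have pw: "f w * norm (v - w) powr \<beta> \<le> h * (exp (- \<theta> * (norm (w - u))\<^sup>2 / 2) * norm (v - w) powr \<beta>)" for w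
      using mult_right_mono[OF 1(5)[of w], of "norm (v - w) powr \<beta>"] by (simp add: mult.assoc)
    have le: "(\<integral>\<^sup>+w. ennreal (f w * norm (v - w) powr \<beta>) \<partial>lborel) \<le> ennreal (h * K * \<theta> powr (- decay))"
    proof -
      have "(\<integral>\<^sup>+w. ennreal (f w * norm (v - w) powr \<beta>) \<partial>lborel)
        \<le> (\<integral>\<^sup>+w. ennreal h * ennreal (exp (- \<theta> * (norm (w - u))\<^sup>2 / 2) * norm (v - w) powr \<beta>) \<partial>lborel)"
        using pw 1(2) by (intro nn_integral_mono) (auto simp: ennreal_mult[symmetric] intro!: ennreal_leI)
      also have "\<dots> = ennreal h * (\<integral>\<^sup>+w. ennreal (exp (- \<theta> * (norm (w - u))\<^sup>2 / 2) * norm (v - w) powr \<beta>) \<partial>lborel)"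
        by (rule nn_integral_cmult) measurable
      also have "\<dots> \<le> ennreal h * ennreal (K * \<theta> powr (- (real DIM(real ^ 'n) + \<beta>) / 2))"
        by (intro mult_left_mono K(2) 1(3)) simp
      also have "\<dots> = ennreal (h * K * \<theta> powr (- decay))"
        using 1(2) K(1) by (simp add: ennreal_mult[symmetric] decay_def mult.assoc minus_divide_left)
      finally show ?thesis .
    qed
    have int: "integrable lborel (\<lambda>w. f w * norm (v - w) powr \<beta>)"
    proof (rule integrableI_nonneg)
      show "(\<integral>\<^sup>+w. ennreal (f w * norm (v - w) powr \<beta>) \<partial>lborel) < \<infinity>"
        using le by (rule le_less_trans) simp
    qed (use 1(4) in auto)
    have "(LINT w|lebesgue. f w * norm (v - w) powr \<beta>) = (LINT w|lborel. f w * norm (v - w) powr \<beta>)"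
      by (rule integral_completion) measurable
    moreover have "ennreal (LINT w|lborel. f w * norm (v - w) powr \<beta>) \<le> ennreal (h * K * \<theta> powr (- decay))"
      using le nn_integral_eq_integral[OF int] 1(4) by simp
    then have "(LINT w|lborel. f w * norm (v - w) powr \<beta>) \<le> h * K * \<theta> powr (- decay)"
      using 1(2) K(1) by (subst (asm) ennreal_le_iff) auto
    ultimately show ?case using int by simp
  qed
qed

lemma attenuation_bound:
  obtains K where "0 \<le> K" "\<And>v x t. attenuation \<beta> bh M v x t \<le> K * theta t powr (- decay)"
    "\<And>v x t. integrable lborel (\<lambda>w. M w x t * norm (v - w) powr \<beta>)"
proof -
  obtain K where K: "0 \<le> K"
    "\<And>f h \<theta> u v. f \<in> borel_measurable borel \<Longrightarrow> 0 \<le> h \<Longrightarrow> 0 < \<theta> \<Longrightarrow> (\<And>w. 0 \<le> f w) \<Longrightarrow>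
       (\<And>w. f w \<le> h * exp (- \<theta> * (norm (w - u :: real ^ 'n))\<^sup>2 / 2)) \<Longrightarrow>
       integrable lborel (\<lambda>w. f w * norm (v - w) powr \<beta>) \<and>
       (LINT w|lebesgue. f w * norm (v - w) powr \<beta>) \<le> h * K * \<theta> powr (- decay)"
    using potential_bound by blast
  have *: "integrable lborel (\<lambda>w. M w x t * norm (v - w) powr \<beta>) \<and>
      (LINT w|lebesgue. M w x t * norm (v - w) powr \<beta>) \<le> height * K * theta t powr (- decay)" for v x t
    by (rule K(2)[OF _ less_imp_le[OF height_pos] theta_pos less_imp_le[OF M_pos] M_le_gaussian]) measurable
  show thesis
  proof (rule that[of "mass * (height * K)"])
    show "0 \<le> mass * (height * K)" using mass_nonneg height_pos K(1) by simp
    show "attenuation \<beta> bh M v x t \<le> mass * (height * K) * theta t powr (- decay)" for v x t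
      unfolding attenuation_def mass_def[symmetric] using mult_left_mono[OF conjunct2[OF *] mass_nonneg, of x t v] by (simp add: mult.assoc)
    show "integrable lborel (\<lambda>w. M w x t * norm (v - w) powr \<beta>)" for v x t using * by blast
  qed
qed

lemma attenuation_nonneg: "0 \<le> attenuation \<beta> bh M v x t"
  unfolding attenuation_def mass_def[symmetric]
  by (intro mult_nonneg_nonneg mass_nonneg integral_nonneg_AE AE_I2 powr_ge_zero less_imp_le[OF M_pos])

lemma attenuation_measurable [measurable (raw)]:
  assumes [measurable]: "f \<in> N \<rightarrow>\<^sub>M borel" "g \<in> N \<rightarrow>\<^sub>M borel" "h \<in> N \<rightarrow>\<^sub>M borel"
  shows "(\<lambda>y. attenuation \<beta> bh M (f y) (g y) (h y)) \<in> borel_measurable N"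
proof -
  have "attenuation \<beta> bh M v x t = mass * (LINT w|lborel. M w x t * norm (v - w) powr \<beta>)" for v x t
    unfolding attenuation_def mass_def[symmetric] by (subst integral_completion) auto
  then show ?thesis by simp
qed

definition sup_att :: "real \<Rightarrow> real" where
  "sup_att t = enn2real (Linf_norm (\<lambda>v x. attenuation \<beta> bh M v x t))"

lemma Linf_attenuation_le:
  assumes "\<And>v x. attenuation \<beta> bh M v x t \<le> C"
  shows "Linf_norm (\<lambda>v x. attenuation \<beta> bh M v x t) \<le> ennreal C"
  unfolding Linf_norm_def
proof (rule esssup_I)
  show "(\<lambda>(v, x). ennreal \<bar>attenuation \<beta> bh M v x t\<bar>) \<in> borel_measurable lebesgue"
    by (rule measurable_completion) (simp add: lborel_prod[symmetric] case_prod_beta)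
  show "AE p in lebesgue. (case p of (v, x) \<Rightarrow> ennreal \<bar>attenuation \<beta> bh M v x t\<bar>) \<le> ennreal C"
    by (rule AE_I2) (auto intro!: ennreal_leI simp: attenuation_nonneg assms)
qed

lemma Linf_attenuation: "ennreal (sup_att t) = Linf_norm (\<lambda>v x. attenuation \<beta> bh M v x t)"
proof -
  obtain K where "\<And>v x t. attenuation \<beta> bh M v x t \<le> K * theta t powr (- decay)"
    using attenuation_bound by metis
  from Linf_attenuation_le[OF this] show ?thesis
    unfolding sup_att_def by (intro ennreal_enn2real le_less_trans[OF _ ennreal_less_top])
qed

lemma sup_att_nonneg: "0 \<le> sup_att t" by (simp add: sup_att_def)

lemma AE_attenuation_le_sup: "AE (v, x) in lborel. attenuation \<beta> bh M v x t \<le> sup_att t"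
proof -
  have "AE p in lebesgue. (case p of (v, x) \<Rightarrow> ennreal \<bar>attenuation \<beta> bh M v x t\<bar>) \<le> ennreal (sup_att t)"
    unfolding Linf_attenuation Linf_norm_def by (rule esssup_AE)
  then have "AE p in lborel. (case p of (v, x) \<Rightarrow> ennreal \<bar>attenuation \<beta> bh M v x t\<bar>) \<le> ennreal (sup_att t)"
    by (simp only: AE_completion_iff)
  then show ?thesis
    by eventually_elim (auto simp: sup_att_nonneg attenuation_nonneg)
qed

text \<open>The essential supremum is at most \<open>y\<close> when almost every phase point obeys
  the bound, and by \<open>lborel.measurable_pred_AE\<close> this condition depends measurably on
  \<open>t\<close>.\<close>

lemma sup_att_measurable [measurable]: "sup_att \<in> borel_measurable borel"
proof -
  have "(\<lambda>t. Linf_norm (\<lambda>v x. attenuation \<beta> bh M v x t)) \<in> borel_measurable borel"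
  proof (rule borel_measurableI_le)
    fix y :: ennreal
    have eq: "Linf_norm (\<lambda>v x. attenuation \<beta> bh M v x t) \<le> y
       \<longleftrightarrow> (AE p in (lborel :: ((real ^ 'n) \<times> (real ^ 'n)) measure). ennreal \<bar>attenuation \<beta> bh M (fst p) (snd p) t\<bar> \<le> y)" for t
    proof -
      have m: "(\<lambda>(v, x). ennreal \<bar>attenuation \<beta> bh M v x t\<bar>) \<in> borel_measurable lebesgue"
        by (rule measurable_completion) (simp add: lborel_prod[symmetric] case_prod_beta)
      have "Linf_norm (\<lambda>v x. attenuation \<beta> bh M v x t) \<le> y
        \<longleftrightarrow> (AE p in lebesgue. (case p of (v, x) \<Rightarrow> ennreal \<bar>attenuation \<beta> bh M v x t\<bar>) \<le> y)" (is "?L \<le> y \<longleftrightarrow> ?R")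
      proof
        assume "?L \<le> y"
        then show ?R using esssup_AE[of "\<lambda>(v, x). ennreal \<bar>attenuation \<beta> bh M v x t\<bar>" lebesgue]
          unfolding Linf_norm_def by (auto elim!: eventually_mono intro: order_trans)
      next
        assume ?R then show "?L \<le> y" unfolding Linf_norm_def by (intro esssup_I m)
      qed
      then show ?thesis by (simp only: AE_completion_iff case_prod_beta)
    qed
    have "Measurable.pred borel (\<lambda>t. AE p in (lborel :: ((real ^ 'n) \<times> (real ^ 'n)) measure).
        (\<lambda>q. ennreal \<bar>attenuation \<beta> bh M (fst (snd q)) (snd (snd q)) (fst q)\<bar> \<le> y) (t, p))"
      by (rule lborel.measurable_pred_AE) (simp add: lborel_prod[symmetric])
    then show "{t \<in> space borel. Linf_norm (\<lambda>v x. attenuation \<beta> bh M v x t) \<le> y} \<in> sets borel"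
      unfolding eq by (simp add: pred_def)
  qed
  then show ?thesis unfolding sup_att_def by measurable
qed

lemma sup_att_integrable: "integrable lborel sup_att"
proof -
  obtain K where K: "0 \<le> K" "\<And>v x t. attenuation \<beta> bh M v x t \<le> K * theta t powr (- decay)"
    using attenuation_bound by metis
  show ?thesis
  proof (rule Bochner_Integration.integrable_bound[OF integrable_mult_right[OF theta_powr_integrable[OF decay], of K]])
    show "AE t in lborel. norm (sup_att t) \<le> norm (K * theta t powr (- decay))"
    proof (rule AE_I2)
      fix t
      have "ennreal (sup_att t) \<le> ennreal (K * theta t powr (- decay))"
        unfolding Linf_attenuation by (rule Linf_attenuation_le[OF K(2)])
      then show "norm (sup_att t) \<le> norm (K * theta t powr (- decay))"
        using K(1) sup_att_nonneg[of t] by simp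
    qed
  qed simp
qed

lemma integral_sup_att: "(LINT t|lborel. sup_att t) = mu \<beta> bh M"
proof -
  have "(\<integral>\<^sup>+t. Linf_norm (\<lambda>v x. attenuation \<beta> bh M v x t) \<partial>lborel) = ennreal (LINT t|lborel. sup_att t)"
    unfolding Linf_attenuation[symmetric]
    by (rule nn_integral_eq_integral[OF sup_att_integrable]) (simp add: sup_att_nonneg)
  then show ?thesis by (simp add: mu_def integral_nonneg_AE sup_att_nonneg)
qed

end

section \<open>Duhamel's formula and stability\<close>

lemma AE_transport:
  fixes P :: "'a::euclidean_space \<Rightarrow> 'a \<Rightarrow> bool"
  assumes "AE (v, x) in lborel. P v x"
  shows "AE (v, x) in lborel. P v (x + t *\<^sub>R v)"
proof -
  have "linear (\<lambda>(v :: 'a, x). (v, x - t *\<^sub>R v))"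
    by (auto intro!: linearI simp: algebra_simps)
  from AE_lborel_linear_bij[OF this, of "\<lambda>(v, x). (v, x + t *\<^sub>R v)", OF _ assms]
  show ?thesis by (simp add: case_prod_beta)
qed

lemma AE_transport_iff:
  fixes P :: "'a::euclidean_space \<Rightarrow> 'a \<Rightarrow> bool"
  shows "(AE (v, x) in lborel. P v (x + t *\<^sub>R v)) \<longleftrightarrow> (AE (v, x) in lborel. P v x)"
proof
  assume "AE (v, x) in lborel. P v (x + t *\<^sub>R v)"
  from AE_transport[OF this, of "- t"] show "AE (v, x) in lborel. P v x" by simp
qed (rule AE_transport)

lemma AE_time_slices:
  fixes P :: "'a::euclidean_space \<Rightarrow> 'b::euclidean_space \<Rightarrow> 'c::euclidean_space \<Rightarrow> bool"
  assumes "AE (v, x, t) in lborel. P v x t"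
  shows "AE t in lborel. AE (v, x) in lborel. P v x t"
proof -
  obtain N where N: "N \<in> sets borel" "AE p in lborel. p \<notin> N" "\<And>p. p \<notin> N \<Longrightarrow> case p of (v, x, t) \<Rightarrow> P v x t"
    using AE_lborel_borel_null[OF assms] by blast
  have "AE t in lborel. AE (v, x) in lborel. (v, x, t) \<notin> N"
    using N(2) by (subst AE_lborel_triple_iff(1)[symmetric]) (use N(1) in simp)
  then show ?thesis by eventually_elim (auto elim!: eventually_mono dest: N(3))
qed

text \<open>Free transport at a fixed time preserves null sets, so a null set of phase space and
  time can be sheared slice by slice and recombined. This carries facts known almost everywhere to
  Duhamel integrals, which follow a single characteristic.\<close>

lemma AE_characteristics:
  fixes P :: "'a::euclidean_space \<Rightarrow> 'a \<Rightarrow> real \<Rightarrow> bool"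
  assumes "AE (v, x, t) in lborel. P v x t"
  shows "AE (v, x) in lborel. AE t in lborel. P v (x + t *\<^sub>R v) t"
proof -
  obtain N where N: "N \<in> sets borel" "AE p in lborel. p \<notin> N" "\<And>p. p \<notin> N \<Longrightarrow> case p of (v, x, t) \<Rightarrow> P v x t"
    using AE_lborel_borel_null[OF assms] by blast
  have [measurable]: "Measurable.pred borel (\<lambda>p. p \<notin> N)" using N(1) by simp
  have m: "Measurable.pred borel (\<lambda>(v :: 'a, x, t :: real). (v, x + t *\<^sub>R v, t) \<notin> N)"
    by (simp add: borel_prod[symmetric] case_prod_beta)
  have "AE t in lborel. AE (v, x) in lborel. (v, x, t) \<notin> N"
    using N(2) by (subst AE_lborel_triple_iff(1)[symmetric]) auto
  then have "AE t in lborel. AE (v, x) in lborel. (v, x + t *\<^sub>R v, t) \<notin> N"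
    by eventually_elim (rule AE_transport)
  then have "AE (v, x) in lborel. AE t in lborel. (v, x + t *\<^sub>R v, t) \<notin> N"
    using AE_lborel_triple_iff[OF m] by (simp add: case_prod_beta)
  then show ?thesis by eventually_elim (auto elim!: eventually_mono dest: N(3))
qed

text \<open>Recombining slices is the direction of Fubini that requires measurability; it is the
  reason for the Borel representatives below.\<close>

lemma AE_of_time_slices:
  fixes P :: "'a::euclidean_space \<Rightarrow> 'b::euclidean_space \<Rightarrow> 'c::euclidean_space \<Rightarrow> bool"
  assumes "Measurable.pred borel (\<lambda>(v, x, t). P v x t)"
    and "AE t in lborel. AE (v, x) in lborel. P v x t"
  shows "AE (v, x, t) in lborel. P v x t"
  using AE_lborel_triple_iff(1)[OF assms(1)] assms(2) by simp

section \<open>Duhamel's formula with Borel representatives\<close>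

definition borel_on :: "real set \<Rightarrow> ('a::euclidean_space \<Rightarrow> 'a \<Rightarrow> real \<Rightarrow> real) \<Rightarrow> ('a \<times> 'a \<times> real \<Rightarrow> real) \<Rightarrow> bool" where
  "borel_on I f g \<longleftrightarrow> g \<in> borel_measurable borel \<and> (AE (v, x, t) in lborel. t \<in> I \<longrightarrow> f v x t = g (v, x, t))"

text \<open>Keeping the source \<open>e\<close> abstract lets the same estimates serve one solution
  with its collision integral and the difference of two solutions. Representatives are recorded
  because local integrability gives only Lebesgue measurability.\<close>

definition duhamel :: "real set \<Rightarrow> ('a::euclidean_space \<Rightarrow> 'a \<Rightarrow> real \<Rightarrow> real) \<Rightarrow> ('a \<Rightarrow> 'a \<Rightarrow> real \<Rightarrow> real) \<Rightarrow> bool" where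
  "duhamel I d e \<longleftrightarrow> (\<exists>g. borel_on I d g) \<and> (\<exists>g. borel_on I e g) \<and>
     (\<forall>t1\<in>I. \<forall>t2\<in>I. AE (v, x) in lborel.
        d v (x + t2 *\<^sub>R v) t2 = d v (x + t1 *\<^sub>R v) t1 + (LINT s=t1..t2|lebesgue. e v (x + s *\<^sub>R v) s))"

text \<open>A compact exhaustion of \<open>S\<close> exhibits \<open>f\<close>, cut off to
  \<open>S\<close>, as a pointwise limit of Lebesgue measurable functions.\<close>

lemma L1_loc_borel_rep:
  fixes f :: "'a::euclidean_space \<Rightarrow> real"
  assumes S: "open S" and f: "L1_loc S f"
  obtains g where "g \<in> borel_measurable borel" "AE x in lborel. x \<in> S \<longrightarrow> f x = g x"
proof -
  obtain C where C: "\<And>n. compact (C n)" "\<And>n. C n \<subseteq> S" "\<And>n. C n \<subseteq> interior (C (Suc n))" "\<Union>(range C) = S"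
    using open_Union_compact_subsets[OF S] by metis
  have mono: "C n \<subseteq> C k" if "n \<le> k" for n k
    using that by (rule lift_Suc_mono_le[of C, rotated]) (use C(3) interior_subset in blast)
  have "(\<lambda>x. indicator S x *\<^sub>R f x) \<in> borel_measurable lebesgue"
  proof (rule borel_measurable_LIMSEQ_metric)
    fix n
    have "f absolutely_integrable_on C n" using f C by (auto simp: L1_loc_def)
    then show "(\<lambda>x. indicator (C n) x *\<^sub>R f x) \<in> borel_measurable lebesgue"
      unfolding set_integrable_def by (rule borel_measurable_integrable)
  next
    fix x
    show "(\<lambda>n. indicator (C n) x *\<^sub>R f x) \<longlonglongrightarrow> indicator S x *\<^sub>R f x"
    proof (cases "x \<in> S")
      case True
      then obtain n where n: "x \<in> C n" using C(4) by auto
      have "eventually (\<lambda>k. indicator (C k) x *\<^sub>R f x = f x) sequentially"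
        using eventually_ge_at_top[of n]
      proof eventually_elim
        case (elim k)
        then have "x \<in> C k" using mono n by blast
        then show ?case by simp
      qed
      then show ?thesis using True by (simp add: tendsto_eventually)
    next
      case False
      then have "x \<notin> C n" for n using C by auto
      then show ?thesis using False by simp
    qed
  qed
  from completion_ex_borel_measurable_real[OF this] obtain g where
    g: "g \<in> borel_measurable lborel" "AE x in lborel. indicator S x *\<^sub>R f x = g x" by auto
  show thesis
  proof (rule that)
    show "g \<in> borel_measurable borel" using g by simp
    show "AE x in lborel. x \<in> S \<longrightarrow> f x = g x" using g(2) by eventually_elim auto
  qed
qed

lemma L1_loc_borel_on:
  fixes f :: "'a::euclidean_space \<Rightarrow> 'a \<Rightarrow> real \<Rightarrow> real"
  assumes "open I" "L1_loc (UNIV \<times> UNIV \<times> I) (\<lambda>(v, x, t). f v x t)"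
  obtains g where "borel_on I f g"
proof -
  have "open (UNIV \<times> UNIV \<times> I :: ('a \<times> 'a \<times> real) set)" using assms(1) by (intro open_Times) auto
  from L1_loc_borel_rep[OF this assms(2)] obtain g where
    "g \<in> borel_measurable borel" "AE p in lborel. p \<in> UNIV \<times> UNIV \<times> I \<longrightarrow> (\<lambda>(v, x, t). f v x t) p = g p" by blast
  then show thesis by (intro that[of g]) (auto simp: borel_on_def elim!: eventually_mono)
qed

lemma integral_abs_le_of_AE_le:
  fixes f g :: "'a \<Rightarrow> real"
  assumes g: "integrable M g" and fg: "AE x in M. \<bar>f x\<bar> \<le> g x"
  shows "\<bar>integral\<^sup>L M f\<bar> \<le> integral\<^sup>L M g"
proof (cases "integrable M f")
  case True
  have "\<bar>integral\<^sup>L M f\<bar> \<le> (LINT x|M. \<bar>f x\<bar>)" by (rule integral_abs_bound)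
  also have "\<dots> \<le> integral\<^sup>L M g" using True g fg by (intro integral_mono_AE) auto
  finally show ?thesis .
next
  \<comment> \<open>The default value \<open>0\<close> of a nonexistent Bochner integral satisfies
    the bound as well, so domination by \<open>g\<close> is all that has to be checked.\<close>
  case False
  have "0 \<le> integral\<^sup>L M g" using fg by (intro integral_nonneg_AE) (auto elim!: eventually_mono)
  then show ?thesis using False by (simp add: not_integrable_integral_eq)
qed

lemma interval_integral_abs_le:
  fixes f g :: "real \<Rightarrow> real"
  assumes g: "integrable lborel g" and fg: "AE s in lborel. s \<in> {min t1 t2..max t1 t2} \<longrightarrow> \<bar>f s\<bar> \<le> g s"
  shows "\<bar>LINT s=t1..t2|lebesgue. f s\<bar> \<le> (LINT s:{min t1 t2..max t1 t2}|lborel. g s)"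
proof -
  let ?J = "{min t1 t2..max t1 t2}" and ?E = "{min t1 t2<..<max t1 t2}"
  have gm[measurable]: "g \<in> borel_measurable borel" using borel_measurable_integrable[OF g] by simp
  have "\<bar>LINT s=t1..t2|lebesgue. f s\<bar> = \<bar>LINT s:?E|lebesgue. f s\<bar>"
    by (auto simp: interval_lebesgue_integral_def min_def max_def)
  also have "\<dots> \<le> (LINT s|lebesgue. indicator ?J s * g s)"
    unfolding set_lebesgue_integral_def
  proof (rule integral_abs_le_of_AE_le)
    have "integrable lborel (\<lambda>s. indicator ?J s * g s)"
      using integrable_real_mult_indicator[OF _ g, of ?J] by (simp add: mult.commute)
    then show "integrable lebesgue (\<lambda>s. indicator ?J s * g s)"
      by (subst integrable_completion) auto
    have "AE s in lebesgue. s \<in> ?J \<longrightarrow> \<bar>f s\<bar> \<le> g s" using fg by (simp only: AE_completion_iff)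
    then show "AE s in lebesgue. \<bar>indicator ?E s *\<^sub>R f s\<bar> \<le> indicator ?J s * g s"
      by eventually_elim (auto simp: indicator_def)
  qed
  also have "\<dots> = (LINT s:?J|lborel. g s)"
    unfolding set_lebesgue_integral_def by (subst integral_completion) auto
  finally show ?thesis .
qed

text \<open>A nonempty open set is not negligible. The lemma selects a time at which an
  almost-everywhere bound really holds, from which Duhamel's formula can be started.\<close>

lemma open_AE_witness:
  fixes I :: "real set"
  assumes I: "open I" "t \<in> I" and P: "AE s in lborel. s \<in> I \<longrightarrow> P s"
  obtains T where "T \<in> I" "P T"
proof (rule ccontr)
  assume "\<not> thesis"
  then have "\<forall>T\<in>I. \<not> P T" using that by blast
  with P have "AE s in lborel. s \<notin> I" by (auto elim!: eventually_mono)
  then have "emeasure lborel I = 0" using I by (simp add: AE_iff_measurable[OF _ refl])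
  then have "I \<in> null_sets lborel" using I by auto
  then have "negligible I" by (simp add: negligible_iff_null_sets null_sets_completionI)
  then show False using open_not_negligible I by blast
qed

text \<open>The common setting of the two Gronwall arguments: the difference of two solutions with
  weight \<open>M\<close>, and a single solution with weight 1. \<open>I_between\<close> says that
  \<open>I\<close> is an interval, in a form that covers integration in both time
  directions.\<close>

locale duhamel_bound =
  fixes I :: "real set" and d e W :: "'a::euclidean_space \<Rightarrow> 'a \<Rightarrow> real \<Rightarrow> real"
    and W0 :: "'a \<Rightarrow> 'a \<Rightarrow> real" and \<alpha> :: "real \<Rightarrow> real" and C :: real
  assumes I_between: "\<And>s t. s \<in> I \<Longrightarrow> t \<in> I \<Longrightarrow> {min s t..max s t} \<subseteq> I"
    and I_open: "open I"
    and duhamel: "duhamel I d e"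
    and W_measurable: "(\<lambda>(v, x, t). W v x t) \<in> borel_measurable borel"
    and W_pos: "\<And>v x t. 0 < W v x t"
    and W_transport: "\<And>v x t. W v (x + t *\<^sub>R v) t = W0 v x"
    and \<alpha>_integrable: "integrable lborel \<alpha>" and \<alpha>_nonneg: "\<And>t. 0 \<le> \<alpha> t"
    and C_nonneg: "0 \<le> C"
    and a_priori: "AE t in lborel. t \<in> I \<longrightarrow> (AE (v, x) in lborel. \<bar>d v x t\<bar> \<le> C * W v x t)"
    and contraction: "AE t in lborel. t \<in> I \<longrightarrow> (\<forall>K\<ge>0. (AE (v, x) in lborel. \<bar>d v x t\<bar> \<le> K * W v x t) \<longrightarrow>
           (AE (v, x) in lborel. \<bar>e v x t\<bar> \<le> K * W v x t * \<alpha> t))"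
begin

lemma \<alpha>_measurable [measurable]: "\<alpha> \<in> borel_measurable borel"
  using borel_measurable_integrable[OF \<alpha>_integrable] by simp

lemma W0_nonneg: "0 \<le> W0 v x"
  using W_pos[of v "x + 0 *\<^sub>R v" 0] W_transport[of v x 0] by simp

text \<open>Slice bounds on \<open>e\<close> are carried to characteristics, where \<open>W\<close>
  has the constant value \<open>W0 v x\<close>, and inserted into Duhamel's formula. The detour
  through the representative \<open>g\<close> supplies the measurability needed to combine
  slices.\<close>

lemma estimate:
  assumes t: "t \<in> I" and T: "T \<in> I" and K: "0 \<le> K"
    and bound: "AE s in lborel. s \<in> {min T t..max T t} \<longrightarrow> (AE (v, x) in lborel. \<bar>d v x s\<bar> \<le> K * W v x s)"
  shows "AE (v, x) in lborel. \<bar>d v (x + t *\<^sub>R v) t\<bar> \<le> \<bar>d v (x + T *\<^sub>R v) T\<bar>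
           + K * W0 v x * (LINT s:{min T t..max T t}|lborel. \<alpha> s)"
proof -
  let ?J = "{min T t..max T t}"
  have J: "?J \<subseteq> I" by (rule I_between[OF T t])
  obtain g where g[measurable]: "g \<in> borel_measurable borel" and eg: "AE (v, x, s) in lborel. s \<in> I \<longrightarrow> e v x s = g (v, x, s)"
    using duhamel by (auto simp: duhamel_def borel_on_def)
  have "AE (v, x, s) in lborel. s \<in> ?J \<longrightarrow> \<bar>g (v, x, s)\<bar> \<le> K * W v x s * \<alpha> s"
  proof (rule AE_of_time_slices)
    have [measurable]: "(\<lambda>q :: 'a \<times> 'a \<times> real. snd (snd q)) \<in> borel \<rightarrow>\<^sub>M borel"
      by (intro borel_measurable_continuous_onI continuous_intros)
    define Wq where "Wq q = W (fst q) (fst (snd q)) (snd (snd q))" for q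
    have [measurable]: "Wq \<in> borel_measurable borel"
      using W_measurable unfolding case_prod_unfold Wq_def[abs_def] .
    have eq: "(\<lambda>(v, x, s). s \<in> ?J \<longrightarrow> \<bar>g (v, x, s)\<bar> \<le> K * W v x s * \<alpha> s)
       = (\<lambda>q. snd (snd q) \<in> ?J \<longrightarrow> \<bar>g q\<bar> \<le> K * Wq q * \<alpha> (snd (snd q)))"
      by (rule ext) (simp only: Wq_def case_prod_unfold prod.collapse)
    show "Measurable.pred borel (\<lambda>(v, x, s). s \<in> ?J \<longrightarrow> \<bar>g (v, x, s)\<bar> \<le> K * W v x s * \<alpha> s)"
      unfolding eq by measurable
    show "AE s in lborel. AE (v, x) in lborel. s \<in> ?J \<longrightarrow> \<bar>g (v, x, s)\<bar> \<le> K * W v x s * \<alpha> s"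
      using bound contraction AE_time_slices[OF eg]
    proof eventually_elim
      case (elim s)
      show ?case
      proof (cases "s \<in> ?J")
        case True
        then have sI: "s \<in> I" using J by auto
        have "AE (v, x) in lborel. \<bar>e v x s\<bar> \<le> K * W v x s * \<alpha> s" using elim(1,2) True sI K by auto
        with elim(3) show ?thesis by eventually_elim (use sI in auto)
      next
        case False
        then show ?thesis by (intro AE_I2) auto
      qed
    qed
  qed
  then have g_char: "AE (v, x) in lborel. AE s in lborel. s \<in> ?J \<longrightarrow> \<bar>g (v, x + s *\<^sub>R v, s)\<bar> \<le> K * W v (x + s *\<^sub>R v) s * \<alpha> s"
    by (rule AE_characteristics)
  have e_char: "AE (v, x) in lborel. AE s in lborel. s \<in> I \<longrightarrow> e v (x + s *\<^sub>R v) s = g (v, x + s *\<^sub>R v, s)"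
    by (rule AE_characteristics) (rule eg)
  have du: "AE (v, x) in lborel. d v (x + t *\<^sub>R v) t = d v (x + T *\<^sub>R v) T + (LINT s=T..t|lebesgue. e v (x + s *\<^sub>R v) s)"
    using duhamel t T by (auto simp: duhamel_def)
  show ?thesis using g_char e_char du
  proof eventually_elim
    case (elim p)
    obtain v x where p: "p = (v, x)" by (cases p)
    have "AE s in lborel. s \<in> ?J \<longrightarrow> \<bar>e v (x + s *\<^sub>R v) s\<bar> \<le> K * W0 v x * \<alpha> s"
      using elim(1,2) unfolding p case_prod_conv
      by eventually_elim (use J W_transport in auto)
    from interval_integral_abs_le[OF integrable_mult_right[OF \<alpha>_integrable] this]
    have "\<bar>LINT s=T..t|lebesgue. e v (x + s *\<^sub>R v) s\<bar> \<le> K * W0 v x * (LINT s:?J|lborel. \<alpha> s)"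
      by (simp add: set_integral_mult_right)
    then show ?case using elim(3) by (simp add: p)
  qed
qed

definition bounded_by :: "real \<Rightarrow> real \<Rightarrow> bool" where
  "bounded_by K t \<longleftrightarrow> (AE (v, x) in lborel. \<bar>d v x t\<bar> \<le> K * W v x t)"

text \<open>Pulled back along characteristics the weight no longer depends on time, so bounds at
  different times can be compared at the same \<open>(v, x)\<close>.\<close>

lemma bounded_by_char: "bounded_by K t \<longleftrightarrow> (AE (v, x) in lborel. \<bar>d v (x + t *\<^sub>R v) t\<bar> \<le> K * W0 v x)"
  unfolding bounded_by_def
  by (subst AE_transport_iff[symmetric, of _ t]) (simp add: W_transport)

lemma bounded_by_mono: "bounded_by K t \<Longrightarrow> K \<le> L \<Longrightarrow> bounded_by L t"
  unfolding bounded_by_def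
  by (erule eventually_mono) (auto intro: order_trans mult_right_mono less_imp_le[OF W_pos])

definition tot :: real where "tot = (LINT s|lborel. \<alpha> s)"

lemma \<alpha>_indicator_integrable: "J \<in> sets borel \<Longrightarrow> integrable lborel (\<lambda>s. indicat_real J s *\<^sub>R \<alpha> s)"
  by (rule integrable_mult_indicator[OF _ \<alpha>_integrable]) simp

lemma set_integral_mono_\<alpha>:
  assumes "J \<in> sets borel" "J' \<in> sets borel" "J \<subseteq> J'"
  shows "(LINT s:J|lborel. \<alpha> s) \<le> (LINT s:J'|lborel. \<alpha> s)"
  unfolding set_lebesgue_integral_def
proof (rule integral_mono)
  show "indicat_real J s *\<^sub>R \<alpha> s \<le> indicat_real J' s *\<^sub>R \<alpha> s" for s
    using assms(3) \<alpha>_nonneg[of s] by (auto simp: indicator_def)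
qed (use assms in \<open>simp_all only: \<alpha>_indicator_integrable\<close>)

lemma set_integral_le_tot: "J \<in> sets borel \<Longrightarrow> (LINT s:J|lborel. \<alpha> s) \<le> tot"
  using set_integral_mono_\<alpha>[of J UNIV] by (simp add: tot_def set_lebesgue_integral_def)

lemma tot_nonneg: "0 \<le> tot" unfolding tot_def by (simp add: \<alpha>_nonneg integral_nonneg_AE)

lemma set_integral_nonneg_\<alpha>: "0 \<le> (LINT s:J|lborel. \<alpha> s)"
  unfolding set_lebesgue_integral_def by (auto intro!: integral_nonneg_AE simp: \<alpha>_nonneg)

lemma step:
  assumes "t \<in> I" "T \<in> I" "0 \<le> K" "0 \<le> L" "bounded_by L T"
    and "AE s in lborel. s \<in> {min T t..max T t} \<longrightarrow> bounded_by K s"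
  shows "bounded_by (L + K * (LINT s:{min T t..max T t}|lborel. \<alpha> s)) t"
  using estimate[OF assms(1,2,3) assms(6)[unfolded bounded_by_def]] assms(5)
  unfolding bounded_by_char
proof eventually_elim
  case (elim p)
  obtain v x where p: "p = (v, x)" by (cases p)
  have "\<bar>d v (x + t *\<^sub>R v) t\<bar> \<le> L * W0 v x + K * W0 v x * (LINT s:{min T t..max T t}|lborel. \<alpha> s)"
    using elim by (simp add: p)
  then show ?case by (simp add: p algebra_simps)
qed

text \<open>\<open>a_priori\<close> leaves out a null set of times. Duhamel's formula from a good
  time \<open>T\<close> fills the gap, and the source adds at most \<open>C * tot\<close>.\<close>

lemma a_priori_everywhere:
  assumes "t \<in> I" shows "bounded_by (C + C * tot) t"
proof -
  obtain T where T: "T \<in> I" "bounded_by C T"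
    by (rule open_AE_witness[OF I_open assms a_priori[folded bounded_by_def]])
  have "AE s in lborel. s \<in> {min T t..max T t} \<longrightarrow> bounded_by C s"
    using a_priori I_between[OF T(1) assms] by (auto simp: bounded_by_def elim!: eventually_mono)
  from step[OF assms T(1) C_nonneg C_nonneg T(2) this] show ?thesis
    by (rule bounded_by_mono) (auto intro!: mult_left_mono set_integral_le_tot C_nonneg)
qed

text \<open>This is the weighted supremum norm of \<open>d\<close> as a real number; by
  \<open>a_priori_everywhere\<close> the set of bounds is nonempty at every time of
  \<open>I\<close>.\<close>

definition N :: "real \<Rightarrow> real" where "N t = Inf {K. 0 \<le> K \<and> bounded_by K t}"

lemma N_nonneg: assumes "t \<in> I" shows "0 \<le> N t"
  unfolding N_def using a_priori_everywhere[OF assms] C_nonneg tot_nonneg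
  by (intro cInf_greatest) (auto intro: exI[of _ "C + C * tot"])

lemma N_le: "0 \<le> K \<Longrightarrow> bounded_by K t \<Longrightarrow> N t \<le> K"
  unfolding N_def by (rule cInf_lower) (auto intro: bdd_belowI[of _ 0])

text \<open>The infimum is attained because the bounds \<open>N t + inverse (real (Suc n))\<close>
  involve only countably many null sets.\<close>

lemma bounded_by_N: assumes t: "t \<in> I" shows "bounded_by (N t) t"
proof -
  have "bounded_by (N t + inverse (real (Suc n))) t" for n
  proof -
    have "N t < N t + inverse (real (Suc n))" by simp
    then have "\<exists>K\<in>{K. 0 \<le> K \<and> bounded_by K t}. K < N t + inverse (real (Suc n))"
      unfolding N_def[of t] using a_priori_everywhere[OF t] C_nonneg tot_nonneg
      by (subst (asm) cInf_less_iff) (auto intro: bdd_belowI[of _ 0] exI[of _ "C + C * tot"])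
    then show ?thesis by (auto intro: bounded_by_mono)
  qed
  then have "AE p in lborel. \<forall>n. case p of (v, x) \<Rightarrow> \<bar>d v x t\<bar> \<le> (N t + inverse (real (Suc n))) * W v x t"
    unfolding bounded_by_def AE_all_countable by blast
  then show ?thesis unfolding bounded_by_def
  proof eventually_elim
    case (elim p)
    obtain v x where p: "p = (v, x)" by (cases p)
    have "(\<lambda>n. (N t + inverse (real (Suc n))) * W v x t) \<longlonglongrightarrow> (N t + 0) * W v x t"
      by (intro tendsto_intros LIMSEQ_inverse_real_of_nat)
    then show ?case using elim by (auto simp: p intro!: LIMSEQ_le_const)
  qed
qed

lemma N_step:
  assumes "t \<in> I" "T \<in> I" "0 \<le> K" "\<And>s. s \<in> {min T t..max T t} \<Longrightarrow> N s \<le> K"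
  shows "N t \<le> N T + K * (LINT s:{min T t..max T t}|lborel. \<alpha> s)"
proof (rule N_le)
  show "bounded_by (N T + K * (LINT s:{min T t..max T t}|lborel. \<alpha> s)) t"
  proof (intro step AE_I2 impI bounded_by_N N_nonneg assms(1-3))
    fix s assume s: "s \<in> {min T t..max T t}"
    then have "s \<in> I" using I_between[OF assms(2,1)] by blast
    then show "bounded_by K s" by (rule bounded_by_mono[OF bounded_by_N]) (rule assms(4)[OF s])
  qed
  show "0 \<le> N T + K * (LINT s:{min T t..max T t}|lborel. \<alpha> s)"
    using assms by (intro add_nonneg_nonneg mult_nonneg_nonneg N_nonneg set_integral_nonneg_\<alpha>) auto
qed

text \<open>The rate \<open>\<alpha>\<close> is merely integrable, but its primitive
  \<open>A\<close> is continuous and monotone and can play the part of \<open>E\<close> in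
  \<open>gronwall_interval\<close>. The time \<open>t\<close> may lie on either side of
  \<open>T\<close>.\<close>

lemma N_exp_bound:
  assumes t: "t \<in> I" and T: "T \<in> I"
  shows "N t \<le> N T * exp tot"
proof -
  define lo hi where "lo = min T t" and "hi = max T t"
  have sub: "{lo..hi} \<subseteq> I" using I_between[OF T t] by (simp add: lo_def hi_def)
  define A where "A s = integral {lo..s} \<alpha>" for s
  have ai: "\<alpha> absolutely_integrable_on J" if "J \<in> sets borel" for J
    using that integrable_mult_indicator[OF _ \<alpha>_integrable, of J]
    by (simp add: set_integrable_def integrable_completion)
  have int: "\<alpha> integrable_on {r..s}" for r s
    using ai[of "{r..s}"] by (auto intro: set_lebesgue_integral_eq_integral(1))
  have eq: "(LINT u:{r..s}|lborel. \<alpha> u) = integral {r..s} \<alpha>" for r s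
  proof -
    have "(LINT u:{r..s}|lborel. \<alpha> u) = (LINT u:{r..s}|lebesgue. \<alpha> u)"
      unfolding set_lebesgue_integral_def by (subst integral_completion) auto
    also have "\<dots> = integral {r..s} \<alpha>" by (rule set_lebesgue_integral_eq_integral(2)[OF ai]) simp
    finally show ?thesis .
  qed
  have A_diff: "A s - A r = (LINT u:{r..s}|lborel. \<alpha> u)" if "lo \<le> r" "r \<le> s" for r s
    unfolding eq A_def using Henstock_Kurzweil_Integration.integral_combine[OF that int] by simp
  have A_mono: "A r \<le> A s" if "lo \<le> r" "r \<le> s" for r s
    using A_diff[OF that] set_integral_nonneg_\<alpha>[of "{r..s}"] by simp
  have A_cont: "continuous_on {lo..hi} A" unfolding A_def by (rule indefinite_integral_continuous_1[OF int])
  have A_tot: "A s - A r \<le> tot" if "lo \<le> r" "r \<le> s" for r s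
    unfolding A_diff[OF that] by (rule set_integral_le_tot) simp
  have Nb: "0 \<le> N s" "N s \<le> C + C * tot" if "s \<in> {lo..hi}" for s
    using that sub C_nonneg tot_nonneg by (auto intro!: N_nonneg N_le a_priori_everywhere)
  have "\<exists>k. N t \<le> N T * exp k \<and> k \<le> tot"
  proof (cases "t \<le> T")
    case True
    then have lh: "lo = t" "hi = T" by (auto simp: lo_def hi_def)
    have "N t \<le> N T * exp (- A t - - A T)"
    proof (rule gronwall_interval[where C = "C + C * tot" and E = "\<lambda>s. - A s"])
      show "N r \<le> N s + K * (- A r - - A s)"
        if rs: "t \<le> r" "r \<le> s" "s \<le> T" "0 \<le> K" and K: "\<And>u. u \<in> {r..s} \<Longrightarrow> N u \<le> K" for r s K
        using N_step[of r s K] rs K sub A_diff[of r s]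
          by (auto simp: lh min_absorb2 max_absorb1 subset_iff)
    qed (use True A_cont A_mono Nb in \<open>auto simp: lh intro!: continuous_intros\<close>)
    then show ?thesis using A_tot[of t T] True by (intro exI[of _ "- A t - - A T"]) (simp add: lh)
  next
    case False
    then have lh: "lo = T" "hi = t" by (auto simp: lo_def hi_def)
    \<comment> \<open>\<open>gronwall_interval\<close> bounds an earlier time by a later one, so
      time is reversed here.\<close>
    have "(\<lambda>s. N (- s)) (- t) \<le> (\<lambda>s. N (- s)) (- T) * exp (A (- (- t)) - A (- (- T)))"
    proof (rule gronwall_interval[where C = "C + C * tot" and E = "\<lambda>s. A (- s)"])
      show "continuous_on {- t..- T} (\<lambda>s. A (- s))"
        by (rule continuous_on_compose2[OF A_cont]) (auto simp: lh intro!: continuous_intros)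
      show "N (- r) \<le> N (- s) + K * (A (- r) - A (- s))"
        if rs: "- t \<le> r" "r \<le> s" "s \<le> - T" "0 \<le> K" and K: "\<And>u. u \<in> {r..s} \<Longrightarrow> N (- u) \<le> K" for r s K
      proof -
        have "N u \<le> K" if "u \<in> {- s..- r}" for u using K[of "- u"] that by auto
        then show ?thesis using N_step[of "- r" "- s" K] rs sub A_diff[of "- s" "- r"]
          by (auto simp: lh min_absorb1 max_absorb2 subset_iff)
      qed
    qed (use False A_mono Nb in \<open>auto simp: lh\<close>)
    then show ?thesis using A_tot[of T t] False by (intro exI[of _ "A t - A T"]) (simp add: lh)
  qed
  then obtain k where k: "N t \<le> N T * exp k" "k \<le> tot" by blast
  have "N T * exp k \<le> N T * exp tot" using k N_nonneg[OF T] by (intro mult_left_mono) auto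
  then show ?thesis using k by linarith
qed

text \<open>\<open>\<sigma>\<close> is 1 for the future and -1 for the past. Two limits are nested:
  at fixed \<open>j\<close>, the index \<open>k\<close> tends to infinity in the pointwise estimate
  between the two times, which bounds \<open>N\<close> at the time of index \<open>j\<close>; then
  the index tends to infinity in the Gronwall bound from that time to \<open>t\<close>.\<close>

lemma stability:
  fixes \<sigma> :: real and r :: "nat \<Rightarrow> real"
  assumes \<sigma>: "\<bar>\<sigma>\<bar> = 1" and r: "filterlim r at_top sequentially" and T: "\<And>k. \<sigma> * r k \<in> I"
    and lim: "AE (v, x) in lborel. (\<lambda>k. d v (x + (\<sigma> * r k) *\<^sub>R v) (\<sigma> * r k)) \<longlonglongrightarrow> g v x"
    and L: "0 \<le> L" and gL: "AE (v, x) in lborel. \<bar>g v x\<bar> \<le> L * W0 v x"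
    and t: "t \<in> I"
  shows "AE (v, x) in lborel. \<bar>d v x t\<bar> \<le> L * exp tot * W v x t"
proof -
  define C' where "C' = C + C * tot"
  have C': "0 \<le> C'" using C_nonneg tot_nonneg by (simp add: C'_def)
  define tail where "tail R = (LINT s:{s. R \<le> \<bar>s\<bar>}|lborel. \<alpha> s)" for R
  have tail: "(\<lambda>k. tail (r k)) \<longlonglongrightarrow> (LINT s|(lborel :: real measure). 0)"
    unfolding tail_def set_lebesgue_integral_def
  proof (rule integral_dominated_convergence[where w = \<alpha>])
    show "AE s in lborel. (\<lambda>k. indicat_real {s. r k \<le> \<bar>s\<bar>} s *\<^sub>R \<alpha> s) \<longlonglongrightarrow> 0"
    proof (rule AE_I2)
      fix s
      have "eventually (\<lambda>k. \<bar>s\<bar> < r k) sequentially" using r by (simp add: filterlim_at_top_dense)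
      then have "eventually (\<lambda>k. indicat_real {s. r k \<le> \<bar>s\<bar>} s *\<^sub>R \<alpha> s = 0) sequentially"
        by eventually_elim simp
      then show "(\<lambda>k. indicat_real {s. r k \<le> \<bar>s\<bar>} s *\<^sub>R \<alpha> s) \<longlonglongrightarrow> 0" by (rule tendsto_eventually)
    qed
  qed (auto simp: \<alpha>_integrable \<alpha>_nonneg indicator_def)
  have tail_bound: "N (\<sigma> * r j) \<le> L + C' * tail (r j)" if rj: "0 \<le> r j" for j
  proof -
    let ?T = "\<lambda>k. \<sigma> * r k"
    \<comment> \<open>One null set of characteristics must serve all \<open>k\<close>, since
      \<open>k\<close> tends to infinity at a fixed \<open>(v, x)\<close>.\<close>
    have "AE p in lborel. \<forall>k. case p of (v, x) \<Rightarrow> \<bar>d v (x + ?T j *\<^sub>R v) (?T j)\<bar>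
       \<le> \<bar>d v (x + ?T k *\<^sub>R v) (?T k)\<bar> + C' * W0 v x * (LINT s:{min (?T k) (?T j)..max (?T k) (?T j)}|lborel. \<alpha> s)"
      unfolding AE_all_countable
    proof
      fix k
      have "AE s in lborel. s \<in> {min (?T k) (?T j)..max (?T k) (?T j)} \<longrightarrow> (AE (v, x) in lborel. \<bar>d v x s\<bar> \<le> C' * W v x s)"
      proof (rule AE_I2, rule impI)
        fix s assume "s \<in> {min (?T k) (?T j)..max (?T k) (?T j)}"
        then have "s \<in> I" using I_between[OF T T] by blast
        then show "AE (v, x) in lborel. \<bar>d v x s\<bar> \<le> C' * W v x s"
          using a_priori_everywhere[of s] by (simp add: bounded_by_def C'_def)
      qed
      from estimate[OF T T C' this]
      show "AE p in lborel. case p of (v, x) \<Rightarrow> \<bar>d v (x + ?T j *\<^sub>R v) (?T j)\<bar>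
         \<le> \<bar>d v (x + ?T k *\<^sub>R v) (?T k)\<bar> + C' * W0 v x * (LINT s:{min (?T k) (?T j)..max (?T k) (?T j)}|lborel. \<alpha> s)" .
    qed
    with lim gL have "AE (v, x) in lborel. \<bar>d v (x + ?T j *\<^sub>R v) (?T j)\<bar> \<le> (L + C' * tail (r j)) * W0 v x"
    proof eventually_elim
      case (elim p)
      obtain v x where p: "p = (v, x)" by (cases p)
      have "eventually (\<lambda>k. \<bar>d v (x + ?T j *\<^sub>R v) (?T j)\<bar> \<le> \<bar>d v (x + ?T k *\<^sub>R v) (?T k)\<bar> + C' * W0 v x * tail (r j)) sequentially"
      proof -
        have "eventually (\<lambda>k. r j \<le> r k) sequentially" using r by (simp add: filterlim_at_top)
        then show ?thesis
        proof (rule eventually_mono)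
          fix k assume le: "r j \<le> r k"
          let ?J = "{min (?T k) (?T j)..max (?T k) (?T j)}"
          \<comment> \<open>Both endpoints lie on the same side of zero, at distances
            \<open>r k\<close> and \<open>r j\<close> from it, so no time between them is closer to
            zero than \<open>r j\<close>.\<close>
          have sub: "?J \<subseteq> {s. r j \<le> \<bar>s\<bar>}"
          proof -
            have "\<sigma> = 1 \<or> \<sigma> = -1" using \<sigma> by linarith
            then show ?thesis using le rj by auto
          qed
          have "(LINT s:?J|lborel. \<alpha> s) \<le> tail (r j)"
            unfolding tail_def by (rule set_integral_mono_\<alpha>[OF _ _ sub]) auto
          then have "C' * W0 v x * (LINT s:?J|lborel. \<alpha> s) \<le> C' * W0 v x * tail (r j)"
            using C' W0_nonneg by (intro mult_left_mono) auto
          moreover have "\<bar>d v (x + ?T j *\<^sub>R v) (?T j)\<bar> \<le> \<bar>d v (x + ?T k *\<^sub>R v) (?T k)\<bar> + C' * W0 v x * (LINT s:?J|lborel. \<alpha> s)"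
            using elim(3) by (simp add: p)
          ultimately show "\<bar>d v (x + ?T j *\<^sub>R v) (?T j)\<bar> \<le> \<bar>d v (x + ?T k *\<^sub>R v) (?T k)\<bar> + C' * W0 v x * tail (r j)"
            by linarith
        qed
      qed
      moreover have "(\<lambda>k. \<bar>d v (x + ?T k *\<^sub>R v) (?T k)\<bar> + C' * W0 v x * tail (r j)) \<longlonglongrightarrow> \<bar>g v x\<bar> + C' * W0 v x * tail (r j)"
        using elim(1) by (intro tendsto_intros) (simp add: p)
      ultimately have "\<bar>d v (x + ?T j *\<^sub>R v) (?T j)\<bar> \<le> \<bar>g v x\<bar> + C' * W0 v x * tail (r j)"
        by (intro tendsto_lowerbound) auto
      then show ?case using elim(2) by (simp add: p algebra_simps)
    qed
    then show ?thesis
      using L C' set_integral_nonneg_\<alpha> by (intro N_le) (auto simp: bounded_by_char tail_def)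
  qed
  have "N t \<le> L * exp tot"
  proof (rule tendsto_lowerbound)
    show "(\<lambda>k. (L + C' * tail (r k)) * exp tot) \<longlonglongrightarrow> L * exp tot"
      using tendsto_mult_right[OF tendsto_add[OF tendsto_const[of L] tendsto_mult_left[OF tail, of C']], of "exp tot"] by simp
    have "eventually (\<lambda>k. 0 \<le> r k) sequentially" using r by (simp add: filterlim_at_top)
    then show "eventually (\<lambda>k. N t \<le> (L + C' * tail (r k)) * exp tot) sequentially"
    proof eventually_elim
      case (elim k)
      have "N t \<le> N (\<sigma> * r k) * exp tot" by (rule N_exp_bound[OF t T])
      also have "\<dots> \<le> (L + C' * tail (r k)) * exp tot" by (intro mult_right_mono tail_bound elim) simp
      finally show ?case .
    qed
  qed simp
  then have "bounded_by (L * exp tot) t" by (rule bounded_by_mono[OF bounded_by_N[OF t]])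
  then show ?thesis by (simp add: bounded_by_def)
qed

end

section \<open>Slice measurability, subtraction of Duhamel formulas and convergence in L1\<close>

lemma AE_lborel_swap:
  fixes P :: "'a::euclidean_space \<Rightarrow> 'b::euclidean_space \<Rightarrow> bool"
  assumes "AE (v, x) in lborel. P v x"
  shows "AE x in lborel. AE v in lborel. P v x"
proof -
  obtain N where N: "N \<in> sets borel" "AE p in lborel. p \<notin> N" "\<And>p. p \<notin> N \<Longrightarrow> case p of (v, x) \<Rightarrow> P v x"
    using AE_lborel_borel_null[OF assms] by blast
  have "AE v in lborel. AE x in lborel. (v, x) \<notin> N" by (rule AE_lborel_pair) (rule N(2))
  then have "AE x in lborel. AE v in lborel. (v, x) \<notin> N"
    by (subst AE_lborel_commute[symmetric]) (use N(1) in simp_all)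
  then show ?thesis by eventually_elim (auto elim!: eventually_mono dest: N(3))
qed

text \<open>The collision estimates hold for almost every \<open>x\<close> and then almost every
  \<open>v\<close>. Passing from this iterated form to almost every pair needs measurability, which
  the representative \<open>g\<close> provides.\<close>

lemma AE_lborel_swap_le:
  fixes e U :: "'a::euclidean_space \<Rightarrow> 'b::euclidean_space \<Rightarrow> real"
  assumes g: "g \<in> borel_measurable borel" "AE (v, x) in lborel. e v x = g (v, x)"
    and U: "(\<lambda>(v, x). U v x) \<in> borel_measurable borel"
    and le: "AE x in lborel. AE v in lborel. \<bar>e v x\<bar> \<le> U v x"
  shows "AE (v, x) in lborel. \<bar>e v x\<bar> \<le> U v x"
proof -
  note [measurable] = g(1)
  have [measurable]: "(\<lambda>p. U (fst p) (snd p)) \<in> borel_measurable borel" using U by (simp add: case_prod_unfold)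
  have m: "Measurable.pred borel (\<lambda>p. \<bar>g (fst p, snd p)\<bar> \<le> U (fst p) (snd p))" by simp
  have "AE x in lborel. AE v in lborel. e v x = g (v, x)" by (rule AE_lborel_swap) (rule g(2))
  with le have "AE x in lborel. AE v in lborel. \<bar>g (v, x)\<bar> \<le> U v x"
  proof eventually_elim
    case (elim x)
    then show ?case by eventually_elim simp
  qed
  then have "AE v in lborel. AE x in lborel. \<bar>g (v, x)\<bar> \<le> U v x"
    by (subst AE_lborel_commute) (use m in simp_all)
  then have "AE p in lborel. \<bar>g p\<bar> \<le> U (fst p) (snd p)"
    by (subst AE_lborel_pair_iff) (use m in simp_all)
  with g(2) show ?thesis by eventually_elim auto
qed

text \<open>Local integrability in phase space and time says nothing about one fixed time. Duhamel's
  formula from a time \<open>T\<close> with a good slice expresses the slice at \<open>t\<close>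
  almost everywhere by a Borel function.\<close>

lemma duhamel_slice_measurable:
  fixes d e :: "'a::euclidean_space \<Rightarrow> 'a \<Rightarrow> real \<Rightarrow> real"
  assumes du: "duhamel I d e" and I: "open I" "t \<in> I"
    and between: "\<And>s t. s \<in> I \<Longrightarrow> t \<in> I \<Longrightarrow> {min s t..max s t} \<subseteq> I"
  shows "(\<lambda>(v, x). d v x t) \<in> borel_measurable lebesgue"
proof -
  obtain f g where f[measurable]: "f \<in> borel_measurable borel" and df: "AE (v, x, s) in lborel. s \<in> I \<longrightarrow> d v x s = f (v, x, s)"
    and g[measurable]: "g \<in> borel_measurable borel" and eg: "AE (v, x, s) in lborel. s \<in> I \<longrightarrow> e v x s = g (v, x, s)"
    using du by (auto simp: duhamel_def borel_on_def)
  have "AE s in lborel. s \<in> I \<longrightarrow> (AE (v, x) in lborel. d v x s = f (v, x, s))"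
    using AE_time_slices[OF df] by eventually_elim auto
  from open_AE_witness[OF I this] obtain T where T: "T \<in> I" "AE (v, x) in lborel. d v x T = f (v, x, T)" .
  have [measurable]: "f \<in> borel \<Otimes>\<^sub>M borel \<Otimes>\<^sub>M borel \<rightarrow>\<^sub>M borel" "g \<in> borel \<Otimes>\<^sub>M borel \<Otimes>\<^sub>M borel \<rightarrow>\<^sub>M borel"
    using f g by (simp_all add: borel_prod)
  \<comment> \<open>Duhamel's formula is rewritten at the point reached at time \<open>t\<close>, so
    positions at time \<open>s\<close> are traced back by \<open>t - s\<close> along the
    velocity.\<close>
  define h where "h p = f (fst p, snd p - (t - T) *\<^sub>R fst p, T) + (LINT s=T..t|lborel. g (fst p, snd p - (t - s) *\<^sub>R fst p, s))" for p :: "'a \<times> 'a"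
  have [measurable]: "h \<in> borel_measurable borel"
    unfolding h_def[abs_def] interval_lebesgue_integral_def set_lebesgue_integral_def
    by (simp add: borel_prod[symmetric])
  have J: "{min T t..max T t} \<subseteq> I" by (rule between[OF T(1) I(2)])
  have "AE (v, x) in lborel. d v (x + t *\<^sub>R v) t = d v (x + T *\<^sub>R v) T + (LINT s=T..t|lebesgue. e v (x + s *\<^sub>R v) s)"
    using du T(1) I(2) by (auto simp: duhamel_def)
  moreover have "AE (v, x) in lborel. AE s in lborel. s \<in> I \<longrightarrow> e v (x + s *\<^sub>R v) s = g (v, x + s *\<^sub>R v, s)"
    by (rule AE_characteristics) (rule eg)
  moreover have "AE (v, x) in lborel. d v (x + T *\<^sub>R v) T = f (v, x + T *\<^sub>R v, T)" by (rule AE_transport) (rule T(2))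
  ultimately have "AE (v, x) in lborel. d v (x + t *\<^sub>R v) t = h (v, x + t *\<^sub>R v)"
  proof eventually_elim
    case (elim p)
    obtain v x where p: "p = (v, x)" by (cases p)
    have set_eq: "(LINT s:A|lebesgue. e v (x + s *\<^sub>R v) s) = (LINT s:A|lborel. g (v, x + s *\<^sub>R v, s))"
      if A: "A \<subseteq> {min T t..max T t}" "A \<in> sets borel" for A
    proof -
      note [measurable] = A(2)
      have m: "(\<lambda>s. indicator A s *\<^sub>R g (v, x + s *\<^sub>R v, s)) \<in> borel_measurable borel" by measurable
      have ae: "AE s in lebesgue. indicator A s *\<^sub>R g (v, x + s *\<^sub>R v, s) = indicator A s *\<^sub>R e v (x + s *\<^sub>R v) s"
        using elim(2) unfolding p AE_completion_iff case_prod_conv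
        by eventually_elim (use A J in \<open>auto simp: indicator_def\<close>)
      have m': "(\<lambda>s. indicator A s *\<^sub>R e v (x + s *\<^sub>R v) s) \<in> borel_measurable lebesgue"
        by (rule borel_measurable_AE[OF _ ae]) (use m in \<open>simp add: measurable_completion\<close>)
      have "(LINT s:A|lebesgue. e v (x + s *\<^sub>R v) s) = (LINT s|lebesgue. indicator A s *\<^sub>R g (v, x + s *\<^sub>R v, s))"
        unfolding set_lebesgue_integral_def
        by (rule integral_cong_AE[OF m']) (use m ae in \<open>auto simp: measurable_completion elim!: eventually_mono\<close>)
      also have "\<dots> = (LINT s:A|lborel. g (v, x + s *\<^sub>R v, s))"
        unfolding set_lebesgue_integral_def by (rule integral_completion) (use m in simp)
      finally show ?thesis .
    qed
    have "(LINT s=T..t|lebesgue. e v (x + s *\<^sub>R v) s) = (LINT s=T..t|lborel. g (v, x + s *\<^sub>R v, s))"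
      unfolding interval_lebesgue_integral_def by (auto intro!: set_eq)
    moreover have "h (v, x + t *\<^sub>R v) = f (v, x + T *\<^sub>R v, T) + (LINT s=T..t|lborel. g (v, x + s *\<^sub>R v, s))"
      by (simp add: h_def algebra_simps)
    ultimately show ?case using elim(1,3) by (simp add: p)
  qed
  then have "AE (v, x) in lborel. d v x t = h (v, x)" by (subst (asm) AE_transport_iff)
  then have "AE p in lebesgue. h p = (case p of (v, x) \<Rightarrow> d v x t)"
    unfolding AE_completion_iff by eventually_elim auto
  then show ?thesis
    by (rule borel_measurable_AE[rotated]) (simp add: measurable_completion)
qed

text \<open>Needed for subtracting two Duhamel formulas: an integral that does not exist would
  silently count as \<open>0\<close>, and linearity would fail.\<close>

lemma duhamel_integrable:
  fixes d e :: "'a::euclidean_space \<Rightarrow> 'a \<Rightarrow> real \<Rightarrow> real"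
  assumes du: "duhamel I d e"
    and between: "\<And>s t. s \<in> I \<Longrightarrow> t \<in> I \<Longrightarrow> {min s t..max s t} \<subseteq> I"
    and \<alpha>: "integrable lborel \<alpha>" and bound: "AE s in lborel. s \<in> I \<longrightarrow> (AE (v, x) in lborel. \<bar>e v x s\<bar> \<le> \<alpha> s)"
    and T: "T \<in> I" and t: "t \<in> I"
  shows "AE (v, x) in lborel. interval_lebesgue_integrable lebesgue (ereal T) (ereal t) (\<lambda>s. e v (x + s *\<^sub>R v) s)"
proof -
  have J: "{min T t..max T t} \<subseteq> I" by (rule between[OF T t])
  obtain g where g: "g \<in> borel_measurable borel" and eg: "AE (v, x, s) in lborel. s \<in> I \<longrightarrow> e v x s = g (v, x, s)"
    using du by (auto simp: duhamel_def borel_on_def)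
  have [measurable]: "\<alpha> \<in> borel_measurable borel" using borel_measurable_integrable[OF \<alpha>] by simp
  have [measurable]: "g \<in> borel \<Otimes>\<^sub>M borel \<Otimes>\<^sub>M borel \<rightarrow>\<^sub>M borel" using g by (simp add: borel_prod)
  have "AE (v, x, s) in lborel. s \<in> {min T t..max T t} \<longrightarrow> \<bar>g (v, x, s)\<bar> \<le> \<alpha> s"
  proof (rule AE_of_time_slices)
    show "Measurable.pred borel (\<lambda>(v, x, s). s \<in> {min T t..max T t} \<longrightarrow> \<bar>g (v, x, s)\<bar> \<le> \<alpha> s)"
      unfolding case_prod_unfold borel_prod[symmetric] by measurable
    show "AE s in lborel. AE (v, x) in lborel. s \<in> {min T t..max T t} \<longrightarrow> \<bar>g (v, x, s)\<bar> \<le> \<alpha> s"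
      using bound AE_time_slices[OF eg]
    proof eventually_elim
      case (elim s)
      show ?case
      proof (cases "s \<in> {min T t..max T t}")
        case True
        then have sI: "s \<in> I" using J by auto
        have "AE (v, x) in lborel. \<bar>e v x s\<bar> \<le> \<alpha> s" using elim(1) sI by auto
        with elim(2) show ?thesis by eventually_elim (use sI in auto)
      next
        case False
        then show ?thesis by (intro AE_I2) auto
      qed
    qed
  qed
  then have "AE (v, x) in lborel. AE s in lborel. s \<in> {min T t..max T t} \<longrightarrow> \<bar>g (v, x + s *\<^sub>R v, s)\<bar> \<le> \<alpha> s"
    by (rule AE_characteristics)
  moreover have "AE (v, x) in lborel. AE s in lborel. s \<in> I \<longrightarrow> e v (x + s *\<^sub>R v) s = g (v, x + s *\<^sub>R v, s)"
    by (rule AE_characteristics) (rule eg)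
  ultimately show ?thesis
  proof eventually_elim
    case (elim p)
    obtain v x where p: "p = (v, x)" by (cases p)
    have "set_integrable lebesgue A (\<lambda>s. e v (x + s *\<^sub>R v) s)"
      if A: "A \<subseteq> {min T t..max T t}" "A \<in> sets borel" for A
      unfolding set_integrable_def
    proof (rule Bochner_Integration.integrable_bound)
      note [measurable] = A(2)
      have m: "(\<lambda>s. indicator A s *\<^sub>R g (v, x + s *\<^sub>R v, s)) \<in> borel_measurable borel" by measurable
      have ae: "AE s in lebesgue. indicator A s *\<^sub>R g (v, x + s *\<^sub>R v, s) = indicator A s *\<^sub>R e v (x + s *\<^sub>R v) s"
        using elim(2) unfolding p AE_completion_iff case_prod_conv
        by eventually_elim (use A J in \<open>auto simp: indicator_def\<close>)
      show "(\<lambda>s. indicator A s *\<^sub>R e v (x + s *\<^sub>R v) s) \<in> borel_measurable lebesgue"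
        by (rule borel_measurable_AE[OF _ ae]) (use m in \<open>simp add: measurable_completion\<close>)
      show "integrable lebesgue \<alpha>" using \<alpha> by (simp add: integrable_completion)
      show "AE s in lebesgue. norm (indicator A s *\<^sub>R e v (x + s *\<^sub>R v) s) \<le> norm (\<alpha> s)"
        using elim unfolding p AE_completion_iff case_prod_conv
        by eventually_elim (use A J in \<open>auto simp: indicator_def\<close>)
    qed
    from this[of "{T<..<t}"] this[of "{t<..<T}"] show ?case
      unfolding p case_prod_conv interval_lebesgue_integrable_def by (auto simp: subset_iff)
  qed
qed

lemma duhamel_diff:
  fixes d1 e1 d2 e2 :: "'a::euclidean_space \<Rightarrow> 'a \<Rightarrow> real \<Rightarrow> real"
  assumes du: "duhamel I d1 e1" "duhamel I d2 e2"
    and between: "\<And>s t. s \<in> I \<Longrightarrow> t \<in> I \<Longrightarrow> {min s t..max s t} \<subseteq> I"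
    and \<alpha>: "integrable lborel \<alpha>"
    and bound: "AE s in lborel. s \<in> I \<longrightarrow> (AE (v, x) in lborel. \<bar>e1 v x s\<bar> \<le> \<alpha> s)"
      "AE s in lborel. s \<in> I \<longrightarrow> (AE (v, x) in lborel. \<bar>e2 v x s\<bar> \<le> \<alpha> s)"
  shows "duhamel I (\<lambda>v x s. d1 v x s - d2 v x s) (\<lambda>v x s. e1 v x s - e2 v x s)"
proof -
  have sub: "\<exists>g. borel_on I (\<lambda>v x s. f1 v x s - f2 v x s) g"
    if ex: "\<exists>g. borel_on I f1 g" "\<exists>g. borel_on I f2 g" for f1 f2 :: "'a \<Rightarrow> 'a \<Rightarrow> real \<Rightarrow> real"
  proof -
    obtain g1 g2 where g: "borel_on I f1 g1" "borel_on I f2 g2" using ex by blast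
    have "AE (v, x, t) in lborel. t \<in> I \<longrightarrow> f1 v x t = g1 (v, x, t)" "AE (v, x, t) in lborel. t \<in> I \<longrightarrow> f2 v x t = g2 (v, x, t)"
      using g by (auto simp: borel_on_def)
    then have "AE (v, x, t) in lborel. t \<in> I \<longrightarrow> f1 v x t - f2 v x t = g1 (v, x, t) - g2 (v, x, t)"
      by eventually_elim auto
    then show ?thesis using g by (intro exI[of _ "\<lambda>p. g1 p - g2 p"]) (auto simp: borel_on_def)
  qed
  have main: "AE (v, x) in lborel. d1 v (x + t *\<^sub>R v) t - d2 v (x + t *\<^sub>R v) t =
     d1 v (x + T *\<^sub>R v) T - d2 v (x + T *\<^sub>R v) T
     + (LINT s=T..t|lebesgue. (e1 v (x + s *\<^sub>R v) s - e2 v (x + s *\<^sub>R v) s))" if T: "T \<in> I" and t: "t \<in> I" for T t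
  proof -
    have d: "AE (v, x) in lborel. d1 v (x + t *\<^sub>R v) t = d1 v (x + T *\<^sub>R v) T + (LINT s=T..t|lebesgue. e1 v (x + s *\<^sub>R v) s)"
      "AE (v, x) in lborel. d2 v (x + t *\<^sub>R v) t = d2 v (x + T *\<^sub>R v) T + (LINT s=T..t|lebesgue. e2 v (x + s *\<^sub>R v) s)"
      using du T t by (auto simp: duhamel_def)
    have i: "AE (v, x) in lborel. interval_lebesgue_integrable lebesgue (ereal T) (ereal t) (\<lambda>s. e1 v (x + s *\<^sub>R v) s)"
      "AE (v, x) in lborel. interval_lebesgue_integrable lebesgue (ereal T) (ereal t) (\<lambda>s. e2 v (x + s *\<^sub>R v) s)"
      by (rule duhamel_integrable[OF du(1) _ \<alpha> bound(1) T t] duhamel_integrable[OF du(2) _ \<alpha> bound(2) T t], rule between, assumption+)+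
    show ?thesis
      using d i
      by eventually_elim (auto simp: interval_lebesgue_integral_diff)
  qed
  show ?thesis using du sub main unfolding duhamel_def by blast
qed

lemma mild_solution_duhamel:
  assumes "open I" "mild_solution b I F"
  shows "duhamel I F (\<lambda>v x t. collision b F v x t)"
  unfolding duhamel_def
proof (intro conjI ballI)
  have F: "L1_loc (UNIV \<times> UNIV \<times> I) (\<lambda>(v, x, t). F v x t)"
    and c: "L1_loc (UNIV \<times> UNIV \<times> I) (\<lambda>(v, x, t). collision b F v x t)"
    using assms(2) by (simp_all add: mild_solution_def)
  show "\<exists>g. borel_on I F g" by (rule L1_loc_borel_on[OF assms(1) F]) (rule exI)
  show "\<exists>g. borel_on I (\<lambda>v x t. collision b F v x t) g" by (rule L1_loc_borel_on[OF assms(1) c]) (rule exI)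
  fix t1 t2 assume "t1 \<in> I" "t2 \<in> I"
  then have "AE (v, x) in lebesgue. transport t2 (\<lambda>v x. F v x t2) v x = transport t1 (\<lambda>v x. F v x t1) v x +
        (LINT s=t1..t2|lebesgue. transport s (\<lambda>v x. collision b F v x s) v x)"
    using assms(2) by (auto simp: mild_solution_def)
  then show "AE (v, x) in lborel. F v (x + t2 *\<^sub>R v) t2 = F v (x + t1 *\<^sub>R v) t1 +
        (LINT s=t1..t2|lebesgue. collision b F v (x + s *\<^sub>R v) s)"
    by (simp only: AE_completion_iff transport_def)
qed

text \<open>For each \<open>v\<close> the shear is a translation in \<open>x\<close>, so Tonelli
  shows that it preserves the integral. Errors measured by \<open>L1_norm\<close> can therefore be
  read along characteristics.\<close>

lemma measurable_transport:
  fixes f :: "'a::euclidean_space \<times> 'a \<Rightarrow> real"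
  assumes f: "f \<in> borel_measurable lebesgue"
  shows "(\<lambda>(v, x). f (v, x + t *\<^sub>R v)) \<in> borel_measurable lebesgue"
    and "(\<integral>\<^sup>+(v, x). ennreal \<bar>f (v, x + t *\<^sub>R v)\<bar> \<partial>lebesgue) = (\<integral>\<^sup>+p. ennreal \<bar>f p\<bar> \<partial>lebesgue)"
proof -
  obtain g where g: "g \<in> borel_measurable lborel" "AE p in lborel. f p = g p"
    using completion_ex_borel_measurable_real[OF f] by blast
  have gm[measurable]: "g \<in> borel \<Otimes>\<^sub>M borel \<rightarrow>\<^sub>M borel" using g(1) by (simp add: borel_prod)
  have hm: "(\<lambda>(v, x). g (v, x + t *\<^sub>R v)) \<in> borel_measurable borel"
    unfolding case_prod_unfold borel_prod[symmetric] by measurable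
  have "AE (v, x) in lborel. f (v, x) = g (v, x)" using g(2) by eventually_elim auto
  then have ae: "AE (v, x) in lborel. f (v, x + t *\<^sub>R v) = g (v, x + t *\<^sub>R v)" by (rule AE_transport)
  then have ae': "AE p in lebesgue. (case p of (v, x) \<Rightarrow> g (v, x + t *\<^sub>R v)) = (case p of (v, x) \<Rightarrow> f (v, x + t *\<^sub>R v))"
    unfolding AE_completion_iff by eventually_elim auto
  show "(\<lambda>(v, x). f (v, x + t *\<^sub>R v)) \<in> borel_measurable lebesgue"
    by (rule borel_measurable_AE[OF _ ae']) (use hm in \<open>simp add: measurable_completion\<close>)
  have "(\<integral>\<^sup>+(v, x). ennreal \<bar>f (v, x + t *\<^sub>R v)\<bar> \<partial>lebesgue) = (\<integral>\<^sup>+(v, x). ennreal \<bar>g (v, x + t *\<^sub>R v)\<bar> \<partial>lborel)"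
    unfolding nn_integral_completion by (rule nn_integral_cong_AE) (use ae in \<open>eventually_elim, auto\<close>)
  also have "\<dots> = (\<integral>\<^sup>+v. \<integral>\<^sup>+x. ennreal \<bar>g (v, x + t *\<^sub>R v)\<bar> \<partial>lborel \<partial>lborel)"
    unfolding lborel_prod[symmetric] by (subst lborel.nn_integral_fst[symmetric]) (auto simp: case_prod_unfold)
  also have "\<dots> = (\<integral>\<^sup>+v. \<integral>\<^sup>+x. ennreal \<bar>g (v, x)\<bar> \<partial>lborel \<partial>lborel)"
  proof (rule nn_integral_cong)
    fix v :: 'a
    show "(\<integral>\<^sup>+x. ennreal \<bar>g (v, x + t *\<^sub>R v)\<bar> \<partial>lborel) = (\<integral>\<^sup>+x. ennreal \<bar>g (v, x)\<bar> \<partial>lborel)"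
      by (subst nn_integral_lborel_affine[of "\<lambda>x. ennreal \<bar>g (v, x)\<bar>" 1 "t *\<^sub>R v"]) (auto simp: add.commute)
  qed
  also have "\<dots> = (\<integral>\<^sup>+p. ennreal \<bar>g p\<bar> \<partial>lborel)"
    unfolding lborel_prod[symmetric] by (subst lborel.nn_integral_fst) auto
  also have "\<dots> = (\<integral>\<^sup>+p. ennreal \<bar>f p\<bar> \<partial>lebesgue)"
    unfolding nn_integral_completion by (rule nn_integral_cong_AE) (use g(2) in \<open>eventually_elim, auto\<close>)
  finally show "(\<integral>\<^sup>+(v, x). ennreal \<bar>f (v, x + t *\<^sub>R v)\<bar> \<partial>lebesgue) = (\<integral>\<^sup>+p. ennreal \<bar>f p\<bar> \<partial>lebesgue)" .
qed

text \<open>Finitely many of the L1 norms may be infinite, so the sequence is shifted by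
  \<open>k0\<close> before the subsequence theorem for integrable functions is applied.\<close>

lemma L1_null_sequence_subseq:
  fixes u :: "nat \<Rightarrow> 'a \<Rightarrow> real"
  assumes m: "\<And>k. u k \<in> borel_measurable M"
    and lim: "(\<lambda>k. \<integral>\<^sup>+p. ennreal \<bar>u k p\<bar> \<partial>M) \<longlonglongrightarrow> 0"
  obtains r :: "nat \<Rightarrow> nat" where "strict_mono r" "AE p in M. (\<lambda>k. u (r k) p) \<longlonglongrightarrow> 0"
proof -
  have "eventually (\<lambda>k. (\<integral>\<^sup>+p. ennreal \<bar>u k p\<bar> \<partial>M) < 1) sequentially"
    using lim by (rule order_tendstoD) simp
  then obtain k0 where k0: "\<And>k. k0 \<le> k \<Longrightarrow> (\<integral>\<^sup>+p. ennreal \<bar>u k p\<bar> \<partial>M) < 1"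
    by (auto simp: eventually_sequentially)
  define w where "w k = u (k + k0)" for k
  have int: "integrable M (w k)" for k
  proof (rule integrableI_bounded)
    show "w k \<in> borel_measurable M" by (simp add: w_def m)
    show "(\<integral>\<^sup>+p. ennreal (norm (w k p)) \<partial>M) < \<infinity>"
      using k0[of "k + k0"] by (simp add: w_def less_trans[OF _ ennreal_one_less_top])
  qed
  have "(\<lambda>k. ennreal (LINT p|M. norm (w k p))) \<longlonglongrightarrow> ennreal 0"
    using LIMSEQ_ignore_initial_segment[OF lim, of k0] int
    by (simp add: nn_integral_eq_integral[symmetric] w_def)
  then have "(\<lambda>k. LINT p|M. norm (w k p)) \<longlonglongrightarrow> 0"
    by (subst (asm) tendsto_ennreal_iff) (auto intro!: always_eventually)
  from tendsto_L1_AE_subseq[OF int this] obtain r where r: "strict_mono r" "AE p in M. (\<lambda>n. w (r n) p) \<longlonglongrightarrow> 0" by blast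
  show thesis
  proof (rule that[of "\<lambda>k. r k + k0"])
    show "strict_mono (\<lambda>k. r k + k0)" using r(1) by (simp add: strict_mono_def)
    show "AE p in M. (\<lambda>k. u (r k + k0) p) \<longlonglongrightarrow> 0" using r(2) by (simp add: w_def)
  qed
qed

section \<open>Collision estimates\<close>

context kinetic
begin

lemma kernel_nonneg:
  assumes "norm \<omega> = 1" "v \<noteq> w"
  shows "0 \<le> ker (v - w) \<omega>"
proof -
  have n: "norm ((v - w) /\<^sub>R norm (v - w)) = 1" using assms by simp
  have "0 \<le> bh (\<omega> \<bullet> ((v - w) /\<^sub>R norm (v - w)))"
    using angular_factor_nonneg[OF kernel n] assms by (simp add: space_surface_measure)
  then show ?thesis using kernel assms by (simp add: separated_kernel_def)
qed

text \<open>A collision takes place at one position, so \<open>x\<close> is fixed first and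
  \<open>AE_collision_velocities\<close> is used within its velocity slice. \<open>H\<close> is
  general in order to cover both a collision integrand and the difference of two.\<close>

lemma collision_slice_bound:
  fixes H :: "real ^ 'n \<Rightarrow> real ^ 'n \<Rightarrow> (real ^ 'n) \<times> (real ^ 'n) \<Rightarrow> real"
  assumes R: "AE (v, x) in lborel. R v x"
    and H: "\<And>v x w \<omega>. norm \<omega> = 1 \<Longrightarrow> v \<noteq> w \<Longrightarrow> R v x \<Longrightarrow> R w x \<Longrightarrow> R (post_v v w \<omega>) x \<Longrightarrow> R (post_vs v w \<omega>) x \<Longrightarrow>
          \<bar>H v x (\<omega>, w)\<bar> \<le> A v x * f x w * ker (v - w) \<omega>"
    and f: "\<And>x. f x \<in> borel_measurable borel" "\<And>x w. 0 \<le> f x w" and A: "\<And>v x. 0 \<le> A v x"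
    and int: "\<And>v x. integrable lborel (\<lambda>w. f x w * norm (v - w) powr \<beta>)"
  shows "AE x in lborel. AE v in lborel. \<bar>integral\<^sup>L (completion (surface_measure \<Otimes>\<^sub>M lborel)) (H v x)\<bar>
           \<le> A v x * (mass * (LINT w|lebesgue. f x w * norm (v - w) powr \<beta>))"
  using AE_lborel_swap[OF R]
proof eventually_elim
  case (elim x)
  show ?case using elim AE_collision_velocities[OF elim]
  proof eventually_elim
    case (elim v)
    have "AE q in surface_measure \<Otimes>\<^sub>M lborel. snd q \<noteq> v"
    proof (rule surface_lborel.AE_pair_measure)
      show "AE \<omega> in surface_measure. AE w in lborel. snd (\<omega>, w) \<noteq> v" by (rule AE_I2) (simp add: AE_lborel_singleton)
      show "{q \<in> space (surface_measure \<Otimes>\<^sub>M lborel). snd q \<noteq> v} \<in> sets (surface_measure \<Otimes>\<^sub>M lborel)"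
        by measurable
    qed
    moreover have "AE q in surface_measure \<Otimes>\<^sub>M lborel. norm (fst q) = 1"
      by (rule AE_I2) (auto simp: space_pair_measure space_surface_measure)
    ultimately have "AE (\<omega>, w) in surface_measure \<Otimes>\<^sub>M lborel. \<bar>H v x (\<omega>, w)\<bar> \<le> A v x * f x w * ker (v - w) \<omega>"
      using elim(2) by eventually_elim (use elim(1) H in auto)
    then show ?case unfolding mass_def
      by (rule collision_integral_bound[OF kernel f A int])
  qed
qed

lemma AE_integrand_integrable:
  assumes "mild_solution ker I F"
  shows "AE t in lborel. t \<in> I \<longrightarrow> (AE x in lborel. AE v in lborel.
     integrable (completion (surface_measure \<Otimes>\<^sub>M lborel)) (collision_integrand ker F v x t))"
proof -
  have "AE (v, x, t) in lborel. t \<in> I \<longrightarrow>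
        integrable (completion (surface_measure \<Otimes>\<^sub>M lborel)) (collision_integrand ker F v x t)"
    using assms by (simp add: mild_solution_def AE_completion_iff)
  from AE_time_slices[OF this] show ?thesis
  proof eventually_elim
    case (elim t)
    show ?case
    proof
      assume "t \<in> I"
      with elim have "AE (v, x) in lborel. integrable (completion (surface_measure \<Otimes>\<^sub>M lborel)) (collision_integrand ker F v x t)"
        by simp
      then show "AE x in lborel. AE v in lborel. integrable (completion (surface_measure \<Otimes>\<^sub>M lborel)) (collision_integrand ker F v x t)"
        by (rule AE_lborel_swap)
    qed
  qed
qed

lemma AE_Maxwellian_attenuation:
  assumes "AE x in lborel. AE v in lborel. \<bar>e v x\<bar> \<le> k * M v x t * (mass * (LINT w|lebesgue. M w x t * norm (v - w) powr \<beta>))"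
    and g: "g \<in> borel_measurable borel" "AE (v, x) in lborel. e v x = g (v, x)" and k: "0 \<le> k"
  shows "AE (v, x) in lborel. \<bar>e v x\<bar> \<le> k * M v x t * sup_att t"
proof (rule AE_lborel_swap_le[OF g])
  show "(\<lambda>(v, x). k * M v x t * sup_att t) \<in> borel_measurable borel"
    by (simp add: borel_prod[symmetric] case_prod_unfold)
  have "AE x in lborel. AE v in lborel. attenuation \<beta> bh M v x t \<le> sup_att t"
    by (rule AE_lborel_swap[OF AE_attenuation_le_sup])
  with assms(1) show "AE x in lborel. AE v in lborel. \<bar>e v x\<bar> \<le> k * M v x t * sup_att t"
  proof eventually_elim
    case (elim x)
    then show ?case
    proof eventually_elim
      case (elim v)
      have "k * M v x t * attenuation \<beta> bh M v x t \<le> k * M v x t * sup_att t"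
        using elim(2) k less_imp_le[OF M_pos] by (intro mult_left_mono) auto
      then show ?case using elim(1) by (simp add: attenuation_def mass_def)
    qed
  qed
qed

text \<open>The 2 counts gain and loss; each product is at most \<open>M v x t * M w x t\<close>,
  the gain by \<open>M_collision\<close>.\<close>

lemma collision_bound_Maxwellian:
  assumes F: "AE (v, x) in lborel. \<bar>F v x t\<bar> \<le> M v x t"
    and g: "g \<in> borel_measurable borel" "AE (v, x) in lborel. collision ker F v x t = g (v, x)"
  shows "AE (v, x) in lborel. \<bar>collision ker F v x t\<bar> \<le> 2 * M v x t * sup_att t"
proof (rule AE_Maxwellian_attenuation[OF _ g])
  obtain K where K: "\<And>v x t. integrable lborel (\<lambda>w. M w x t * norm (v - w) powr \<beta>)"
    using attenuation_bound by metis
  show "AE x in lborel. AE v in lborel. \<bar>collision ker F v x t\<bar>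
      \<le> 2 * M v x t * (mass * (LINT w|lebesgue. M w x t * norm (v - w) powr \<beta>))"
    unfolding collision_def
  proof (rule collision_slice_bound[OF F, where f = "\<lambda>x w. M w x t" and A = "\<lambda>v x. 2 * M v x t"])
    fix v x w \<omega> :: "real ^ 'n"
    assume *: "norm \<omega> = 1" "v \<noteq> w" "\<bar>F v x t\<bar> \<le> M v x t" "\<bar>F w x t\<bar> \<le> M w x t"
      "\<bar>F (post_v v w \<omega>) x t\<bar> \<le> M (post_v v w \<omega>) x t" "\<bar>F (post_vs v w \<omega>) x t\<bar> \<le> M (post_vs v w \<omega>) x t"
    have "\<bar>F (post_v v w \<omega>) x t * F (post_vs v w \<omega>) x t - F v x t * F w x t\<bar>
       \<le> \<bar>F (post_v v w \<omega>) x t\<bar> * \<bar>F (post_vs v w \<omega>) x t\<bar> + \<bar>F v x t\<bar> * \<bar>F w x t\<bar>"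
      by (metis abs_mult abs_triangle_ineq4)
    also have "\<dots> \<le> M (post_v v w \<omega>) x t * M (post_vs v w \<omega>) x t + M v x t * M w x t"
      using * by (intro add_mono mult_mono) (auto intro: order_trans[OF abs_ge_zero])
    also have "\<dots> = 2 * M v x t * M w x t" using M_collision[OF *(1)] by simp
    finally show "\<bar>collision_integrand ker F v x t (\<omega>, w)\<bar> \<le> 2 * M v x t * M w x t * ker (v - w) \<omega>"
      using kernel_nonneg[OF *(1,2)] by (simp add: collision_integrand_def abs_mult mult_right_mono)
  qed (use K in \<open>auto intro: less_imp_le[OF M_pos]\<close>)
qed simp

text \<open>In each of gain and loss, changing one factor of the product at a time costs
  \<open>2 * K\<close>; together this gives the 4.\<close>

lemma collision_diff_bound_Maxwellian:
  assumes F: "AE (v, x) in lborel. \<bar>F1 v x t\<bar> \<le> M v x t" "AE (v, x) in lborel. \<bar>F2 v x t\<bar> \<le> M v x t"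
    and d: "AE (v, x) in lborel. \<bar>F1 v x t - F2 v x t\<bar> \<le> K * M v x t" and K: "0 \<le> K"
    and g: "g \<in> borel_measurable borel" "AE (v, x) in lborel. collision ker F1 v x t - collision ker F2 v x t = g (v, x)"
    and int: "AE x in lborel. AE v in lborel. integrable (completion (surface_measure \<Otimes>\<^sub>M lborel)) (collision_integrand ker F1 v x t)"
      "AE x in lborel. AE v in lborel. integrable (completion (surface_measure \<Otimes>\<^sub>M lborel)) (collision_integrand ker F2 v x t)"
  shows "AE (v, x) in lborel. \<bar>collision ker F1 v x t - collision ker F2 v x t\<bar> \<le> 4 * K * M v x t * sup_att t"
proof (rule AE_Maxwellian_attenuation[OF _ g])
  obtain K' where K': "\<And>v x t. integrable lborel (\<lambda>w. M w x t * norm (v - w) powr \<beta>)"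
    using attenuation_bound by metis
  define H where "H v x p = collision_integrand ker F1 v x t p - collision_integrand ker F2 v x t p" for v x p
  have R: "AE (v, x) in lborel. \<bar>F1 v x t\<bar> \<le> M v x t \<and> \<bar>F2 v x t\<bar> \<le> M v x t \<and> \<bar>F1 v x t - F2 v x t\<bar> \<le> K * M v x t"
    using F d by eventually_elim auto
  have prod: "\<bar>p1 * q1 - p2 * q2\<bar> \<le> 2 * K * (mp * mq)"
    if "\<bar>q1\<bar> \<le> mq" "\<bar>p2\<bar> \<le> mp" "\<bar>p1 - p2\<bar> \<le> K * mp" "\<bar>q1 - q2\<bar> \<le> K * mq" for p1 q1 p2 q2 mp mq :: real
  proof -
    have "p1 * q1 - p2 * q2 = (p1 - p2) * q1 + p2 * (q1 - q2)" by (simp add: algebra_simps)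
    also have "\<bar>\<dots>\<bar> \<le> \<bar>p1 - p2\<bar> * \<bar>q1\<bar> + \<bar>p2\<bar> * \<bar>q1 - q2\<bar>" by (metis abs_mult abs_triangle_ineq)
    also have "\<dots> \<le> (K * mp) * mq + mp * (K * mq)"
      using that by (intro add_mono mult_mono) (auto intro: order_trans[OF abs_ge_zero])
    finally show ?thesis by (simp add: algebra_simps)
  qed
  have "AE x in lborel. AE v in lborel. \<bar>integral\<^sup>L (completion (surface_measure \<Otimes>\<^sub>M lborel)) (H v x)\<bar>
      \<le> 4 * K * M v x t * (mass * (LINT w|lebesgue. M w x t * norm (v - w) powr \<beta>))"
  proof (rule collision_slice_bound[OF R, where f = "\<lambda>x w. M w x t" and A = "\<lambda>v x. 4 * K * M v x t"])
    fix v x w \<omega> :: "real ^ 'n"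
    let ?v = "post_v v w \<omega>" and ?w = "post_vs v w \<omega>"
    let ?R = "\<lambda>v x. \<bar>F1 v x t\<bar> \<le> M v x t \<and> \<bar>F2 v x t\<bar> \<le> M v x t \<and> \<bar>F1 v x t - F2 v x t\<bar> \<le> K * M v x t"
    assume *: "norm \<omega> = 1" "v \<noteq> w" "?R v x" "?R w x" "?R ?v x" "?R ?w x"
    have "\<bar>F1 ?v x t * F1 ?w x t - F2 ?v x t * F2 ?w x t\<bar> \<le> 2 * K * (M ?v x t * M ?w x t)"
      using * by (intro prod) auto
    then have "\<bar>F1 ?v x t * F1 ?w x t - F2 ?v x t * F2 ?w x t\<bar> \<le> 2 * K * (M v x t * M w x t)"
      by (simp only: M_collision[OF *(1)])
    moreover have "\<bar>F1 v x t * F1 w x t - F2 v x t * F2 w x t\<bar> \<le> 2 * K * (M v x t * M w x t)"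
      using * by (intro prod) auto
    ultimately have "\<bar>(F1 ?v x t * F1 ?w x t - F1 v x t * F1 w x t) - (F2 ?v x t * F2 ?w x t - F2 v x t * F2 w x t)\<bar>
       \<le> 4 * K * M v x t * M w x t" (is "\<bar>?D\<bar> \<le> ?U") by linarith
    moreover have "H v x (\<omega>, w) = ?D * ker (v - w) \<omega>"
      by (simp add: H_def collision_integrand_def algebra_simps)
    ultimately show "\<bar>H v x (\<omega>, w)\<bar> \<le> 4 * K * M v x t * M w x t * ker (v - w) \<omega>"
      using kernel_nonneg[OF *(1,2)] by (simp add: abs_mult mult_right_mono)
  qed (use K K' in \<open>auto intro: less_imp_le[OF M_pos] intro!: mult_nonneg_nonneg\<close>)
  with int show "AE x in lborel. AE v in lborel. \<bar>collision ker F1 v x t - collision ker F2 v x t\<bar>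
      \<le> 4 * K * M v x t * (mass * (LINT w|lebesgue. M w x t * norm (v - w) powr \<beta>))"
  proof eventually_elim
    case (elim x)
    then show ?case
    proof eventually_elim
      \<comment> \<open>The difference of the two collision integrals is the integral of
        \<open>H\<close> because both integrands are integrable, which is part of being a mild
        solution.\<close>
      case (elim v)
      have "integral\<^sup>L (completion (surface_measure \<Otimes>\<^sub>M lborel)) (H v x) = collision ker F1 v x t - collision ker F2 v x t"
        using elim(1,2) unfolding H_def[abs_def] collision_def by (rule Bochner_Integration.integral_diff)
      then show ?case using elim(3) by simp
    qed
  qed
qed (use K in simp)

text \<open>A bound by \<open>K * K\<close> alone would not be integrable in \<open>w\<close>, and
  one by the Maxwellians alone would not be proportional to \<open>K\<close>; the geometric mean has
  both properties. \<open>\<alpha>\<close> depends neither on \<open>F\<close> nor on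
  \<open>K\<close>, so it can serve as the rate for weight 1.\<close>

lemma collision_bound_uniform:
  obtains \<alpha> where "integrable lborel \<alpha>" "\<And>t. 0 \<le> \<alpha> t"
    "\<And>F K t g. AE (v, x) in lborel. \<bar>F v x t\<bar> \<le> M v x t \<Longrightarrow> AE (v, x) in lborel. \<bar>F v x t\<bar> \<le> K \<Longrightarrow> 0 \<le> K \<Longrightarrow>
       g \<in> borel_measurable borel \<Longrightarrow> AE (v, x) in lborel. collision ker F v x t = g (v, x) \<Longrightarrow>
       AE (v, x) in lborel. \<bar>collision ker F v x t\<bar> \<le> K * \<alpha> t"
proof -
  obtain L where L: "0 \<le> L"
    "\<And>f h \<theta> u v. f \<in> borel_measurable borel \<Longrightarrow> 0 \<le> h \<Longrightarrow> 0 < \<theta> \<Longrightarrow> (\<And>w. 0 \<le> f w) \<Longrightarrow>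
       (\<And>w. f w \<le> h * exp (- \<theta> * (norm (w - u :: real ^ 'n))\<^sup>2 / 2)) \<Longrightarrow>
       integrable lborel (\<lambda>w. f w * norm (v - w) powr \<beta>) \<and>
       (LINT w|lebesgue. f w * norm (v - w) powr \<beta>) \<le> h * L * \<theta> powr (- decay)"
    using potential_bound by blast
  let ?h = "sqrt height"
  have h: "0 \<le> ?h" using height_pos by simp
  \<comment> \<open>The 2 counts gain and loss. One \<open>?h\<close> bounds
    \<open>sqrt (M v x t)\<close>; the other is the height of the Gaussian above
    \<open>sqrt (M w x t)\<close>, whose inverse variance is \<open>theta t / 2\<close>.\<close>
  define \<alpha> where "\<alpha> t = 2 * ?h * mass * (?h * L * (theta t / 2) powr (- decay))" for t
  have root: "integrable lborel (\<lambda>w. sqrt (M w x t) * norm (v - w) powr \<beta>) \<and>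
      (LINT w|lebesgue. sqrt (M w x t) * norm (v - w) powr \<beta>) \<le> ?h * L * (theta t / 2) powr (- decay)" for v x t
  proof (rule L(2)[where u = "v0 + drift (x - x0) t /\<^sub>R theta t"])
    fix w
    have "sqrt (M w x t) \<le> sqrt (height * exp (- theta t * (norm (w - (v0 + drift (x - x0) t /\<^sub>R theta t)))\<^sup>2 / 2))"
      by (rule real_sqrt_le_mono) (rule M_le_gaussian)
    also have "\<dots> = ?h * exp (- (theta t / 2) * (norm (w - (v0 + drift (x - x0) t /\<^sub>R theta t)))\<^sup>2 / 2)"
    proof -
      have "sqrt (exp y) = exp (y / 2)" for y :: real
        by (rule real_sqrt_unique) (auto simp: power2_eq_square exp_add[symmetric])
      then show ?thesis by (simp add: real_sqrt_mult)
    qed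
    finally show "sqrt (M w x t) \<le> ?h * exp (- (theta t / 2) * (norm (w - (v0 + drift (x - x0) t /\<^sub>R theta t)))\<^sup>2 / 2)" .
  qed (use h theta_pos in \<open>auto intro: less_imp_le[OF M_pos]\<close>)
  show thesis
  proof (rule that[of \<alpha>])
    have \<alpha>_eq: "\<alpha> = (\<lambda>t. 2 * ?h * mass * (?h * L * (1 / 2) powr (- decay)) * theta t powr (- decay))"
    proof
      fix t
      have "(theta t * (1 / 2)) powr (- decay) = theta t powr (- decay) * (1 / 2) powr (- decay)"
        by (rule powr_mult)
      then show "\<alpha> t = 2 * ?h * mass * (?h * L * (1 / 2) powr (- decay)) * theta t powr (- decay)"
        by (simp add: \<alpha>_def)
    qed
    show "integrable lborel \<alpha>"
      unfolding \<alpha>_eq by (intro integrable_mult_right theta_powr_integrable decay)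
    show "0 \<le> \<alpha> t" for t using h mass_nonneg L(1) by (simp add: \<alpha>_def)
    fix F :: "real ^ 'n \<Rightarrow> real ^ 'n \<Rightarrow> real \<Rightarrow> real" and K t :: real and g :: "(real ^ 'n) \<times> (real ^ 'n) \<Rightarrow> real"
    assume F: "AE (v, x) in lborel. \<bar>F v x t\<bar> \<le> M v x t" "AE (v, x) in lborel. \<bar>F v x t\<bar> \<le> K" and K: "0 \<le> K"
      and g: "g \<in> borel_measurable borel" "AE (v, x) in lborel. collision ker F v x t = g (v, x)"
    have R: "AE (v, x) in lborel. \<bar>F v x t\<bar> \<le> M v x t \<and> \<bar>F v x t\<bar> \<le> K" using F by eventually_elim auto
    have geo: "\<bar>p * q\<bar> \<le> K * ?h * sqrt (M w x t)"
      if "\<bar>p\<bar> \<le> K" "\<bar>q\<bar> \<le> K" "\<bar>p\<bar> \<le> mp" "\<bar>q\<bar> \<le> mq" "mp * mq = M v x t * M w x t" for p q mp mq v w x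
    proof (rule power2_le_imp_le)
      have "\<bar>p * q\<bar> \<le> K * K" unfolding abs_mult using that K by (intro mult_mono) auto
      moreover have "\<bar>p * q\<bar> \<le> M v x t * M w x t" unfolding abs_mult that(5)[symmetric]
        using that by (intro mult_mono) (auto intro: order_trans[OF abs_ge_zero])
      moreover have "M v x t * M w x t \<le> height * M w x t"
        by (intro mult_right_mono M_le_height less_imp_le[OF M_pos])
      ultimately have "\<bar>p * q\<bar> * \<bar>p * q\<bar> \<le> (K * K) * (height * M w x t)"
        using K by (intro mult_mono) auto
      also have "\<dots> = (K * ?h * sqrt (M w x t))\<^sup>2"
        unfolding power_mult_distrib using height_pos M_pos[of w x t] by (simp add: power2_eq_square)
      finally show "\<bar>p * q\<bar>\<^sup>2 \<le> (K * ?h * sqrt (M w x t))\<^sup>2" by (simp add: power2_eq_square)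
      show "0 \<le> K * ?h * sqrt (M w x t)" using K h less_imp_le[OF M_pos] by simp
    qed
    have "AE x in lborel. AE v in lborel. \<bar>collision ker F v x t\<bar>
      \<le> 2 * K * ?h * (mass * (LINT w|lebesgue. sqrt (M w x t) * norm (v - w) powr \<beta>))"
      unfolding collision_def
    proof (rule collision_slice_bound[OF R, where f = "\<lambda>x w. sqrt (M w x t)" and A = "\<lambda>v x. 2 * K * ?h"])
      fix v x w \<omega> :: "real ^ 'n"
      let ?v = "post_v v w \<omega>" and ?w = "post_vs v w \<omega>"
      let ?R = "\<lambda>v x. \<bar>F v x t\<bar> \<le> M v x t \<and> \<bar>F v x t\<bar> \<le> K"
      assume *: "norm \<omega> = 1" "v \<noteq> w" "?R v x" "?R w x" "?R ?v x" "?R ?w x"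
      have "\<bar>F ?v x t * F ?w x t\<bar> \<le> K * ?h * sqrt (M w x t)"
        by (rule geo[OF _ _ _ _ M_collision[OF *(1)]]) (use * in auto)
      moreover have "\<bar>F v x t * F w x t\<bar> \<le> K * ?h * sqrt (M w x t)"
        by (rule geo[OF _ _ _ _ refl]) (use * in auto)
      ultimately have "\<bar>F ?v x t * F ?w x t - F v x t * F w x t\<bar> \<le> 2 * K * ?h * sqrt (M w x t)"
        using abs_triangle_ineq4[of "F ?v x t * F ?w x t" "F v x t * F w x t"] by linarith
      then show "\<bar>collision_integrand ker F v x t (\<omega>, w)\<bar> \<le> 2 * K * ?h * sqrt (M w x t) * ker (v - w) \<omega>"
        using kernel_nonneg[OF *(1,2)] by (simp add: collision_integrand_def abs_mult mult_right_mono)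
    qed (use root K h in \<open>auto intro: less_imp_le[OF M_pos]\<close>)
    then have "AE x in lborel. AE v in lborel. \<bar>collision ker F v x t\<bar> \<le> K * \<alpha> t"
    proof eventually_elim
      case (elim x)
      then show ?case
      proof eventually_elim
        case (elim v)
        have "2 * K * ?h * (mass * (LINT w|lebesgue. sqrt (M w x t) * norm (v - w) powr \<beta>))
          \<le> 2 * K * ?h * (mass * (?h * L * (theta t / 2) powr (- decay)))"
          using K h mass_nonneg root by (intro mult_left_mono) auto
        then show ?case using elim by (simp add: \<alpha>_def mult_ac)
      qed
    qed
    then show "AE (v, x) in lborel. \<bar>collision ker F v x t\<bar> \<le> K * \<alpha> t"
      by (rule AE_lborel_swap_le[OF g, rotated]) simp
  qed
qed

end

section \<open>Scattering\<close>

context kinetic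
begin

text \<open>Future and past are treated together: as \<open>r\<close> tends to infinity,
  \<open>\<sigma> * r\<close> runs through \<open>I\<close> towards its infinite end.\<close>

context
  fixes I :: "real set" and t0 \<sigma> :: real
  assumes I_open: "open I"
    and I_between: "\<And>s t. s \<in> I \<Longrightarrow> t \<in> I \<Longrightarrow> {min s t..max s t} \<subseteq> I"
    and \<sigma>: "\<bar>\<sigma>\<bar> = 1"
    and I_unbounded: "\<exists>R. \<forall>r>R. \<sigma> * r \<in> I"
begin

lemma mild_solution_slices:
  assumes F: "mild_solution ker I F"
    and FM: "AE (v, x, t) in lebesgue. t \<in> I \<longrightarrow> \<bar>F v x t\<bar> \<le> M v x t"
  obtains g where "\<And>t. (\<lambda>p. g (fst p, snd p, t)) \<in> borel_measurable borel"
    "AE t in lborel. t \<in> I \<longrightarrow> (AE (v, x) in lborel. \<bar>F v x t\<bar> \<le> M v x t) \<and>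
       (AE (v, x) in lborel. collision ker F v x t = g (v, x, t)) \<and>
       (AE (v, x) in lborel. \<bar>collision ker F v x t\<bar> \<le> 2 * M v x t * sup_att t)"
proof -
  obtain g where g: "g \<in> borel_measurable borel"
    and eg: "AE (v, x, s) in lborel. s \<in> I \<longrightarrow> collision ker F v x s = g (v, x, s)"
    using mild_solution_duhamel[OF I_open F] by (auto simp: duhamel_def borel_on_def)
  have [measurable]: "g \<in> borel \<Otimes>\<^sub>M borel \<Otimes>\<^sub>M borel \<rightarrow>\<^sub>M borel" using g by (simp add: borel_prod)
  have gm: "(\<lambda>p. g (fst p, snd p, t)) \<in> borel_measurable borel" for t
    unfolding borel_prod[symmetric] by measurable
  have FM': "AE (v, x, t) in lborel. t \<in> I \<longrightarrow> \<bar>F v x t\<bar> \<le> M v x t" using FM by (simp only: AE_completion_iff)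
  show thesis
  proof (rule that[OF gm])
    show "AE t in lborel. t \<in> I \<longrightarrow> (AE (v, x) in lborel. \<bar>F v x t\<bar> \<le> M v x t) \<and>
       (AE (v, x) in lborel. collision ker F v x t = g (v, x, t)) \<and>
       (AE (v, x) in lborel. \<bar>collision ker F v x t\<bar> \<le> 2 * M v x t * sup_att t)"
      using AE_time_slices[OF FM'] AE_time_slices[OF eg]
    proof eventually_elim
      case (elim t)
      show ?case
      proof (intro impI)
        assume t: "t \<in> I"
        have 1: "AE (v, x) in lborel. \<bar>F v x t\<bar> \<le> M v x t" using elim(1) t by simp
        have 2: "AE (v, x) in lborel. collision ker F v x t = g (v, x, t)" using elim(2) t by simp
        from 2 have "AE (v, x) in lborel. collision ker F v x t = (\<lambda>p. g (fst p, snd p, t)) (v, x)" by simp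
        from collision_bound_Maxwellian[OF 1 gm this] 1 2
        show "(AE (v, x) in lborel. \<bar>F v x t\<bar> \<le> M v x t) \<and>
         (AE (v, x) in lborel. collision ker F v x t = g (v, x, t)) \<and>
         (AE (v, x) in lborel. \<bar>collision ker F v x t\<bar> \<le> 2 * M v x t * sup_att t)" by blast
      qed
    qed
  qed
qed

lemma Maxwellian_dominated_vanishes:
  assumes v0: "v0 \<noteq> 0" and F: "mild_solution ker I F"
    and FM: "AE (v, x, t) in lebesgue. t \<in> I \<longrightarrow> \<bar>F v x t\<bar> \<le> M v x t" and t: "t \<in> I"
  shows "AE (v, x) in lborel. F v x t = 0"
proof -
  obtain g where g: "\<And>t. (\<lambda>p. g (fst p, snd p, t)) \<in> borel_measurable borel"
    and slices: "AE t in lborel. t \<in> I \<longrightarrow> (AE (v, x) in lborel. \<bar>F v x t\<bar> \<le> M v x t) \<and>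
       (AE (v, x) in lborel. collision ker F v x t = g (v, x, t)) \<and>
       (AE (v, x) in lborel. \<bar>collision ker F v x t\<bar> \<le> 2 * M v x t * sup_att t)"
    using mild_solution_slices[OF F FM] by blast
  obtain \<alpha> where \<alpha>: "integrable lborel \<alpha>" "\<And>t. 0 \<le> \<alpha> t"
    "\<And>F K t g. AE (v, x) in lborel. \<bar>F v x t\<bar> \<le> M v x t \<Longrightarrow> AE (v, x) in lborel. \<bar>F v x t\<bar> \<le> K \<Longrightarrow> 0 \<le> K \<Longrightarrow>
       g \<in> borel_measurable borel \<Longrightarrow> AE (v, x) in lborel. collision ker F v x t = g (v, x) \<Longrightarrow>
       AE (v, x) in lborel. \<bar>collision ker F v x t\<bar> \<le> K * \<alpha> t"
    using collision_bound_uniform by blast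
  interpret duhamel_bound I F "\<lambda>v x t. collision ker F v x t" "\<lambda>v x t. 1" "\<lambda>v x. 1" \<alpha> height
  proof
    show "duhamel I F (\<lambda>v x t. collision ker F v x t)" by (rule mild_solution_duhamel[OF I_open F])
    show "AE t in lborel. t \<in> I \<longrightarrow> (AE (v, x) in lborel. \<bar>F v x t\<bar> \<le> height * 1)"
      using slices
    proof eventually_elim
      case (elim t)
      show ?case
      proof
        assume "t \<in> I"
        with elim have "AE (v, x) in lborel. \<bar>F v x t\<bar> \<le> M v x t" by blast
        then show "AE (v, x) in lborel. \<bar>F v x t\<bar> \<le> height * 1"
          by eventually_elim (auto intro: order_trans[OF _ M_le_height])
      qed
    qed
    show "AE t in lborel. t \<in> I \<longrightarrow> (\<forall>K\<ge>0. (AE (v, x) in lborel. \<bar>F v x t\<bar> \<le> K * 1) \<longrightarrow>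
           (AE (v, x) in lborel. \<bar>collision ker F v x t\<bar> \<le> K * 1 * \<alpha> t))"
      using slices
    proof eventually_elim
      case (elim t)
      show ?case
      proof (intro impI allI)
        fix K :: real
        assume t: "t \<in> I" and K: "0 \<le> K" "AE (v, x) in lborel. \<bar>F v x t\<bar> \<le> K * 1"
        have "AE (v, x) in lborel. collision ker F v x t = (\<lambda>p. g (fst p, snd p, t)) (v, x)" using elim t by simp
        from \<alpha>(3)[OF _ _ K(1) g this] elim t K(2)
        show "AE (v, x) in lborel. \<bar>collision ker F v x t\<bar> \<le> K * 1 * \<alpha> t" by simp
      qed
    qed
  qed (use I_open I_between \<alpha>(1,2) height_pos in \<open>auto simp: less_imp_le\<close>)
  obtain R where R: "\<And>r. R < r \<Longrightarrow> \<sigma> * r \<in> I" using I_unbounded by blast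
  have \<sigma>\<sigma>: "\<sigma> * \<sigma> = 1" using \<sigma> by (metis abs_mult_self_eq mult_1)
  \<comment> \<open>Domination by \<open>M\<close> is known only at almost every time, so the times
    tending to infinity are picked one by one from nonempty open sets.\<close>
  have "\<exists>r. real k < r \<and> \<sigma> * r \<in> I \<and> (AE (v, x) in lborel. \<bar>F v x (\<sigma> * r)\<bar> \<le> M v x (\<sigma> * r))" for k
  proof -
    define U where "U = I \<inter> {s. real k < \<sigma> * s}"
    have U: "open U" unfolding U_def by (intro open_Int I_open open_Collect_less continuous_intros)
    define r where "r = max R (real k) + 1"
    have "\<sigma> * r \<in> U" using R[of r] \<sigma>\<sigma> by (auto simp: U_def r_def simp flip: mult.assoc)
    moreover have "AE s in lborel. s \<in> U \<longrightarrow> (AE (v, x) in lborel. \<bar>F v x s\<bar> \<le> M v x s)"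
      using slices by eventually_elim (auto simp: U_def)
    ultimately obtain s where s: "s \<in> U" "AE (v, x) in lborel. \<bar>F v x s\<bar> \<le> M v x s"
      by (rule open_AE_witness[OF U])
    have eq: "\<sigma> * (\<sigma> * s) = s" using \<sigma>\<sigma> by (simp flip: mult.assoc)
    show ?thesis by (rule exI[of _ "\<sigma> * s"], unfold eq) (use s in \<open>auto simp: U_def\<close>)
  qed
  then have "\<exists>r. \<forall>k. real k < r k \<and> \<sigma> * r k \<in> I \<and> (AE (v, x) in lborel. \<bar>F v x (\<sigma> * r k)\<bar> \<le> M v x (\<sigma> * r k))"
    by (rule choice[OF allI])
  then obtain r where "\<forall>k. real k < r k \<and> \<sigma> * r k \<in> I \<and> (AE (v, x) in lborel. \<bar>F v x (\<sigma> * r k)\<bar> \<le> M v x (\<sigma> * r k))" ..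
  then have r: "real k < r k" "\<sigma> * r k \<in> I" "AE (v, x) in lborel. \<bar>F v x (\<sigma> * r k)\<bar> \<le> M v x (\<sigma> * r k)" for k
    by simp_all
  have r_top: "filterlim r at_top sequentially"
    by (rule filterlim_at_top_mono[OF filterlim_real_sequentially]) (use r(1) in \<open>auto intro: less_imp_le always_eventually\<close>)
  have "AE p in lborel. \<forall>k. case p of (v, x) \<Rightarrow> \<bar>F v (x + (\<sigma> * r k) *\<^sub>R v) (\<sigma> * r k)\<bar> \<le> M v (x + (\<sigma> * r k) *\<^sub>R v) (\<sigma> * r k)"
    unfolding AE_all_countable
  proof
    fix k
    show "AE p in lborel. case p of (v, x) \<Rightarrow> \<bar>F v (x + (\<sigma> * r k) *\<^sub>R v) (\<sigma> * r k)\<bar> \<le> M v (x + (\<sigma> * r k) *\<^sub>R v) (\<sigma> * r k)"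
      by (rule AE_transport[OF r(3)])
  qed
  then have lim: "AE (v, x) in lborel. (\<lambda>k. F v (x + (\<sigma> * r k) *\<^sub>R v) (\<sigma> * r k)) \<longlonglongrightarrow> 0"
  proof eventually_elim
    case (elim p)
    obtain v x where p: "p = (v, x)" by (cases p)
    obtain k where k: "0 < k" "\<And>t. M v (x + t *\<^sub>R v) t \<le> height * exp (k - t\<^sup>2 / k)"
      using M_transport_moving[OF v0, of v x] by blast
    have "(\<lambda>j. height * exp (k - (\<sigma> * r j)\<^sup>2 / k)) \<longlonglongrightarrow> height * 0"
    proof (intro tendsto_mult tendsto_const filterlim_compose[OF exp_at_bot])
      have "filterlim (\<lambda>j. - k + 1 / k * (r j)\<^sup>2) at_top sequentially"
        using k(1) by (intro filterlim_tendsto_add_at_top[OF tendsto_const] filterlim_tendsto_pos_mult_at_top[OF tendsto_const]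
            filterlim_pow_at_top r_top) auto
      then show "filterlim (\<lambda>j. k - (\<sigma> * r j)\<^sup>2 / k) at_bot sequentially"
        unfolding filterlim_uminus_at_bot
        by (simp add: power_mult_distrib power2_eq_square[of \<sigma>] \<sigma>\<sigma>)
    qed
    then have "(\<lambda>j. height * exp (k - (\<sigma> * r j)\<^sup>2 / k)) \<longlonglongrightarrow> 0" by simp
    then have "(\<lambda>j. F v (x + (\<sigma> * r j) *\<^sub>R v) (\<sigma> * r j)) \<longlonglongrightarrow> 0"
    proof (rule Lim_null_comparison[rotated])
      show "\<forall>\<^sub>F j in sequentially. norm (F v (x + (\<sigma> * r j) *\<^sub>R v) (\<sigma> * r j)) \<le> height * exp (k - (\<sigma> * r j)\<^sup>2 / k)"
        using elim k(2) by (intro always_eventually) (auto simp: p intro: order_trans)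
    qed
    then show ?case by (simp add: p)
  qed
  \<comment> \<open>The limit along characteristics is zero, so stability applies with
    \<open>L = 0\<close>.\<close>
  have "AE (v, x) in lborel. \<bar>F v x t\<bar> \<le> 0 * exp tot * 1"
    by (rule stability[OF \<sigma> r_top r(2) lim _ _ t]) auto
  then show ?thesis by eventually_elim auto
qed

text \<open>Along characteristics the free flow of \<open>G\<close> from time \<open>t0\<close> is
  the constant \<open>G v (x + t0 *\<^sub>R v)\<close>, and pulling back preserves the L1 norm of
  the error; a subsequence of the errors then tends to zero almost everywhere.\<close>

lemma scattering_limit:
  fixes F1 F2 :: "real ^ 'n \<Rightarrow> real ^ 'n \<Rightarrow> real \<Rightarrow> real"
  assumes F: "\<And>t. t \<in> I \<Longrightarrow> (\<lambda>(v, x). F1 v x t) \<in> borel_measurable lebesgue"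
      "\<And>t. t \<in> I \<Longrightarrow> (\<lambda>(v, x). F2 v x t) \<in> borel_measurable lebesgue"
    and G: "(\<lambda>(v, x). G1 v x) \<in> borel_measurable lebesgue" "(\<lambda>(v, x). G2 v x) \<in> borel_measurable lebesgue"
    and lim: "((\<lambda>r. L1_norm (\<lambda>v x. F1 v x (\<sigma> * r) - transport (- (\<sigma> * r - t0)) G1 v x)) \<longlongrightarrow> 0) at_top"
      "((\<lambda>r. L1_norm (\<lambda>v x. F2 v x (\<sigma> * r) - transport (- (\<sigma> * r - t0)) G2 v x)) \<longlongrightarrow> 0) at_top"
  obtains r :: "nat \<Rightarrow> real" where "filterlim r at_top sequentially" "\<And>k. \<sigma> * r k \<in> I"
    "AE (v, x) in lborel. (\<lambda>k. F1 v (x + (\<sigma> * r k) *\<^sub>R v) (\<sigma> * r k) - F2 v (x + (\<sigma> * r k) *\<^sub>R v) (\<sigma> * r k))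
        \<longlonglongrightarrow> G1 v (x + t0 *\<^sub>R v) - G2 v (x + t0 *\<^sub>R v)"
proof -
  obtain R where R: "\<And>r. R < r \<Longrightarrow> \<sigma> * r \<in> I" using I_unbounded by blast
  define q where "q k = real k + (\<bar>R\<bar> + 1)" for k :: nat
  have q: "\<sigma> * q k \<in> I" for k by (rule R) (simp add: q_def)
  have q_top: "filterlim q at_top sequentially"
    unfolding q_def by (rule filterlim_tendsto_add_at_top[OF tendsto_const filterlim_real_sequentially, of "\<bar>R\<bar> + 1", unfolded add.commute[of "\<bar>R\<bar> + 1"]])
  define \<phi> where "\<phi> F G k v x = F v x (\<sigma> * q k) - transport (- (\<sigma> * q k - t0)) G v x"
    for F :: "real ^ 'n \<Rightarrow> real ^ 'n \<Rightarrow> real \<Rightarrow> real" and G k v x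
  have m: "(\<lambda>(v, x). \<phi> F G k v x) \<in> borel_measurable lebesgue"
    if "\<And>t. t \<in> I \<Longrightarrow> (\<lambda>(v, x). F v x t) \<in> borel_measurable lebesgue" "(\<lambda>(v, x). G v x) \<in> borel_measurable lebesgue" for F G k
    using borel_measurable_diff[OF that(1)[OF q, of k] measurable_transport(1)[OF that(2), of "- (\<sigma> * q k - t0)"]]
    by (simp add: \<phi>_def transport_def case_prod_unfold)
  note m1 = m[of F1 G1, OF F(1) G(1)] and m2 = m[of F2 G2, OF F(2) G(2)]
  \<comment> \<open>The two errors are added so that one subsequence serves both solutions.\<close>
  define u where "u k p = \<bar>\<phi> F1 G1 k (fst p) (snd p + (\<sigma> * q k) *\<^sub>R fst p)\<bar> + \<bar>\<phi> F2 G2 k (fst p) (snd p + (\<sigma> * q k) *\<^sub>R fst p)\<bar>" for k p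
  have um1: "(\<lambda>p. \<phi> F1 G1 k (fst p) (snd p + (\<sigma> * q k) *\<^sub>R fst p)) \<in> borel_measurable lebesgue" for k
    using measurable_transport(1)[OF m1[of k], of "\<sigma> * q k"] by (simp add: case_prod_unfold)
  have um2: "(\<lambda>p. \<phi> F2 G2 k (fst p) (snd p + (\<sigma> * q k) *\<^sub>R fst p)) \<in> borel_measurable lebesgue" for k
    using measurable_transport(1)[OF m2[of k], of "\<sigma> * q k"] by (simp add: case_prod_unfold)
  have um: "u k \<in> borel_measurable lebesgue" for k
    unfolding u_def[abs_def] by (intro borel_measurable_add borel_measurable_abs um1 um2)
  have "(\<integral>\<^sup>+p. ennreal \<bar>u k p\<bar> \<partial>lebesgue) = L1_norm (\<phi> F1 G1 k) + L1_norm (\<phi> F2 G2 k)" for k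
  proof -
    have "(\<integral>\<^sup>+p. ennreal \<bar>u k p\<bar> \<partial>lebesgue) =
       (\<integral>\<^sup>+p. ennreal \<bar>\<phi> F1 G1 k (fst p) (snd p + (\<sigma> * q k) *\<^sub>R fst p)\<bar> + ennreal \<bar>\<phi> F2 G2 k (fst p) (snd p + (\<sigma> * q k) *\<^sub>R fst p)\<bar> \<partial>lebesgue)"
      by (rule nn_integral_cong) (simp add: u_def)
    also have "\<dots> = (\<integral>\<^sup>+p. ennreal \<bar>\<phi> F1 G1 k (fst p) (snd p + (\<sigma> * q k) *\<^sub>R fst p)\<bar> \<partial>lebesgue)
       + (\<integral>\<^sup>+p. ennreal \<bar>\<phi> F2 G2 k (fst p) (snd p + (\<sigma> * q k) *\<^sub>R fst p)\<bar> \<partial>lebesgue)"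
      by (intro nn_integral_add measurable_compose[OF _ measurable_ennreal] borel_measurable_abs um1 um2)
    also have "\<dots> = L1_norm (\<phi> F1 G1 k) + L1_norm (\<phi> F2 G2 k)"
      using measurable_transport(2)[OF m1[of k], of "\<sigma> * q k"] measurable_transport(2)[OF m2[of k], of "\<sigma> * q k"]
      by (simp add: L1_norm_def case_prod_unfold)
    finally show ?thesis .
  qed
  moreover have "(\<lambda>k. L1_norm (\<phi> F1 G1 k) + L1_norm (\<phi> F2 G2 k)) \<longlonglongrightarrow> 0 + 0"
    unfolding \<phi>_def by (intro tendsto_add filterlim_compose[OF lim(1) q_top] filterlim_compose[OF lim(2) q_top])
  ultimately have "(\<lambda>k. \<integral>\<^sup>+p. ennreal \<bar>u k p\<bar> \<partial>lebesgue) \<longlonglongrightarrow> 0" by simp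
  from L1_null_sequence_subseq[OF um this] obtain s where
    s: "strict_mono s" "AE p in lebesgue. (\<lambda>k. u (s k) p) \<longlonglongrightarrow> 0" .
  show thesis
  proof (rule that[of "\<lambda>k. q (s k)"])
    show "filterlim (\<lambda>k. q (s k)) at_top sequentially"
      by (rule filterlim_compose[OF q_top filterlim_subseq[OF s(1)]])
    show "\<sigma> * q (s k) \<in> I" for k by (rule q)
    have "AE p in lborel. (\<lambda>k. u (s k) p) \<longlonglongrightarrow> 0" using s(2) by (simp only: AE_completion_iff)
    then show "AE (v, x) in lborel. (\<lambda>k. F1 v (x + (\<sigma> * q (s k)) *\<^sub>R v) (\<sigma> * q (s k)) - F2 v (x + (\<sigma> * q (s k)) *\<^sub>R v) (\<sigma> * q (s k)))
        \<longlonglongrightarrow> G1 v (x + t0 *\<^sub>R v) - G2 v (x + t0 *\<^sub>R v)"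
    proof eventually_elim
      case (elim p)
      obtain v x where p: "p = (v, x)" by (cases p)
      define D where "D k = F1 v (x + (\<sigma> * q (s k)) *\<^sub>R v) (\<sigma> * q (s k)) - F2 v (x + (\<sigma> * q (s k)) *\<^sub>R v) (\<sigma> * q (s k))" for k
      define L where "L = G1 v (x + t0 *\<^sub>R v) - G2 v (x + t0 *\<^sub>R v)"
      have sh: "x + T *\<^sub>R v + (t0 - T) *\<^sub>R v = x + t0 *\<^sub>R v" for T
        by (simp add: algebra_simps)
      have eq: "D k - L = \<phi> F1 G1 (s k) v (x + (\<sigma> * q (s k)) *\<^sub>R v) - \<phi> F2 G2 (s k) v (x + (\<sigma> * q (s k)) *\<^sub>R v)" for k
        by (simp add: D_def L_def \<phi>_def transport_def sh)
      have "\<bar>D k - L\<bar> \<le> u (s k) (v, x)" for k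
        unfolding eq u_def fst_conv snd_conv by (rule abs_triangle_ineq4)
      then have "(\<lambda>k. D k - L) \<longlonglongrightarrow> 0"
        using elim by (intro Lim_null_comparison[of "\<lambda>k. D k - L" "\<lambda>k. u (s k) p"]) (auto simp: p)
      then have "D \<longlonglongrightarrow> L" by (rule LIM_zero_cancel)
      then show ?case by (simp add: p D_def[abs_def] L_def)
    qed
  qed
qed

lemma weighted_stability:
  assumes F: "mild_solution ker I F1" "mild_solution ker I F2"
    and FM: "AE (v, x, t) in lebesgue. t \<in> I \<longrightarrow> \<bar>F1 v x t\<bar> \<le> M v x t"
      "AE (v, x, t) in lebesgue. t \<in> I \<longrightarrow> \<bar>F2 v x t\<bar> \<le> M v x t"
    and G: "(\<lambda>(v, x). G1 v x) \<in> borel_measurable lebesgue" "(\<lambda>(v, x). G2 v x) \<in> borel_measurable lebesgue"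
    and lim: "((\<lambda>r. L1_norm (\<lambda>v x. F1 v x (\<sigma> * r) - transport (- (\<sigma> * r - t0)) G1 v x)) \<longlongrightarrow> 0) at_top"
      "((\<lambda>r. L1_norm (\<lambda>v x. F2 v x (\<sigma> * r) - transport (- (\<sigma> * r - t0)) G2 v x)) \<longlongrightarrow> 0) at_top"
    and L: "0 \<le> L" "AE (v, x) in lborel. \<bar>G1 v x - G2 v x\<bar> \<le> L * M v x t0" and t: "t \<in> I"
  shows "AE (v, x) in lborel. \<bar>F1 v x t - F2 v x t\<bar> \<le> L * exp (4 * mu \<beta> bh M) * M v x t"
proof (cases "v0 = 0")
  case False
  have z: "AE (v, x) in lborel. F1 v x t = 0" "AE (v, x) in lborel. F2 v x t = 0"
    by (rule Maxwellian_dominated_vanishes[OF False F(1) FM(1) t] Maxwellian_dominated_vanishes[OF False F(2) FM(2) t])+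
  then show ?thesis
    by eventually_elim (use L(1) in \<open>auto intro!: mult_nonneg_nonneg less_imp_le[OF M_pos]\<close>)
next
  case True
  obtain g1 where g1: "\<And>t. (\<lambda>p. g1 (fst p, snd p, t)) \<in> borel_measurable borel"
    and slices1: "AE t in lborel. t \<in> I \<longrightarrow> (AE (v, x) in lborel. \<bar>F1 v x t\<bar> \<le> M v x t) \<and>
       (AE (v, x) in lborel. collision ker F1 v x t = g1 (v, x, t)) \<and>
       (AE (v, x) in lborel. \<bar>collision ker F1 v x t\<bar> \<le> 2 * M v x t * sup_att t)"
    using mild_solution_slices[OF F(1) FM(1)] by blast
  obtain g2 where g2: "\<And>t. (\<lambda>p. g2 (fst p, snd p, t)) \<in> borel_measurable borel"
    and slices2: "AE t in lborel. t \<in> I \<longrightarrow> (AE (v, x) in lborel. \<bar>F2 v x t\<bar> \<le> M v x t) \<and>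
       (AE (v, x) in lborel. collision ker F2 v x t = g2 (v, x, t)) \<and>
       (AE (v, x) in lborel. \<bar>collision ker F2 v x t\<bar> \<le> 2 * M v x t * sup_att t)"
    using mild_solution_slices[OF F(2) FM(2)] by blast
  have bound: "AE s in lborel. s \<in> I \<longrightarrow> (AE (v, x) in lborel. \<bar>collision ker F v x s\<bar> \<le> 2 * height * sup_att s)"
    if "AE t in lborel. t \<in> I \<longrightarrow> (AE (v, x) in lborel. \<bar>F v x t\<bar> \<le> M v x t) \<and>
       (AE (v, x) in lborel. collision ker F v x t = g (v, x, t)) \<and>
       (AE (v, x) in lborel. \<bar>collision ker F v x t\<bar> \<le> 2 * M v x t * sup_att t)" for F g
    using that
  proof eventually_elim
    case (elim s)
    show ?case
    proof
      assume "s \<in> I"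
      with elim have "AE (v, x) in lborel. \<bar>collision ker F v x s\<bar> \<le> 2 * M v x s * sup_att s" by blast
      then show "AE (v, x) in lborel. \<bar>collision ker F v x s\<bar> \<le> 2 * height * sup_att s"
      proof eventually_elim
        case (elim p)
        obtain v x where p: "p = (v, x)" by (cases p)
        have "2 * M v x s * sup_att s \<le> 2 * height * sup_att s"
          by (intro mult_right_mono mult_left_mono M_le_height sup_att_nonneg) simp
        then show ?case using elim by (simp add: p)
      qed
    qed
  qed
  \<comment> \<open>As \<open>M\<close> is at most \<open>height\<close>, each collision integral
    has a bound depending on time alone, which is the form that subtracting the Duhamel formulas
    requires.\<close>
  have du: "duhamel I (\<lambda>v x t. F1 v x t - F2 v x t) (\<lambda>v x t. collision ker F1 v x t - collision ker F2 v x t)"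
  proof (rule duhamel_diff[OF mild_solution_duhamel[OF I_open F(1)] mild_solution_duhamel[OF I_open F(2)] I_between])
    show "integrable lborel (\<lambda>s. 2 * height * sup_att s)" by (intro integrable_mult_right sup_att_integrable)
  qed (use bound[OF slices1] bound[OF slices2] in auto)
  \<comment> \<open>The constant 2 adds the two dominations by \<open>M\<close>; the rate
    \<open>4 * sup_att t\<close> integrates to the exponent
    \<open>4 * mu \<beta> bh M\<close>.\<close>
  interpret duhamel_bound I "\<lambda>v x t. F1 v x t - F2 v x t" "\<lambda>v x t. collision ker F1 v x t - collision ker F2 v x t"
    M "\<lambda>v x. M v x 0" "\<lambda>t. 4 * sup_att t" 2
  proof
    show "{min s t..max s t} \<subseteq> I" if "s \<in> I" "t \<in> I" for s t by (rule I_between[OF that])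
    show "open I" by (rule I_open)
    show "(\<lambda>(v, x, t). M v x t) \<in> borel_measurable borel" by (rule M_measurable)
    show "duhamel I (\<lambda>v x t. F1 v x t - F2 v x t) (\<lambda>v x t. collision ker F1 v x t - collision ker F2 v x t)" by (rule du)
    show "integrable lborel (\<lambda>t. 4 * sup_att t)" by (intro integrable_mult_right sup_att_integrable)
    show "AE t in lborel. t \<in> I \<longrightarrow> (AE (v, x) in lborel. \<bar>F1 v x t - F2 v x t\<bar> \<le> 2 * M v x t)"
      using slices1 slices2
    proof eventually_elim
      case (elim t)
      show ?case
      proof
        assume "t \<in> I"
        with elim have "AE (v, x) in lborel. \<bar>F1 v x t\<bar> \<le> M v x t" "AE (v, x) in lborel. \<bar>F2 v x t\<bar> \<le> M v x t" by blast+
        then show "AE (v, x) in lborel. \<bar>F1 v x t - F2 v x t\<bar> \<le> 2 * M v x t" by eventually_elim auto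
      qed
    qed
    show "AE t in lborel. t \<in> I \<longrightarrow> (\<forall>K\<ge>0. (AE (v, x) in lborel. \<bar>F1 v x t - F2 v x t\<bar> \<le> K * M v x t) \<longrightarrow>
           (AE (v, x) in lborel. \<bar>collision ker F1 v x t - collision ker F2 v x t\<bar> \<le> K * M v x t * (4 * sup_att t)))"
      using slices1 slices2 AE_integrand_integrable[OF F(1)] AE_integrand_integrable[OF F(2)]
    proof eventually_elim
      case (elim t)
      show ?case
      proof (intro impI allI)
        fix K :: real
        assume t: "t \<in> I" and K: "0 \<le> K" "AE (v, x) in lborel. \<bar>F1 v x t - F2 v x t\<bar> \<le> K * M v x t"
        let ?g = "\<lambda>p. g1 (fst p, snd p, t) - g2 (fst p, snd p, t)"
        have gm: "?g \<in> borel_measurable borel" by (intro borel_measurable_diff g1 g2)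
        have "AE (v, x) in lborel. collision ker F1 v x t = g1 (v, x, t)" "AE (v, x) in lborel. collision ker F2 v x t = g2 (v, x, t)"
          using elim t by blast+
        then have "AE (v, x) in lborel. collision ker F1 v x t - collision ker F2 v x t = ?g (v, x)"
          by eventually_elim auto
        from collision_diff_bound_Maxwellian[OF _ _ K(2,1) gm this] elim t
        show "AE (v, x) in lborel. \<bar>collision ker F1 v x t - collision ker F2 v x t\<bar> \<le> K * M v x t * (4 * sup_att t)"
          by (simp add: mult_ac)
      qed
    qed
  qed (auto simp: M_pos M_transport_rest[OF True] sup_att_nonneg)
  have tot: "tot = 4 * mu \<beta> bh M" by (simp add: tot_def integral_sup_att)
  have "(\<lambda>(v, x). F1 v x t) \<in> borel_measurable lebesgue" "(\<lambda>(v, x). F2 v x t) \<in> borel_measurable lebesgue" if "t \<in> I" for t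
    by (rule duhamel_slice_measurable[OF mild_solution_duhamel[OF I_open F(1)] I_open that I_between]
        duhamel_slice_measurable[OF mild_solution_duhamel[OF I_open F(2)] I_open that I_between], assumption+)+
  from scattering_limit[OF this G lim] obtain r where r: "filterlim r at_top sequentially" "\<And>k. \<sigma> * r k \<in> I"
    "AE (v, x) in lborel. (\<lambda>k. F1 v (x + (\<sigma> * r k) *\<^sub>R v) (\<sigma> * r k) - F2 v (x + (\<sigma> * r k) *\<^sub>R v) (\<sigma> * r k))
        \<longlonglongrightarrow> G1 v (x + t0 *\<^sub>R v) - G2 v (x + t0 *\<^sub>R v)" by blast
  \<comment> \<open>The data are compared with \<open>M\<close> at time \<open>t0\<close>, but the
    limit lives on characteristics. Since \<open>M\<close> is transported freely, its value at time
    \<open>t0\<close> there equals the weight \<open>M v x 0\<close>.\<close>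
  have "AE (v, x) in lborel. \<bar>G1 v (x + t0 *\<^sub>R v) - G2 v (x + t0 *\<^sub>R v)\<bar> \<le> L * M v (x + t0 *\<^sub>R v) t0"
    by (rule AE_transport) (rule L(2))
  then have "AE (v, x) in lborel. \<bar>G1 v (x + t0 *\<^sub>R v) - G2 v (x + t0 *\<^sub>R v)\<bar> \<le> L * M v x 0"
    by (simp only: M_transport_rest[OF True])
  from stability[OF \<sigma> r(1,2,3) L(1) this t] show ?thesis by (simp only: tot)
qed

lemma scattering_stability:
  assumes F: "mild_solution ker I F1" "mild_solution ker I F2"
    and FM: "AE (v, x, t) in lebesgue. t \<in> I \<longrightarrow> \<bar>F1 v x t\<bar> \<le> M v x t"
      "AE (v, x, t) in lebesgue. t \<in> I \<longrightarrow> \<bar>F2 v x t\<bar> \<le> M v x t"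
    and G: "(\<lambda>(v, x). G1 v x) \<in> borel_measurable lebesgue" "(\<lambda>(v, x). G2 v x) \<in> borel_measurable lebesgue"
    and lim: "((\<lambda>r. L1_norm (\<lambda>v x. F1 v x (\<sigma> * r) - transport (- (\<sigma> * r - t0)) G1 v x)) \<longlongrightarrow> 0) at_top"
      "((\<lambda>r. L1_norm (\<lambda>v x. F2 v x (\<sigma> * r) - transport (- (\<sigma> * r - t0)) G2 v x)) \<longlongrightarrow> 0) at_top"
    and t: "t \<in> I"
  shows "weighted_norm M t (\<lambda>v x. F1 v x t - F2 v x t)
       \<le> weighted_norm M t0 (\<lambda>v x. G1 v x - G2 v x) * ennreal (exp (4 * mu \<beta> bh M))" (is "_ \<le> ?W * _")
    and "AE (v, x) in lebesgue. G1 v x = G2 v x \<Longrightarrow> AE (v, x) in lebesgue. F1 v x t = F2 v x t"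
proof -
  note stab = weighted_stability[OF F FM G lim _ _ t]
  show "weighted_norm M t (\<lambda>v x. F1 v x t - F2 v x t) \<le> ?W * ennreal (exp (4 * mu \<beta> bh M))"
  proof (cases "?W = top")
    \<comment> \<open>The exponential is positive, so an infinite norm of the data makes the
      right-hand side infinite.\<close>
    case True
    then show ?thesis by (simp add: ennreal_top_mult)
  next
    case False
    define L where "L = enn2real ?W"
    have L: "ennreal L = ?W" "0 \<le> L" using False by (auto simp: L_def less_top)
    have "AE p in lebesgue. (case p of (v, x) \<Rightarrow> ennreal \<bar>(G1 v x - G2 v x) / M v x t0\<bar>) \<le> ennreal L"
      unfolding L(1) weighted_norm_def Linf_norm_def by (rule esssup_AE)
    then have "AE p in lborel. (case p of (v, x) \<Rightarrow> ennreal \<bar>(G1 v x - G2 v x) / M v x t0\<bar>) \<le> ennreal L"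
      by (simp only: AE_completion_iff)
    then have "AE (v, x) in lborel. \<bar>G1 v x - G2 v x\<bar> \<le> L * M v x t0"
    proof eventually_elim
      case (elim p)
      obtain v x where p: "p = (v, x)" by (cases p)
      have "\<bar>G1 v x - G2 v x\<bar> / M v x t0 \<le> L"
        using elim L(2) M_pos[of v x t0] by (simp add: p)
      then show ?case using M_pos[of v x t0] by (simp add: p pos_divide_le_eq)
    qed
    from stab[OF L(2) this] have b: "AE (v, x) in lborel. \<bar>F1 v x t - F2 v x t\<bar> \<le> L * exp (4 * mu \<beta> bh M) * M v x t" .
    have "weighted_norm M t (\<lambda>v x. F1 v x t - F2 v x t) \<le> ennreal (L * exp (4 * mu \<beta> bh M))"
      unfolding weighted_norm_def Linf_norm_def
    proof (rule esssup_I)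
      have "(\<lambda>(v, x). F1 v x t) \<in> borel_measurable lebesgue" "(\<lambda>(v, x). F2 v x t) \<in> borel_measurable lebesgue"
        by (rule duhamel_slice_measurable[OF mild_solution_duhamel[OF I_open F(1)] I_open t I_between]
            duhamel_slice_measurable[OF mild_solution_duhamel[OF I_open F(2)] I_open t I_between], assumption+)+
      moreover have "(\<lambda>p. M (fst p) (snd p) t) \<in> borel_measurable lebesgue"
        by (rule measurable_completion) (simp add: lborel_prod[symmetric])
      ultimately show "(\<lambda>(v, x). ennreal \<bar>(F1 v x t - F2 v x t) / M v x t\<bar>) \<in> borel_measurable lebesgue"
        by (simp add: case_prod_unfold)
      show "AE p in lebesgue. (case p of (v, x) \<Rightarrow> ennreal \<bar>(F1 v x t - F2 v x t) / M v x t\<bar>) \<le> ennreal (L * exp (4 * mu \<beta> bh M))"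
        unfolding AE_completion_iff using b
      proof eventually_elim
        case (elim p)
        obtain v x where p: "p = (v, x)" by (cases p)
        have "\<bar>(F1 v x t - F2 v x t) / M v x t\<bar> \<le> L * exp (4 * mu \<beta> bh M)"
          using elim M_pos[of v x t] by (simp add: p pos_divide_le_eq)
        then show ?case by (simp add: p ennreal_leI)
      qed
    qed
    also have "\<dots> = ?W * ennreal (exp (4 * mu \<beta> bh M))" using L by (simp add: ennreal_mult)
    finally show ?thesis .
  qed
  assume "AE (v, x) in lebesgue. G1 v x = G2 v x"
  then have "AE (v, x) in lborel. G1 v x = G2 v x" by (simp only: AE_completion_iff)
  \<comment> \<open>Uniqueness is the estimate with \<open>L = 0\<close>.\<close>
  then have "AE (v, x) in lborel. \<bar>G1 v x - G2 v x\<bar> \<le> 0 * M v x t0" by eventually_elim auto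
  from stab[OF order_refl this] have "AE (v, x) in lborel. F1 v x t = F2 v x t" by eventually_elim auto
  then show "AE (v, x) in lebesgue. F1 v x t = F2 v x t" by (simp only: AE_completion_iff)
qed

end

end

theorem theorem2p5:
  fixes b :: "real ^ 'n \<Rightarrow> real ^ 'n \<Rightarrow> real"
    and bh :: "real \<Rightarrow> real"
    and \<beta> t0 :: real
    and M F1 F2 :: "real ^ 'n \<Rightarrow> real ^ 'n \<Rightarrow> real \<Rightarrow> real"
    and G1 G2 :: "real ^ 'n \<Rightarrow> real ^ 'n \<Rightarrow> real"
  assumes "1 - real CARD('n) < \<beta>" and "\<beta> \<le> 0"
    and "separated_kernel \<beta> bh b"
    and "global_Maxwellian M"
    and "(\<lambda>(v, x). G1 v x) \<in> borel_measurable lebesgue"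
    and "(\<lambda>(v, x). G2 v x) \<in> borel_measurable lebesgue"
  shows
    "(mild_solution b {t0<..} F1 \<longrightarrow>
      mild_solution b {t0<..} F2 \<longrightarrow>
      (AE (v, x, t) in lebesgue. t0 < t \<longrightarrow> \<bar>F1 v x t\<bar> \<le> M v x t) \<longrightarrow>
      (AE (v, x, t) in lebesgue. t0 < t \<longrightarrow> \<bar>F2 v x t\<bar> \<le> M v x t) \<longrightarrow>
      ((\<lambda>t. L1_norm (\<lambda>v x. F1 v x t - transport (- (t - t0)) G1 v x)) \<longlongrightarrow> 0) at_top \<longrightarrow>
      ((\<lambda>t. L1_norm (\<lambda>v x. F2 v x t - transport (- (t - t0)) G2 v x)) \<longlongrightarrow> 0) at_top \<longrightarrow>
      (\<forall>t>t0. weighted_norm M t (\<lambda>v x. F1 v x t - F2 v x t)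
               \<le> weighted_norm M t0 (\<lambda>v x. G1 v x - G2 v x) * ennreal (exp (4 * mu \<beta> bh M))) \<and>
      ((AE (v, x) in lebesgue. G1 v x = G2 v x) \<longrightarrow>
        (\<forall>t>t0. AE (v, x) in lebesgue. F1 v x t = F2 v x t)))
     \<and>
     (mild_solution b {..<t0} F1 \<longrightarrow>
      mild_solution b {..<t0} F2 \<longrightarrow>
      (AE (v, x, t) in lebesgue. t < t0 \<longrightarrow> \<bar>F1 v x t\<bar> \<le> M v x t) \<longrightarrow>
      (AE (v, x, t) in lebesgue. t < t0 \<longrightarrow> \<bar>F2 v x t\<bar> \<le> M v x t) \<longrightarrow>
      ((\<lambda>t. L1_norm (\<lambda>v x. F1 v x t - transport (- (t - t0)) G1 v x)) \<longlongrightarrow> 0) at_bot \<longrightarrow>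
      ((\<lambda>t. L1_norm (\<lambda>v x. F2 v x t - transport (- (t - t0)) G2 v x)) \<longlongrightarrow> 0) at_bot \<longrightarrow>
      (\<forall>t<t0. weighted_norm M t (\<lambda>v x. F1 v x t - F2 v x t)
               \<le> weighted_norm M t0 (\<lambda>v x. G1 v x - G2 v x) * ennreal (exp (4 * mu \<beta> bh M))) \<and>
      ((AE (v, x) in lebesgue. G1 v x = G2 v x) \<longrightarrow>
        (\<forall>t<t0. AE (v, x) in lebesgue. F1 v x t = F2 v x t)))"
proof -
  obtain m a b' c x0 v0 B where M: "0 < m" "0 < a" "0 < c" "transpose B = - B"
     "\<And>y. y \<noteq> 0 \<Longrightarrow> 0 < y \<bullet> (Maxwellian_Q a b' c B *v y)"
     "\<And>v x t. M v x t = m / (2 * pi) ^ CARD('n) * sqrt (det (Maxwellian_Q a b' c B)) *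
           exp (- Maxwellian_q a b' c B (v - v0) (x - x0) t)"
    using assms(4) unfolding global_Maxwellian_def by metis
  interpret kinetic M m a b' c x0 v0 B \<beta> bh b
    by unfold_locales (fact M assms)+
  \<comment> \<open>The past is the case \<open>\<sigma> = - 1\<close>, so limits at minus infinity
    are reparametrised by \<open>r = - t\<close>.\<close>
  have flip: "((\<lambda>r. f (- 1 * r)) \<longlongrightarrow> 0) at_top" if "(f \<longlongrightarrow> 0) at_bot" for f :: "real \<Rightarrow> ennreal"
    using filterlim_compose[OF that filterlim_uminus_at_bot_at_top] by simp
  show ?thesis
  proof (intro conjI impI allI)
    fix t
    assume F: "mild_solution b {t0<..} F1" "mild_solution b {t0<..} F2"
      and FM: "AE (v, x, t) in lebesgue. t0 < t \<longrightarrow> \<bar>F1 v x t\<bar> \<le> M v x t"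
        "AE (v, x, t) in lebesgue. t0 < t \<longrightarrow> \<bar>F2 v x t\<bar> \<le> M v x t"
      and lim: "((\<lambda>t. L1_norm (\<lambda>v x. F1 v x t - transport (- (t - t0)) G1 v x)) \<longlongrightarrow> 0) at_top"
        "((\<lambda>t. L1_norm (\<lambda>v x. F2 v x t - transport (- (t - t0)) G2 v x)) \<longlongrightarrow> 0) at_top"
      and t: "t0 < t"
    note stab = scattering_stability[where I = "{t0<..}" and \<sigma> = 1, unfolded mult_1 greaterThan_iff,
        OF _ _ _ _ F FM assms(5,6) lim t]
    show "weighted_norm M t (\<lambda>v x. F1 v x t - F2 v x t)
               \<le> weighted_norm M t0 (\<lambda>v x. G1 v x - G2 v x) * ennreal (exp (4 * mu \<beta> bh M))"
      by (rule stab(1)) auto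
    show "AE (v, x) in lebesgue. F1 v x t = F2 v x t" if "AE (v, x) in lebesgue. G1 v x = G2 v x"
      by (rule stab(2)[OF _ _ _ _ that]) auto
  next
    fix t
    assume F: "mild_solution b {..<t0} F1" "mild_solution b {..<t0} F2"
      and FM: "AE (v, x, t) in lebesgue. t < t0 \<longrightarrow> \<bar>F1 v x t\<bar> \<le> M v x t"
        "AE (v, x, t) in lebesgue. t < t0 \<longrightarrow> \<bar>F2 v x t\<bar> \<le> M v x t"
      and lim: "((\<lambda>t. L1_norm (\<lambda>v x. F1 v x t - transport (- (t - t0)) G1 v x)) \<longlongrightarrow> 0) at_bot"
        "((\<lambda>t. L1_norm (\<lambda>v x. F2 v x t - transport (- (t - t0)) G2 v x)) \<longlongrightarrow> 0) at_bot"
      and t: "t < t0"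
    note stab = scattering_stability[where I = "{..<t0}" and \<sigma> = "- 1", unfolded lessThan_iff,
        OF _ _ _ _ F FM assms(5,6) flip[OF lim(1)] flip[OF lim(2)] t]
    show "weighted_norm M t (\<lambda>v x. F1 v x t - F2 v x t)
               \<le> weighted_norm M t0 (\<lambda>v x. G1 v x - G2 v x) * ennreal (exp (4 * mu \<beta> bh M))"
      by (rule stab(1)) (auto intro!: exI[of _ "- t0"])
    show "AE (v, x) in lebesgue. F1 v x t = F2 v x t" if "AE (v, x) in lebesgue. G1 v x = G2 v x"
      by (rule stab(2)[OF _ _ _ _ that]) (auto intro!: exI[of _ "- t0"])
  qed
qed

end
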